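(* Let $m,n$ be positive integers with $m<n+1$. If $E\subset\mathbb{P}^n$ is $\mathcal{H}_E^m$ measurable and Euclidean $m$-rectifiable (where $\mathcal{H}^m_E$ is the Euclidean $m$-dimensional Hausdorff measure), then it is parabolic $(m+1)$-rectifiable. Moreover, if $\mathcal{H}_E^{m}(E)<\infty$, then: (1) if for $\mathcal{H}_E^m$ almost all $a\in E$ the Euclidean approximate tangent plane of $E$ at $a$ is not contained in $H=\mathbb{R}^n\times\{0\}$, then $E$ is vertically parabolic $(m+1)$-rectifiable; (2) if for $\mathcal{H}_E^m$ almost all $a\in E$ the Euclidean approximate tangent plane of $E$ at $a$ is contained in $H$, then $\mathcal{H}^{m+1}(E)=0$.
   Context: Setting: $\mathbb{P}^n=\mathbb{R}^n\times\mathbb{R}$ with $\|(x,t)\|=\sqrt{|x|^2+|t|}$ and the metric $d(p,q)=\|p-q\|$. $\mathcal{H}^s$ is the Hausdorff measure with respect to $d$, $\mathcal{H}^s(A)=\lim_{\delta\to0}\inf\{\sum_i d(E_i)^s: A\subset\bigcup_i E_i,\ d(E_i)<\delta\}$, $d(E_i)$ being the $d$-diameter; $\mathcal{H}^s_E$ is defined in the same way with the Euclidean diameter (the subscript $E$ stands for "Euclidean"). Planes: for an integer $k$ with $1\le k\le n$, $H(n,k)$ is the set of linear $k$-dimensional subspaces of $\mathbb{R}^n\times\{0\}$; for $2\le k\le n+1$, $V(n,k)$ is the set of linear $(k-1)$-dimensional subspaces of $\mathbb{R}^{n+1}$ containing $\{0\}\times\mathbb{R}$; $P(n,k)=H(n,k)\cup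 V(n,k)$ (one of the two being empty when its index range fails). $V^\perp$ is the orthogonal complement of $V$ in $\mathbb{R}^{n+1}$. A $(k,L)$-Lipschitz graph is a set $\{x+g(x):x\in A\}$ with $A\subset V\in P(n,k)$ and $g:A\to V^\perp$ satisfying $\|g(x)-g(y)\|\le L\|x-y\|$ for $x,y\in A$; it is called vertical if this holds with $V\in V(n,k)$. $E$ is parabolic (resp. vertically parabolic) $k$-rectifiable if for every $0<L<\infty$ there are $(k,L)$-Lipschitz graphs (resp. vertical $(k,L)$-Lipschitz graphs) $G_1,G_2,\dots$ with $\mathcal{H}^k(E\setminus\bigcup_iG_i)=0$. $E\subset\mathbb{R}^{n+1}$ is Euclidean $m$-rectifiable if there are sets $A_i\subset\mathbb{R}^m$ and (Euclidean) Lipschitz maps $f_i:A_i\to\mathbb{R}^{n+1}$, $i=1,2,\dots$, with $\mathcal{H}^m_E(E\setminus\bigcup_if_i(A_i))=0$. A linear $m$-dimensional subspace $V$ of $\mathbb{R}^{n+1}$ is a Euclidean approximate tangent plane of $E$ at $a$ if for every $0<s<1$, $\lim_{r\to0}r^{-m}\mathcal{H}^m_E(E\cap B_E(a,r)\setminus X_E(a,V,s))=0$, where $B_E(a,r)$ is the closed Euclidean ball and $X_E(a,V,s)=\{p: d_E(p-a,V)<s|p-a|\}$, $d_E$ the Euclidean distance. It is classical that for an $\mathcal{H}^m_E$ measurable Euclidean $m$-rectifiable $E$ with $\mathcal{H}^m_E(E)<\infty$ such a plane exists and is unique at $\mathcal{H}^m_E$ almost all points of $E$. *)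

theory Defs
  imports "HOL-Analysis.Analysis"
begin

section \<open>Hausdorff measures\<close>

text \<open>The metric is a parameter, because the same set carries both the Euclidean and the
  parabolic Hausdorff measures. The library's real-valued \<open>diameter\<close> is unspecified on
  unbounded sets; here these have diameter \<open>\<infinity>\<close>.\<close>

definition ediameter :: "('a \<Rightarrow> 'a \<Rightarrow> real) \<Rightarrow> 'a set \<Rightarrow> ennreal" where
  "ediameter d A = (SUP p\<in>A. SUP q\<in>A. ennreal (d p q))"

definition hausdorff_pre :: "('a \<Rightarrow> 'a \<Rightarrow> real) \<Rightarrow> nat \<Rightarrow> real \<Rightarrow> 'a set \<Rightarrow> ennreal" where
  "hausdorff_pre d k \<delta> A =
     (INF U \<in> {U :: nat \<Rightarrow> 'a set. A \<subseteq> (\<Union>i. U i) \<and> (\<forall>i. ediameter d (U i) < ennreal \<delta>)}.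
        \<Sum>i. ediameter d (U i) ^ k)"

text \<open>Used for integer exponents \<open>k \<ge> 1\<close> only; then the empty set contributes \<open>0\<close> to the sums
  above, so finite covers are included. As an outer measure it is defined on all sets.\<close>

definition hausdorff :: "('a \<Rightarrow> 'a \<Rightarrow> real) \<Rightarrow> nat \<Rightarrow> 'a set \<Rightarrow> ennreal" where
  "hausdorff d k A = Lim (at_right 0) (\<lambda>\<delta>. hausdorff_pre d k \<delta> A)"

lemma hausdorff_pre_antimono:
  assumes "\<delta> \<le> \<epsilon>"
  shows "hausdorff_pre d k \<epsilon> A \<le> hausdorff_pre d k \<delta> A"
  unfolding hausdorff_pre_def
  by (rule INF_superset_mono) (use assms ennreal_leI less_le_trans in blast)+

lemma hausdorff_pre_tendsto:
  "((\<lambda>\<delta>. hausdorff_pre d k \<delta> A) \<longlongrightarrow> (SUP \<delta>\<in>{0<..}. hausdorff_pre d k \<delta> A)) (at_right 0)"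
proof (rule order_tendstoI)
  fix y assume "y < (SUP \<delta>\<in>{0<..}. hausdorff_pre d k \<delta> A)"
  then obtain e where e: "e > 0" "y < hausdorff_pre d k e A"
    by (auto simp: less_SUP_iff)
  show "\<forall>\<^sub>F \<delta> in at_right 0. y < hausdorff_pre d k \<delta> A"
    unfolding eventually_at_right_field
    using e hausdorff_pre_antimono less_le_trans less_imp_le by metis
next
  fix y assume y: "(SUP \<delta>\<in>{0<..}. hausdorff_pre d k \<delta> A) < y"
  have "hausdorff_pre d k \<delta> A < y" if "\<delta> > 0" for \<delta>
    by (rule le_less_trans[OF SUP_upper y]) (use that in auto)
  then show "\<forall>\<^sub>F \<delta> in at_right 0. hausdorff_pre d k \<delta> A < y"
    unfolding eventually_at_right_field using zero_less_one by blast
qed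

lemma hausdorff_eq_SUP: "hausdorff d k A = (SUP \<delta>\<in>{0<..}. hausdorff_pre d k \<delta> A)"
  unfolding hausdorff_def
  by (rule tendsto_Lim[OF _ hausdorff_pre_tendsto]) simp

text \<open>Measurability in the sense of Caratheodory.\<close>

definition hausdorff_measurable :: "('a \<Rightarrow> 'a \<Rightarrow> real) \<Rightarrow> nat \<Rightarrow> 'a set \<Rightarrow> bool" where
  "hausdorff_measurable d k E \<longleftrightarrow> E \<in> lambda_system UNIV UNIV (hausdorff d k)"

definition hausdorff_ae :: "('a \<Rightarrow> 'a \<Rightarrow> real) \<Rightarrow> nat \<Rightarrow> 'a set \<Rightarrow> ('a \<Rightarrow> bool) \<Rightarrow> bool" where
  "hausdorff_ae d k E Q \<longleftrightarrow> hausdorff d k {a \<in> E. \<not> Q a} = 0"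


section \<open>Parabolic space and its planes\<close>

text \<open>The product metric \<open>dist\<close>, the inner product and \<open>norm\<close> on this type are the Euclidean
  ones of \<open>\<real>\<^sup>n\<^sup>+\<^sup>1\<close>, with \<open>n = CARD('n)\<close>.\<close>

type_synonym 'n pspace = "(real ^ 'n) \<times> real"

definition pnorm :: "'n::finite pspace \<Rightarrow> real" where
  "pnorm p = sqrt (norm (fst p) ^ 2 + \<bar>snd p\<bar>)"

definition pdist :: "'n::finite pspace \<Rightarrow> 'n pspace \<Rightarrow> real" where
  "pdist p q = pnorm (p - q)"

definition horizontal :: "'n::finite pspace set" where
  "horizontal = UNIV \<times> {0}"

definition planes_H :: "nat \<Rightarrow> 'n::finite pspace set set" where
  "planes_H k = {V. 1 \<le> k \<and> k \<le> CARD('n) \<and> subspace V \<and> dim V = k \<and> V \<subseteq> horizontal}"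

text \<open>The time axis has parabolic dimension two, hence the shift in the linear dimension.\<close>

definition planes_V :: "nat \<Rightarrow> 'n::finite pspace set set" where
  "planes_V k =
     {V. 2 \<le> k \<and> k \<le> CARD('n) + 1 \<and> subspace V \<and> dim V = k - 1 \<and> {0} \<times> UNIV \<subseteq> V}"

definition planes_P :: "nat \<Rightarrow> 'n::finite pspace set set" where
  "planes_P k = planes_H k \<union> planes_V k"


section \<open>Parabolic rectifiability\<close>

definition lipschitz_graph_over :: "'n::finite pspace set \<Rightarrow> real \<Rightarrow> 'n pspace set \<Rightarrow> bool" where
  "lipschitz_graph_over V L G \<longleftrightarrow>
     (\<exists>A g. A \<subseteq> V \<and> g ` A \<subseteq> V\<^sup>\<bottom> \<and>
            (\<forall>x\<in>A. \<forall>y\<in>A. pnorm (g x - g y) \<le> L * pnorm (x - y)) \<and>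
            G = (\<lambda>x. x + g x) ` A)"

definition lipschitz_graph :: "nat \<Rightarrow> real \<Rightarrow> 'n::finite pspace set \<Rightarrow> bool" where
  "lipschitz_graph k L G \<longleftrightarrow> (\<exists>V\<in>planes_P k. lipschitz_graph_over V L G)"

definition vertical_lipschitz_graph :: "nat \<Rightarrow> real \<Rightarrow> 'n::finite pspace set \<Rightarrow> bool" where
  "vertical_lipschitz_graph k L G \<longleftrightarrow> (\<exists>V\<in>planes_V k. lipschitz_graph_over V L G)"

definition parabolic_rectifiable :: "nat \<Rightarrow> 'n::finite pspace set \<Rightarrow> bool" where
  "parabolic_rectifiable k E \<longleftrightarrow>
     (\<forall>L>0. \<exists>G :: nat \<Rightarrow> 'n pspace set.
        (\<forall>i. lipschitz_graph k L (G i)) \<and> hausdorff pdist k (E - (\<Union>i. G i)) = 0)"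

definition vertically_parabolic_rectifiable :: "nat \<Rightarrow> 'n::finite pspace set \<Rightarrow> bool" where
  "vertically_parabolic_rectifiable k E \<longleftrightarrow>
     (\<forall>L>0. \<exists>G :: nat \<Rightarrow> 'n pspace set.
        (\<forall>i. vertical_lipschitz_graph k L (G i)) \<and> hausdorff pdist k (E - (\<Union>i. G i)) = 0)"


section \<open>Euclidean rectifiability and approximate tangent planes\<close>

text \<open>The type argument fixes the parameter space \<open>\<real>\<^sup>m\<close>, with \<open>m = CARD('m)\<close>.\<close>

definition euclidean_rectifiable :: "'m::finite itself \<Rightarrow> 'a::euclidean_space set \<Rightarrow> bool" where
  "euclidean_rectifiable _ E \<longleftrightarrow>
     (\<exists>(A :: nat \<Rightarrow> (real ^ 'm) set) (f :: nat \<Rightarrow> real ^ 'm \<Rightarrow> 'a).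
        (\<forall>i. \<exists>C. C-lipschitz_on (A i) (f i)) \<and>
        hausdorff dist CARD('m) (E - (\<Union>i. f i ` A i)) = 0)"

definition euclidean_cone :: "'a::euclidean_space \<Rightarrow> 'a set \<Rightarrow> real \<Rightarrow> 'a set" where
  "euclidean_cone a V s = {p. infdist (p - a) V < s * norm (p - a)}"

definition approx_tangent_plane ::
    "nat \<Rightarrow> 'a::euclidean_space set \<Rightarrow> 'a \<Rightarrow> 'a set \<Rightarrow> bool" where
  "approx_tangent_plane m E a V \<longleftrightarrow>
     subspace V \<and> dim V = m \<and>
     (\<forall>s. 0 < s \<and> s < 1 \<longrightarrow>
        ((\<lambda>r. ennreal (1 / r ^ m) * hausdorff dist m (E \<inter> cball a r - euclidean_cone a V s))
           \<longlongrightarrow> 0) (at_right 0))"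

end

(*
Cover E, up to an H^m_E-null set, by images of Lipschitz maps F from R^m. A set of Euclidean size r
splits into about 1/r sets of parabolic size r, so H^m_E-null sets are parabolic H^(m+1)-null.

By Rademacher's theorem F is differentiable almost everywhere. Where DF is singular, or where its
time component vanishes, the image of a small ball needs far fewer sets than expected, so these
points have H^(m+1)-null image. At every other point the image is locally nearly the m-plane
P = DF(R^m), which is not horizontal. Let W be the horizontal part of P. The increments of the
image, taken orthogonally to V = W x R, are O(|dt|) + eps |dx|. On a small scale |dt| is much
smaller than |dt|^(1/2), so the image is a parabolic Lipschitz graph over V with a constant as small
as desired, whatever the slope of P. Hence E is always vertically parabolic rectifiable.

If the approximate tangent planes of E are horizontal, then near such a point the part of E in the
image of F lies, up to zero density, in a thin cone around a horizontal plane, whose preimage under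
F is a thin slab. So this part has density zero at each of its points and is H^m_E-null.
*)

theory Submission
  imports Defs
begin

section \<open>Rademacher's theorem\<close>

text \<open>The graph condition compares any two points of a piece, whereas differentiability at
  \<open>x\<close> compares points with \<open>x\<close> alone. Null images are a matter of
  counting. A set of Euclidean size r, cut at height r^2, gives about 1/r pieces of parabolic size
  r, which contribute (1/r) r^(m+1) = r^m. This is the order of the volume of the parameter ball, so
  any arbitrarily small factor gained in the count forces measure zero: the gain is a factor e in
  the number of slices if the time derivative vanishes, and 1/M in the number of Euclidean pieces if
  the derivative has a kernel. Rademacher's theorem is built up from the line: monotone functions
  first, then directional derivatives by slicing, their additivity in the direction by porosity, and
  finally uniformity over directions by compactness of the sphere. Outer measures are used where a
  set is not known to be measurable.\<close>

lemma open_outer_approx: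
  fixes S :: "'a::euclidean_space set"
  assumes "e > 0"
  obtains T where "open T" "S \<subseteq> T" "emeasure lebesgue T \<le> outer_measure_of lebesgue S + ennreal e"
proof -
  obtain E where E: "E \<in> sets lebesgue" "S \<subseteq> E" "outer_measure_of lebesgue S = emeasure lebesgue E"
    using outer_measure_of_attain[of S lebesgue] by auto
  obtain T where T: "open T" "E \<subseteq> T" "T - E \<in> lmeasurable" "emeasure lebesgue (T - E) < ennreal e"
    using sets_lebesgue_outer_open[OF E(1) assms] by blast
  have "emeasure lebesgue T = emeasure lebesgue (E \<union> (T - E))"
    using T(2) by (simp add: Un_absorb1)
  also have "\<dots> \<le> emeasure lebesgue E + emeasure lebesgue (T - E)"
    using E(1) T(3) by (intro emeasure_subadditive) auto
  also have "\<dots> \<le> outer_measure_of lebesgue S + ennreal e"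
    unfolding E(3) using T(4) by (intro add_mono) auto
  finally show thesis using that[OF T(1)] E(2) T(2) by blast
qed

text \<open>The covering arguments end by cancelling an outer measure, which has to be finite for
  that; they are therefore run on bounded parts.\<close>

lemma negligible_bounded_parts:
  fixes S :: "'a::euclidean_space set"
  assumes "\<And>n::nat. negligible (S \<inter> ball 0 n)"
  shows "negligible S"
proof -
  have "negligible (\<Union>n::nat. S \<inter> ball 0 n)"
    using assms by (intro negligible_countable_Union) auto
  moreover have "S = (\<Union>n::nat. S \<inter> ball 0 n)"
    using reals_Archimedean2 by (auto simp: dist_norm)
  ultimately show ?thesis by simp
qed

text \<open>The holes fill a fixed proportion of a Vitali cover of the set but lie, up to measure zero,
  outside its measurable hull \<open>E\<close>, hence in \<open>T - E\<close>.\<close>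

lemma negligible_porous:
  fixes A :: "'a::euclidean_space set"
  assumes \<eta>: "\<eta> > 0"
  shows "negligible {x\<in>A. \<forall>d>0. \<exists>t. 0 < \<bar>t\<bar> \<and> \<bar>t\<bar> < d \<and> ball (x + t *\<^sub>R u) (\<eta> * \<bar>t\<bar>) \<inter> A = {}}"
    (is "negligible ?S")
proof (rule negligible_bounded_parts)
  fix n :: nat
  define S where "S = ?S \<inter> ball 0 n"
  obtain E where E: "E \<in> sets lebesgue" "S \<subseteq> E" "outer_measure_of lebesgue S = emeasure lebesgue E"
    using outer_measure_of_attain[of S lebesgue] by auto
  have "emeasure lebesgue E \<le> outer_measure_of lebesgue (ball 0 n :: 'a set)"
    unfolding E(3)[symmetric] S_def by (intro outer_measure_of_mono) auto
  also have "\<dots> < \<infinity>" by (simp add: emeasure_ball)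
  finally have Efin: "emeasure lebesgue E \<noteq> \<infinity>" by simp
  \<comment> \<open>\<open>w * \<bar>t\<bar>\<close> is the radius about \<open>x\<close> that
    contains the hole, which lies at distance \<open>norm u * \<bar>t\<bar>\<close> and has radius
    \<open>\<eta> * \<bar>t\<bar>\<close>. The constant \<open>c\<close> below is the ratio of the
    two volumes.\<close>
  define w where "w = norm u + \<eta>"
  have w: "w > 0" using \<eta> by (simp add: w_def add_nonneg_pos)
  define c where "c = (w / \<eta>) ^ DIM('a)"
  have c: "c > 0" using \<eta> w by (simp add: c_def)
  have "emeasure lebesgue E \<le> ennreal c * ennreal e" if e: "e > 0" for e
  proof -
    obtain T where T: "open T" "E \<subseteq> T" "T - E \<in> lmeasurable" "emeasure lebesgue (T - E) < ennreal e"
      using sets_lebesgue_outer_open[OF E(1) e] by blast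
    define K where "K = {(x, t). x \<in> S \<and> 0 < \<bar>t\<bar> \<and> cball x (w * \<bar>t\<bar>) \<subseteq> T \<and>
        ball (x + t *\<^sub>R u) (\<eta> * \<bar>t\<bar>) \<inter> A = {}}"
    define r where "r = (\<lambda>(x::'a, t). w * \<bar>t\<bar>)"
    define h where "h = (\<lambda>(x::'a, t). ball (x + t *\<^sub>R u) (\<eta> * \<bar>t\<bar>))"
    obtain C where C: "countable C" "C \<subseteq> K"
      "pairwise (\<lambda>i j. disjnt (cball (fst i) (r i)) (cball (fst j) (r j))) C"
      "negligible (S - (\<Union>i\<in>C. cball (fst i) (r i)))"
    proof (rule Vitali_covering_theorem_cballs[of K r S fst])
      show "0 < r i" if "i \<in> K" for i using that w by (auto simp: K_def r_def)
      fix x d assume x: "x \<in> S" and d: "0 < (d::real)"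
      obtain s where s: "s > 0" "cball x s \<subseteq> T"
        using T E(2) x by (meson open_contains_cball subsetD)
      have "min s d / w > 0" using s d w by simp
      then obtain t where t: "0 < \<bar>t\<bar>" "\<bar>t\<bar> < min s d / w" "ball (x + t *\<^sub>R u) (\<eta> * \<bar>t\<bar>) \<inter> A = {}"
        using x unfolding S_def by blast
      have "w * \<bar>t\<bar> < min s d" using t(2) w by (simp add: field_simps)
      then have "(x, t) \<in> K" "r (x, t) < d" "0 \<le> r (x, t)"
        using x t s w by (auto simp: K_def r_def)
      then show "\<exists>i. i \<in> K \<and> x \<in> cball (fst i) (r i) \<and> r i < d" by force
    qed blast
    have hsub: "h i \<subseteq> cball (fst i) (r i)" for i
    proof -
      obtain x t where i: "i = (x, t)" by fastforce
      have "dist x y \<le> w * \<bar>t\<bar>" if "dist (x + t *\<^sub>R u) y < \<eta> * \<bar>t\<bar>" for y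
      proof -
        have "dist x y \<le> dist x (x + t *\<^sub>R u) + dist (x + t *\<^sub>R u) y" by (rule dist_triangle)
        also have "dist x (x + t *\<^sub>R u) = norm u * \<bar>t\<bar>" by (simp add: dist_norm)
        finally show ?thesis using that by (simp add: w_def algebra_simps)
      qed
      then show ?thesis by (auto simp: h_def r_def i)
    qed
    have hS: "h i \<inter> S = {}" if "i \<in> C" for i
      using that C(2) by (auto simp: K_def h_def S_def)
    have hT: "h i \<subseteq> T" if "i \<in> C" for i
      using hsub[of i] that C(2) by (force simp: K_def r_def)
    have hm: "h i \<in> sets lebesgue" for i by (simp add: h_def split: prod.splits)
    have hUm: "(\<Union>i\<in>C. h i) \<in> sets lebesgue" using C(1) hm by (intro sets.countable_UN') auto
    have meas: "emeasure lebesgue (cball (fst i) (r i)) = ennreal c * emeasure lebesgue (h i)" if "i \<in> C" for i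
    proof -
      obtain x t where i: "i = (x, t)" by fastforce
      have t: "0 < \<bar>t\<bar>" using that C(2) by (auto simp: K_def i)
      have "w * \<bar>t\<bar> = (w / \<eta>) * (\<eta> * \<bar>t\<bar>)" using \<eta> by simp
      then have "(w * \<bar>t\<bar>) ^ DIM('a) = c * (\<eta> * \<bar>t\<bar>) ^ DIM('a)"
        unfolding c_def by (metis power_mult_distrib)
      then show ?thesis using t \<eta> w c
        by (simp add: i h_def r_def emeasure_ball emeasure_cball ennreal_mult[symmetric] mult_ac)
    qed
    \<comment> \<open>Removing the holes from \<open>E\<close> leaves a measurable set that still
      contains \<open>S\<close>; as \<open>E\<close> already has the least possible measure, the
      holes meet \<open>E\<close> in a null set.\<close>
    have "outer_measure_of lebesgue S \<le> emeasure lebesgue (E - (\<Union>i\<in>C. h i))"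
      unfolding outer_measure_of_def using E(1,2) hUm hS by (intro INF_lower) auto
    moreover have "emeasure lebesgue (E - (\<Union>i\<in>C. h i)) + emeasure lebesgue (E \<inter> (\<Union>i\<in>C. h i)) = emeasure lebesgue E"
      using E(1) hUm by (subst plus_emeasure) (auto simp: Un_Diff_Int)
    moreover from this have "emeasure lebesgue (E - (\<Union>i\<in>C. h i)) \<noteq> \<infinity>"
      using Efin by (metis ennreal_add_eq_top infinity_ennreal_def)
    ultimately have "emeasure lebesgue (E \<inter> (\<Union>i\<in>C. h i)) \<le> 0"
      using E(3) ennreal_add_left_cancel_le[of "emeasure lebesgue (E - (\<Union>i\<in>C. h i))"
          "emeasure lebesgue (E \<inter> (\<Union>i\<in>C. h i))" 0]
      by (simp only: add_0_right) blast
    then have z: "emeasure lebesgue (E \<inter> (\<Union>i\<in>C. h i)) = 0" by simp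
    have "(\<Union>i\<in>C. h i) \<subseteq> (E \<inter> (\<Union>i\<in>C. h i)) \<union> (T - E)" using hT by blast
    then have "emeasure lebesgue (\<Union>i\<in>C. h i) \<le> emeasure lebesgue ((E \<inter> (\<Union>i\<in>C. h i)) \<union> (T - E))"
      using E(1) hUm T(3) by (intro emeasure_mono) auto
    also have "\<dots> \<le> 0 + emeasure lebesgue (T - E)"
      using E(1) hUm T(3) emeasure_subadditive[of "E \<inter> (\<Union>i\<in>C. h i)" lebesgue "T - E"] z by auto
    finally have hle: "emeasure lebesgue (\<Union>i\<in>C. h i) \<le> ennreal e" using T(4) by simp
    define N where "N = S - (\<Union>i\<in>C. cball (fst i) (r i))"
    have N: "N \<in> sets lebesgue" "emeasure lebesgue N = 0"
      using C(4) unfolding N_def by (auto simp: negligible_iff_null_sets)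
    have Bm: "(\<Union>i\<in>C. cball (fst i) (r i)) \<in> sets lebesgue" using C(1) by (intro sets.countable_UN') auto
    have "outer_measure_of lebesgue S \<le> emeasure lebesgue ((\<Union>i\<in>C. cball (fst i) (r i)) \<union> N)"
      unfolding outer_measure_of_def using sets.Un[OF Bm N(1)] by (intro INF_lower) (auto simp: N_def)
    also have "\<dots> \<le> emeasure lebesgue (\<Union>i\<in>C. cball (fst i) (r i))"
      using emeasure_subadditive[OF Bm N(1)] N(2) by simp
    also have "\<dots> = (\<integral>\<^sup>+i. emeasure lebesgue (cball (fst i) (r i)) \<partial>count_space C)"
      using C(1,3) by (intro emeasure_UN_countable) (auto simp: disjoint_family_on_def pairwise_def disjnt_def)
    also have "\<dots> = (\<integral>\<^sup>+i. ennreal c * emeasure lebesgue (h i) \<partial>count_space C)"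
      using meas by (intro nn_integral_cong) auto
    also have "\<dots> = ennreal c * (\<integral>\<^sup>+i. emeasure lebesgue (h i) \<partial>count_space C)"
      by (intro nn_integral_cmult) auto
    also have "(\<integral>\<^sup>+i. emeasure lebesgue (h i) \<partial>count_space C) = emeasure lebesgue (\<Union>i\<in>C. h i)"
    proof (rule emeasure_UN_countable[symmetric])
      show "disjoint_family_on h C"
        using C(3) hsub unfolding disjoint_family_on_def pairwise_def disjnt_def by blast
    qed (use hm C(1) in auto)
    also have "ennreal c * \<dots> \<le> ennreal c * ennreal e" by (intro mult_left_mono hle) simp
    finally show ?thesis using E(3) by simp
  qed
  then have le: "emeasure lebesgue E \<le> ennreal (c * e)" if "e > 0" for e
    using that c by (simp add: ennreal_mult)
  have "emeasure lebesgue E \<le> 0"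
  proof (rule ennreal_le_epsilon)
    fix e :: real assume "0 < e"
    then show "emeasure lebesgue E \<le> 0 + ennreal e" using le[of "e / c"] c by simp
  qed
  then have "emeasure lebesgue E = 0" by simp
  then have "negligible E" using E(1) by (simp add: negligible_iff_emeasure0)
  then show "negligible (?S \<inter> ball 0 n)" using E(2) negligible_subset S_def by blast
qed

section \<open>Differentiability almost everywhere on the line\<close>

lemma emeasure_UN_le_nn_integral:
  assumes C: "countable C" and X: "\<And>i. i \<in> C \<Longrightarrow> X i \<in> sets M"
  shows "emeasure M (\<Union>i\<in>C. X i) \<le> (\<integral>\<^sup>+i. emeasure M (X i) \<partial>count_space C)"
proof (cases "finite C")
  case True
  then show ?thesis
    using X by (auto simp: nn_integral_count_space_finite intro!: emeasure_subadditive_finite)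
next
  case False
  then have bij: "bij_betw (from_nat_into C) UNIV C" using C by (simp add: bij_betw_from_nat_into)
  then have "(\<Union>i\<in>C. X i) = (\<Union>n. X (from_nat_into C n))" by (metis bij_betw_imp_surj_on image_image)
  also have "emeasure M \<dots> \<le> (\<Sum>n. emeasure M (X (from_nat_into C n)))"
    using X False by (intro emeasure_subadditive_countably) (auto intro!: X from_nat_into simp: infinite_imp_nonempty)
  also have "\<dots> = (\<integral>\<^sup>+i. emeasure M (X i) \<partial>count_space C)"
    using nn_integral_bij_count_space[OF bij, of "\<lambda>i. emeasure M (X i)"] by (simp add: nn_integral_count_space_nat)
  finally show ?thesis .
qed

text \<open>Monotonicity makes the image of the interval between \<open>x\<close> and
  \<open>y\<close> an interval of length at most \<open>p\<close> times as large. Such intervals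
  exist at arbitrarily small scales around each point of \<open>S\<close>, so they form a Vitali
  cover.\<close>

lemma outer_measure_image_le:
  fixes h :: "real \<Rightarrow> real"
  assumes mono: "mono h" and lip: "L-lipschitz_on UNIV h" and p: "p \<ge> 0"
    and S: "\<And>x d. x \<in> S \<Longrightarrow> d > 0 \<Longrightarrow> \<exists>y. 0 < \<bar>y - x\<bar> \<and> \<bar>y - x\<bar> < d \<and> \<bar>h y - h x\<bar> \<le> p * \<bar>y - x\<bar>"
  shows "outer_measure_of lebesgue (h ` S) \<le> ennreal p * outer_measure_of lebesgue S"
proof -
  have *: "outer_measure_of lebesgue (h ` S) \<le> ennreal p * (outer_measure_of lebesgue S + ennreal e)" if e: "e > 0" for e
  proof -
    obtain T where T: "open T" "S \<subseteq> T" "emeasure lebesgue T \<le> outer_measure_of lebesgue S + ennreal e"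
      using open_outer_approx[OF e] by blast
    \<comment> \<open>Midpoint and half length: the closed ball is the interval between
      \<open>x\<close> and \<open>y\<close>, which puts the cover into the form required by the
      Vitali theorem for balls.\<close>
    define c where "c = (\<lambda>(x::real, y::real). (x + y) / 2)"
    define r where "r = (\<lambda>(x::real, y::real). \<bar>y - x\<bar> / 2)"
    define K where "K = {(x, y). 0 < \<bar>y - x\<bar> \<and> \<bar>h y - h x\<bar> \<le> p * \<bar>y - x\<bar> \<and> cball (c (x, y)) (r (x, y)) \<subseteq> T}"
    define I where "I = (\<lambda>(x::real, y::real). cball ((h x + h y) / 2) (\<bar>h y - h x\<bar> / 2))"
    obtain C where C: "countable C" "C \<subseteq> K"
      "pairwise (\<lambda>i j. disjnt (cball (c i) (r i)) (cball (c j) (r j))) C"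
      "negligible (S - (\<Union>i\<in>C. cball (c i) (r i)))"
    proof (rule Vitali_covering_theorem_cballs[of K r S c])
      show "0 < r i" if "i \<in> K" for i using that by (auto simp: K_def r_def)
      fix x d :: real assume x: "x \<in> S" and d: "0 < d"
      obtain s where s: "s > 0" "cball x s \<subseteq> T"
        using T x by (meson open_contains_cball subsetD)
      obtain y where y: "0 < \<bar>y - x\<bar>" "\<bar>y - x\<bar> < min s d" "\<bar>h y - h x\<bar> \<le> p * \<bar>y - x\<bar>"
        using S[OF x, of "min s d"] s d by auto
      have "cball (c (x, y)) (r (x, y)) \<subseteq> cball x s"
      proof
        fix z assume "z \<in> cball (c (x, y)) (r (x, y))"
        then have "\<bar>(x + y) / 2 - z\<bar> \<le> \<bar>y - x\<bar> / 2" by (auto simp: c_def r_def dist_real_def)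
        then have "\<bar>x - z\<bar> \<le> \<bar>y - x\<bar>" by argo
        then show "z \<in> cball x s" using y by (auto simp: dist_real_def)
      qed
      moreover have "x \<in> cball (c (x, y)) (r (x, y))" "r (x, y) < d"
        using y d by (auto simp: c_def r_def dist_real_def abs_if field_simps)
      ultimately show "\<exists>i. i \<in> K \<and> x \<in> cball (c i) (r i) \<and> r i < d"
        using y s by (intro exI[of _ "(x, y)"]) (auto simp: K_def)
    qed blast
    have sub: "h ` cball (c i) (r i) \<subseteq> I i" for i
    proof -
      obtain x y where i: "i = (x, y)" by fastforce
      { fix z assume "\<bar>(x + y) / 2 - z\<bar> \<le> \<bar>y - x\<bar> / 2"
        then have "min x y \<le> z" "z \<le> max x y" by argo+
        then have "h (min x y) \<le> h z" "h z \<le> h (max x y)" using mono by (auto simp: mono_def)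
        then have "\<bar>(h x + h y) / 2 - h z\<bar> \<le> \<bar>h y - h x\<bar> / 2"
          by (cases "x \<le> y") (auto simp: min_def max_def abs_if field_simps split: if_splits)
      }
      then show ?thesis by (auto simp: i c_def r_def I_def dist_real_def)
    qed
    have Imeas: "emeasure lebesgue (I i) \<le> ennreal p * emeasure lebesgue (cball (c i) (r i))" if "i \<in> C" for i
    proof -
      obtain x y where i: "i = (x, y)" by fastforce
      have "\<bar>h y - h x\<bar> \<le> p * \<bar>y - x\<bar>" using that C(2) by (auto simp: K_def i)
      then show ?thesis using p
        by (simp add: i I_def c_def r_def cball_eq_atLeastAtMost ennreal_mult[symmetric])
    qed
    \<comment> \<open>The Vitali theorem may miss a null set; the Lipschitz bound keeps its image
      null.\<close>
    define N where "N = S - (\<Union>i\<in>C. cball (c i) (r i))"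
    have "negligible (h ` N)"
    proof (rule negligible_locally_Lipschitz_image)
      show "negligible N" using C(4) by (simp add: N_def)
      show "\<exists>T B. open T \<and> x \<in> T \<and> (\<forall>y\<in>N \<inter> T. norm (h y - h x) \<le> B * norm (y - x))" for x
        using lip by (intro exI[of _ UNIV] exI[of _ L]) (auto simp: lipschitz_on_def dist_norm)
    qed simp
    then have N: "h ` N \<in> sets lebesgue" "emeasure lebesgue (h ` N) = 0"
      by (auto simp: negligible_iff_null_sets)
    have Im: "I i \<in> sets lebesgue" for i by (simp add: I_def split: prod.splits)
    have IUm: "(\<Union>i\<in>C. I i) \<in> sets lebesgue" using C(1) Im by (intro sets.countable_UN') auto
    have Bm: "(\<Union>i\<in>C. cball (c i) (r i)) \<in> sets lebesgue" using C(1) by (intro sets.countable_UN') auto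
    have "h ` S \<subseteq> (\<Union>i\<in>C. I i) \<union> h ` N"
      using sub by (fastforce simp: N_def)
    then have "outer_measure_of lebesgue (h ` S) \<le> emeasure lebesgue ((\<Union>i\<in>C. I i) \<union> h ` N)"
      unfolding outer_measure_of_def using sets.Un[OF IUm N(1)] by (intro INF_lower) auto
    also have "\<dots> \<le> emeasure lebesgue (\<Union>i\<in>C. I i)"
      using emeasure_subadditive[OF IUm N(1)] N(2) by simp
    \<comment> \<open>The image intervals need not be disjoint, so subadditivity is used here;
      disjointness is used for the source intervals further down.\<close>
    also have "\<dots> \<le> (\<integral>\<^sup>+i. emeasure lebesgue (I i) \<partial>count_space C)"
      using C(1) Im by (intro emeasure_UN_le_nn_integral) auto
    also have "\<dots> \<le> (\<integral>\<^sup>+i. ennreal p * emeasure lebesgue (cball (c i) (r i)) \<partial>count_space C)"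
      using Imeas by (intro nn_integral_mono) auto
    also have "\<dots> = ennreal p * (\<integral>\<^sup>+i. emeasure lebesgue (cball (c i) (r i)) \<partial>count_space C)"
      by (intro nn_integral_cmult) auto
    also have "(\<integral>\<^sup>+i. emeasure lebesgue (cball (c i) (r i)) \<partial>count_space C)
        = emeasure lebesgue (\<Union>i\<in>C. cball (c i) (r i))"
      using C(1,3) by (intro emeasure_UN_countable[symmetric]) (auto simp: disjoint_family_on_def pairwise_def disjnt_def)
    also have "\<dots> \<le> emeasure lebesgue T"
      using T(1) Bm C(2) by (intro emeasure_mono) (auto simp: K_def)
    also have "\<dots> \<le> outer_measure_of lebesgue S + ennreal e" by (rule T(3))
    finally show ?thesis by (simp add: mult_left_mono)
  qed
  show ?thesis
  proof (cases "outer_measure_of lebesgue S = \<infinity> \<and> p > 0")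
    case True
    then show ?thesis by (simp add: ennreal_mult_top)
  next
    case False
    show ?thesis
    proof (rule ennreal_le_epsilon)
      fix e :: real assume e: "0 < e"
      have "outer_measure_of lebesgue (h ` S) \<le> ennreal p * (outer_measure_of lebesgue S + ennreal (e / (p + 1)))"
        using e p by (intro *) auto
      also have "\<dots> = ennreal p * outer_measure_of lebesgue S + ennreal (p * (e / (p + 1)))"
        using e p by (simp add: distrib_left ennreal_mult[symmetric])
      also have "\<dots> \<le> ennreal p * outer_measure_of lebesgue S + ennreal e"
        using e p by (intro add_left_mono ennreal_leI) (simp add: field_simps)
      finally show "outer_measure_of lebesgue (h ` S) \<le> ennreal p * outer_measure_of lebesgue S + ennreal e" .
    qed
  qed
qed

text \<open>The limit is the supremum of the eventual lower bounds. Rational levels are enough and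
  keep the number of exceptional sets countable when this is applied at almost every point.\<close>

lemma tendsto_if_no_oscillation:
  fixes Q :: "'a \<Rightarrow> real"
  assumes F: "F \<noteq> bot" and bd: "\<And>y. \<bar>Q y\<bar> \<le> B"
    and osc: "\<And>p q. p \<in> \<rat> \<Longrightarrow> q \<in> \<rat> \<Longrightarrow> p < q \<Longrightarrow> \<not> ((\<exists>\<^sub>F y in F. Q y < p) \<and> (\<exists>\<^sub>F y in F. Q y > q))"
  shows "\<exists>l. (Q \<longlongrightarrow> l) F"
proof -
  define A where "A = {p. \<forall>\<^sub>F y in F. Q y \<ge> p}"
  have "- B \<le> Q y" for y using bd[of y] by linarith
  then have "-B \<in> A" by (simp add: A_def)
  have Ale: "p \<le> B" if "p \<in> A" for p
  proof -
    have "\<exists>y. Q y \<ge> p" using that F unfolding A_def by (auto dest: eventually_happens)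
    then obtain y where "Q y \<ge> p" by blast
    then show ?thesis using bd[of y] by linarith
  qed
  then have bdd: "bdd_above A" by (auto simp: bdd_above_def)
  define l where "l = Sup A"
  have "(Q \<longlongrightarrow> l) F"
  proof (rule order_tendstoI)
    fix a assume "a < l"
    then obtain p where "p \<in> A" "a < p"
      unfolding l_def using \<open>-B \<in> A\<close> bdd less_cSup_iff by (metis empty_iff)
    then show "\<forall>\<^sub>F y in F. a < Q y" unfolding A_def by (auto elim: eventually_mono)
  next
    fix a assume "l < a"
    \<comment> \<open>Two rational levels between \<open>l\<close> and \<open>a\<close>: the lower
      one is not an eventual lower bound, so the absence of oscillation turns the upper one into an
      eventual upper bound.\<close>
    then obtain p where p: "l < p" "p < a" "p \<in> \<rat>" using Rats_dense_in_real by blast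
    then obtain q where q: "p < q" "q < a" "q \<in> \<rat>" using Rats_dense_in_real by blast
    have "p \<notin> A" using p(1) cSup_upper[OF _ bdd] unfolding l_def by force
    then have "\<exists>\<^sub>F y in F. Q y < p" unfolding A_def by (auto simp: not_eventually not_le)
    then have "\<not> (\<exists>\<^sub>F y in F. Q y > q)" using osc p q by blast
    then have "\<forall>\<^sub>F y in F. Q y \<le> q" by (simp add: not_frequently not_less)
    then show "\<forall>\<^sub>F y in F. Q y < a" using q by (auto elim: eventually_mono)
  qed
  then show ?thesis by blast
qed

text \<open>The covering estimate for \<open>g\<close> and for its inverse bounds the outer measure of the set by \<open>p / q\<close> times itself.\<close>

lemma negligible_oscillation:
  fixes g :: "real \<Rightarrow> real"
  assumes lo: "\<And>x y. x < y \<Longrightarrow> y - x \<le> g y - g x" and lip: "L-lipschitz_on UNIV g"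
    and pq: "0 < p" "p < q"
  shows "negligible {x. (\<exists>\<^sub>F y in at x. (g y - g x) / (y - x) < p) \<and> (\<exists>\<^sub>F y in at x. (g y - g x) / (y - x) > q)}"
    (is "negligible ?S")
proof (rule negligible_bounded_parts)
  fix n :: nat
  define S where "S = ?S \<inter> ball 0 n"
  have smono: "strict_mono g" using lo by (force intro: strict_monoI)
  then have mono: "mono g" and inj: "inj g" by (auto simp: strict_mono_mono strict_mono_imp_inj_on)
  have conti: "continuous_on UNIV g" using lip lipschitz_on_continuous_on by blast
  have surj: "surj g"
  proof (rule surjI)
    fix z
    \<comment> \<open>Slopes of at least 1 carry \<open>g\<close> past \<open>z\<close> within
      distance \<open>\<bar>z - g 0\<bar>\<close> of 0, so these endpoints bracket a
      preimage.\<close>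
    define a where "a = min 0 (z - g 0)" define b where "b = max 0 (z - g 0)"
    have "g a \<le> z" using lo[of a 0] unfolding a_def by (cases "z < g 0") auto
    moreover have "z \<le> g b" using lo[of 0 b] unfolding b_def by (cases "z > g 0") auto
    ultimately have "\<exists>x. a \<le> x \<and> x \<le> b \<and> g x = z"
      using conti by (intro IVT') (auto simp: a_def b_def intro: continuous_on_subset)
    then have "\<exists>x. g x = z" by blast
    then show "g (SOME x. g x = z) = z" by (rule someI_ex)
  qed
  define k where "k = inv g"
  have gk: "g (k z) = z" for z using surj by (simp add: k_def surj_f_inv_f)
  have kg: "k (g z) = z" for z using inj by (simp add: k_def)
  have lo': "\<bar>x - y\<bar> \<le> \<bar>g x - g y\<bar>" for x y
    using lo[of x y] lo[of y x] by (cases x y rule: linorder_cases) auto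
  have klip: "1-lipschitz_on UNIV k"
    using lo'[of "k _" "k _"] by (auto simp: lipschitz_on_def dist_real_def gk)
  have kmono: "mono k"
    using smono gk by (metis monoI strict_mono_less_eq)
  have quot: "(g y - g x) / (y - x) = \<bar>g y - g x\<bar> / \<bar>y - x\<bar>" if "y \<noteq> x" for x y
  proof -
    have "0 \<le> (g y - g x) / (y - x)"
      using lo[of x y] lo[of y x] that by (cases x y rule: linorder_cases) (auto simp: zero_le_divide_iff)
    then show ?thesis by (metis abs_divide abs_of_nonneg)
  qed
  have 1: "outer_measure_of lebesgue (g ` S) \<le> ennreal p * outer_measure_of lebesgue S"
  proof (rule outer_measure_image_le[OF mono lip])
    fix x d :: real assume "x \<in> S" "d > 0"
    then have "\<exists>\<^sub>F y in at x. (g y - g x) / (y - x) < p" by (auto simp: S_def)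
    then have "\<exists>\<^sub>F y in at x. (g y - g x) / (y - x) < p \<and> y \<noteq> x \<and> dist y x < d"
      using \<open>d > 0\<close> by (intro frequently_eventually_frequently) (auto simp: eventually_at)
    then obtain y where y: "(g y - g x) / (y - x) < p" "y \<noteq> x" "dist y x < d"
      by (auto dest: frequently_ex)
    then have "\<bar>g y - g x\<bar> \<le> p * \<bar>y - x\<bar>" using quot[of y x] by (simp add: divide_less_eq)
    then show "\<exists>y. 0 < \<bar>y - x\<bar> \<and> \<bar>y - x\<bar> < d \<and> \<bar>g y - g x\<bar> \<le> p * \<bar>y - x\<bar>"
      using y by (auto simp: dist_real_def)
  qed (use pq in auto)
  have 2: "outer_measure_of lebesgue (k ` g ` S) \<le> ennreal (1 / q) * outer_measure_of lebesgue (g ` S)"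
  proof (rule outer_measure_image_le[OF kmono klip])
    fix z d :: real assume "z \<in> g ` S" "d > 0"
    then obtain x where x: "x \<in> S" "z = g x" by auto
    \<comment> \<open>For the inverse, closeness is demanded of the values of \<open>g\<close>;
      continuity provides it from closeness of the arguments.\<close>
    have "((\<lambda>y. g y) \<longlongrightarrow> g x) (at x)"
      using conti by (simp add: continuous_on_eq_continuous_at isContD)
    then have "\<forall>\<^sub>F y in at x. dist (g y) (g x) < d" using \<open>d > 0\<close> by (rule tendstoD)
    moreover have "\<exists>\<^sub>F y in at x. (g y - g x) / (y - x) > q" using x by (auto simp: S_def)
    ultimately have "\<exists>\<^sub>F y in at x. (g y - g x) / (y - x) > q \<and> (y \<noteq> x \<and> dist (g y) (g x) < d)"
      by (intro frequently_eventually_frequently) (auto simp: eventually_at_filter elim: eventually_mono)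
    then obtain y where y: "(g y - g x) / (y - x) > q" "y \<noteq> x" "dist (g y) (g x) < d"
      by (auto dest: frequently_ex)
    then have "q * \<bar>y - x\<bar> \<le> \<bar>g y - g x\<bar>" using quot[of y x] by (simp add: less_divide_eq)
    then have "\<bar>y - x\<bar> \<le> 1 / q * \<bar>g y - g x\<bar>" using pq by (simp add: field_simps)
    moreover have "g y \<noteq> g x" using y(2) inj by (simp add: inj_eq)
    ultimately show "\<exists>w. 0 < \<bar>w - z\<bar> \<and> \<bar>w - z\<bar> < d \<and> \<bar>k w - k z\<bar> \<le> 1 / q * \<bar>w - z\<bar>"
      using y x by (intro exI[of _ "g y"]) (auto simp: dist_real_def kg)
  qed (use pq in auto)
  have im: "k ` g ` S = S" by (auto simp: image_image kg)
  define mS where "mS = outer_measure_of lebesgue S"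
  have "mS \<le> outer_measure_of lebesgue (ball 0 n :: real set)"
    unfolding mS_def S_def by (intro outer_measure_of_mono) auto
  also have "\<dots> < \<infinity>" by (simp add: emeasure_ball)
  finally obtain s where s: "mS = ennreal s" "s \<ge> 0" by (cases mS) auto
  have "mS \<le> ennreal (1 / q) * (ennreal p * mS)"
    using 2 1 unfolding im mS_def by (meson mult_left_mono order_trans zero_le)
  then have "s \<le> 1 / q * (p * s)" using s pq by (simp add: ennreal_mult[symmetric])
  then have "s * (q - p) \<le> 0" using pq by (simp add: field_simps)
  then have "s \<le> 0" using pq by (simp add: mult_le_0_iff)
  then have "mS = 0" using s by simp
  then obtain E where "E \<in> sets lebesgue" "S \<subseteq> E" "emeasure lebesgue E = 0"
    using outer_measure_of_attain[of S lebesgue] by (auto simp: mS_def)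
  then show "negligible (?S \<inter> ball 0 n)"
    unfolding S_def using negligible_iff_emeasure0 negligible_subset by blast
qed

lemma Lipschitz_real_ae_differentiable:
  fixes f :: "real \<Rightarrow> real"
  assumes lip: "L-lipschitz_on UNIV f"
  shows "negligible {x. \<not> (\<exists>l. (f has_real_derivative l) (at x))}"
proof -
  have L: "L \<ge> 0" using lip lipschitz_on_nonneg by blast
  have fl: "\<bar>f y - f x\<bar> \<le> L * \<bar>y - x\<bar>" for x y
    using lip by (auto simp: lipschitz_on_def dist_real_def)
  \<comment> \<open>The slopes of \<open>f\<close> are at least \<open>- L\<close>, so those of
    \<open>g\<close> are at least 1: both \<open>g\<close> and its inverse become Lipschitz, and
    differentiability is unaffected.\<close>
  define g where "g x = f x + (L + 1) * x" for x
  have lo: "y - x \<le> g y - g x" if "x < y" for x y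
    using fl[of y x] that by (auto simp: g_def algebra_simps)
  have "(L + (L + 1))-lipschitz_on UNIV g"
    unfolding g_def using L by (intro lipschitz_on_add lip) (auto simp: lipschitz_on_def dist_real_def abs_mult right_diff_distrib[symmetric])
  note glip = this
  define Q where "Q x y = (g y - g x) / (y - x)" for x y
  have Qb: "\<bar>Q x y\<bar> \<le> L + (L + 1)" for x y
    using lipschitz_onD[OF glip, of y x] L by (auto simp: Q_def dist_real_def abs_divide divide_le_eq)
  have Q1: "1 \<le> Q x y" if "x \<noteq> y" for x y
    using lo[of x y] lo[of y x] that by (cases x y rule: linorder_cases) (auto simp: Q_def divide_simps)
  define S where "S p q = {x. (\<exists>\<^sub>F y in at x. Q x y < p) \<and> (\<exists>\<^sub>F y in at x. Q x y > q)}" for p q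
  have "negligible (\<Union>(p,q)\<in>{(p,q). p \<in> \<rat> \<and> q \<in> \<rat> \<and> 0 < p \<and> p < q}. S p q)"
  proof (rule negligible_countable_Union)
    have "countable (\<rat> \<times> \<rat> :: (real \<times> real) set)" by (simp add: countable_rat)
    then show "countable ((\<lambda>(p, q). S p q) ` {(p,q). p \<in> \<rat> \<and> q \<in> \<rat> \<and> 0 < p \<and> p < q})"
      by (intro countable_image) (rule countable_subset[rotated], auto)
    fix X assume "X \<in> (\<lambda>(p, q). S p q) ` {(p,q). p \<in> \<rat> \<and> q \<in> \<rat> \<and> 0 < p \<and> p < q}"
    then obtain p q where "0 < p" "p < q" "X = S p q" by auto
    then show "negligible X" using negligible_oscillation[OF lo glip] by (simp add: S_def Q_def)
  qed
  moreover have "{x. \<not> (\<exists>l. (f has_real_derivative l) (at x))} \<subseteq> (\<Union>(p,q)\<in>{(p,q). p \<in> \<rat> \<and> q \<in> \<rat> \<and> 0 < p \<and> p < q}. S p q)"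
  proof
    fix x assume x: "x \<in> {x. \<not> (\<exists>l. (f has_real_derivative l) (at x))}"
    show "x \<in> (\<Union>(p,q)\<in>{(p,q). p \<in> \<rat> \<and> q \<in> \<rat> \<and> 0 < p \<and> p < q}. S p q)"
    proof (rule ccontr)
      assume n: "x \<notin> (\<Union>(p,q)\<in>{(p,q). p \<in> \<rat> \<and> q \<in> \<rat> \<and> 0 < p \<and> p < q}. S p q)"
      have "\<exists>l. (Q x \<longlongrightarrow> l) (at x)"
      proof (rule tendsto_if_no_oscillation)
        show "\<bar>Q x y\<bar> \<le> L + (L + 1)" for y by (rule Qb)
        fix p q :: real assume pq: "p \<in> \<rat>" "q \<in> \<rat>" "p < q"
        show "\<not> ((\<exists>\<^sub>F y in at x. Q x y < p) \<and> (\<exists>\<^sub>F y in at x. q < Q x y))"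
        proof (cases "p > 0")
          case True
          then show ?thesis using n pq by (auto simp: S_def)
        next
          \<comment> \<open>The oscillation lemma is for positive levels; quotients that are at
            least 1 never drop below a nonpositive one.\<close>
          case False
          have "\<not> Q x y < p" if "y \<noteq> x" for y using Q1[of x y] False that by linarith
          then have "\<forall>\<^sub>F y in at x. \<not> Q x y < p" by (simp add: eventually_at_filter)
          then show ?thesis by (simp add: frequently_def)
        qed
      qed simp
      then obtain l where "(g has_real_derivative l) (at x)"
        unfolding has_field_derivative_iff Q_def by blast
      then have "((\<lambda>x. g x - (L + 1) * x) has_real_derivative l - (L + 1)) (at x)"
        by (auto intro!: derivative_eq_intros)
      then show False using x by (auto simp: g_def)
    qed
  qed
  ultimately show ?thesis by (rule negligible_subset)
qed

section \<open>Directional derivatives in several variables\<close>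

text \<open>By Tonelli and translation invariance, averaging the slices over the unit interval
  computes the measure of the whole set.\<close>

lemma negligible_if_slices_negligible:
  fixes M :: "'a::euclidean_space set"
  assumes M: "M \<in> sets borel" and sl: "\<And>x. negligible {t::real. x + t *\<^sub>R u \<in> M}"
  shows "negligible M"
proof -
  have meas: "(\<lambda>(x, t). indicator M (x + t *\<^sub>R u) * indicator {0..1} t :: ennreal) \<in> borel_measurable (lborel \<Otimes>\<^sub>M lborel)"
    using M by measurable
  have tr: "(\<integral>\<^sup>+x. indicator M (x + c) \<partial>lborel) = emeasure lborel M" for c
  proof -
    have "(\<integral>\<^sup>+x. indicator M (x + c) \<partial>lborel) = (\<integral>\<^sup>+x. indicator M x \<partial>distr lborel borel ((+) c))"
      using M by (subst nn_integral_distr) (auto simp: add.commute)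
    then show ?thesis using M by (simp add: lborel_distr_plus)
  qed
  have "emeasure lborel M = (\<integral>\<^sup>+t. emeasure lborel M * indicator {0..1::real} t \<partial>lborel)"
    by (subst nn_integral_cmult_indicator) auto
  also have "\<dots> = (\<integral>\<^sup>+t. (\<integral>\<^sup>+x. indicator M (x + t *\<^sub>R u) * indicator {0..1} t \<partial>lborel) \<partial>lborel)"
    using M by (intro nn_integral_cong) (simp add: nn_integral_multc tr)
  also have "\<dots> = (\<integral>\<^sup>+x. (\<integral>\<^sup>+t. indicator M (x + t *\<^sub>R u) * indicator {0..1} t \<partial>lborel) \<partial>lborel)"
    using meas by (intro lborel_pair.Fubini') simp
  also have "\<dots> = (\<integral>\<^sup>+(x::'a). 0 \<partial>lborel)"
  proof (intro nn_integral_cong)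
    fix x :: 'a
    have m: "{t. x + t *\<^sub>R u \<in> M} \<in> sets borel"
      using measurable_sets[of "\<lambda>t. x + t *\<^sub>R u" borel borel M] M by (simp add: vimage_def)
    have "(\<integral>\<^sup>+t. indicator M (x + t *\<^sub>R u) * indicator {0..1} t \<partial>lborel) \<le> (\<integral>\<^sup>+t. indicator {t. x + t *\<^sub>R u \<in> M} t \<partial>lborel)"
      by (intro nn_integral_mono) (auto simp: indicator_def)
    also have "\<dots> = emeasure lborel {t. x + t *\<^sub>R u \<in> M}" using m by simp
    also have "\<dots> = 0" using sl[of x] m by (simp add: negligible_iff_emeasure0)
    finally show "(\<integral>\<^sup>+t. indicator M (x + t *\<^sub>R u) * indicator {0..1} t \<partial>lborel) = 0" by simp
  qed
  finally show ?thesis using M by (simp add: negligible_iff_emeasure0)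
qed

text \<open>Only one line through \<open>x\<close> enters, so nothing about linearity in
  \<open>u\<close> is built in; that is a separate statement, valid almost everywhere.\<close>

definition has_dir_deriv :: "('a::real_normed_vector \<Rightarrow> real) \<Rightarrow> 'a \<Rightarrow> 'a \<Rightarrow> real \<Rightarrow> bool" where
  "has_dir_deriv f x u l \<longleftrightarrow> ((\<lambda>t. (f (x + t *\<^sub>R u) - f x) / t) \<longlongrightarrow> l) (at 0)"

lemma has_dir_derivD:
  assumes "has_dir_deriv f x u l" "e > 0"
  shows "\<exists>d>0. \<forall>t. \<bar>t\<bar> < d \<longrightarrow> \<bar>f (x + t *\<^sub>R u) - f x - t * l\<bar> \<le> e * \<bar>t\<bar>"
proof -
  have "\<forall>\<^sub>F t in at 0. dist ((f (x + t *\<^sub>R u) - f x) / t) l < e"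
    using assms unfolding has_dir_deriv_def by (rule tendstoD)
  then obtain d where d: "d > 0" "\<And>t. t \<noteq> 0 \<Longrightarrow> \<bar>t\<bar> < d \<Longrightarrow> \<bar>(f (x + t *\<^sub>R u) - f x) / t - l\<bar> < e"
    by (auto simp: eventually_at dist_real_def)
  have "\<bar>f (x + t *\<^sub>R u) - f x - t * l\<bar> \<le> e * \<bar>t\<bar>" if "\<bar>t\<bar> < d" for t
  proof (cases "t = 0")
    case False
    then have "f (x + t *\<^sub>R u) - f x - t * l = t * ((f (x + t *\<^sub>R u) - f x) / t - l)" by (simp add: field_simps)
    then have "\<bar>f (x + t *\<^sub>R u) - f x - t * l\<bar> = \<bar>(f (x + t *\<^sub>R u) - f x) / t - l\<bar> * \<bar>t\<bar>"
      by (simp only: abs_mult mult.commute)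
    also have "\<dots> \<le> e * \<bar>t\<bar>" using d(2)[OF False that] by (intro mult_right_mono) auto
    finally show ?thesis .
  qed simp
  then show ?thesis using d by blast
qed

lemma has_dir_derivI:
  assumes "\<And>e. e > 0 \<Longrightarrow> \<exists>d>0. \<forall>t. 0 < \<bar>t\<bar> \<longrightarrow> \<bar>t\<bar> < d \<longrightarrow> \<bar>f (x + t *\<^sub>R u) - f x - t * l\<bar> \<le> e * \<bar>t\<bar>"
  shows "has_dir_deriv f x u l"
  unfolding has_dir_deriv_def
proof (rule tendstoI)
  fix e :: real assume "e > 0"
  then obtain d where d: "d > 0" "\<And>t. 0 < \<bar>t\<bar> \<Longrightarrow> \<bar>t\<bar> < d \<Longrightarrow> \<bar>f (x + t *\<^sub>R u) - f x - t * l\<bar> \<le> (e/2) * \<bar>t\<bar>"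
    using assms[of "e/2"] by auto
  have "\<bar>(f (x + t *\<^sub>R u) - f x) / t - l\<bar> < e" if "t \<noteq> 0" "\<bar>t\<bar> < d" for t
  proof -
    have "(f (x + t *\<^sub>R u) - f x) / t - l = (f (x + t *\<^sub>R u) - f x - t * l) / t" using that by (simp add: field_simps)
    also have "\<bar>\<dots>\<bar> \<le> e / 2" using d(2)[of t] that by (simp add: divide_le_eq)
    finally show ?thesis using \<open>e > 0\<close> by simp
  qed
  then show "\<forall>\<^sub>F t in at 0. dist ((f (x + t *\<^sub>R u) - f x) / t) l < e"
    using d(1) by (auto simp: eventually_at dist_real_def)
qed

lemma has_dir_deriv_scaleR:
  assumes "has_dir_deriv f x u l"
  shows "has_dir_deriv f x (c *\<^sub>R u) (c * l)"
proof (rule has_dir_derivI)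
  fix e :: real assume "e > 0"
  then obtain d where d: "d > 0" "\<And>t. \<bar>t\<bar> < d \<Longrightarrow> \<bar>f (x + t *\<^sub>R u) - f x - t * l\<bar> \<le> (e / (\<bar>c\<bar> + 1)) * \<bar>t\<bar>"
    using has_dir_derivD[OF assms, of "e / (\<bar>c\<bar> + 1)"] by (auto simp: field_simps)
  have "\<bar>f (x + t *\<^sub>R c *\<^sub>R u) - f x - t * (c * l)\<bar> \<le> e * \<bar>t\<bar>" if "\<bar>t\<bar> < d / (\<bar>c\<bar> + 1)" for t
  proof -
    have "\<bar>t * c\<bar> \<le> \<bar>t\<bar> * (\<bar>c\<bar> + 1)" by (simp add: abs_mult algebra_simps)
    also have "\<dots> < d" using that by (simp add: field_simps)
    finally have "\<bar>f (x + (t * c) *\<^sub>R u) - f x - (t * c) * l\<bar> \<le> (e / (\<bar>c\<bar> + 1)) * \<bar>t * c\<bar>" by (rule d(2))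
    also have "\<dots> \<le> (e / (\<bar>c\<bar> + 1)) * (\<bar>t\<bar> * (\<bar>c\<bar> + 1))"
      using \<open>e > 0\<close> by (intro mult_left_mono) (auto simp: abs_mult algebra_simps)
    also have "\<dots> = e * \<bar>t\<bar>" by (simp add: field_simps)
    finally show ?thesis by (simp add: mult_ac)
  qed
  then show "\<exists>d>0. \<forall>t. 0 < \<bar>t\<bar> \<longrightarrow> \<bar>t\<bar> < d \<longrightarrow> \<bar>f (x + t *\<^sub>R c *\<^sub>R u) - f x - t * (c * l)\<bar> \<le> e * \<bar>t\<bar>"
    using d(1) by (intro exI[of _ "d / (\<bar>c\<bar> + 1)"]) auto
qed

text \<open>On each line in direction \<open>u\<close> the one-dimensional theorem applies. The
  slicing lemma wants a Borel set, so the exceptional set is enlarged to the set \<open>M\<close> of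
  oscillation between rational levels, which is Borel by continuity of the quotients in
  \<open>x\<close>.\<close>

lemma Lipschitz_ae_has_dir_deriv:
  fixes f :: "'a::euclidean_space \<Rightarrow> real"
  assumes lip: "L-lipschitz_on UNIV f"
  shows "negligible {x. \<not> (\<exists>l. has_dir_deriv f x u l)}"
proof -
  have L: "L \<ge> 0" using lip lipschitz_on_nonneg by blast
  have fl: "\<bar>f y - f x\<bar> \<le> L * norm (y - x)" for x y
    using lip by (auto simp: lipschitz_on_def dist_norm)
  have cont: "continuous_on UNIV f" using lip lipschitz_on_continuous_on by blast
  define Q where "Q x t = (f (x + t *\<^sub>R u) - f x) / t" for x t
  have Qc: "continuous_on UNIV (\<lambda>x. Q x t)" for t
  proof (cases "t = 0")
    case False
    then show ?thesis unfolding Q_def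
      by (intro continuous_intros continuous_on_compose2[OF cont]) auto
  qed (simp add: Q_def)
  have Qb: "\<bar>Q x t\<bar> \<le> L * norm u" for x t
    using fl[of "x + t *\<^sub>R u" x] L by (cases "t = 0") (auto simp: Q_def abs_divide divide_le_eq mult_ac)
  define P where "P p q = {x. (\<exists>\<^sub>F t in at 0. Q x t < p) \<and> (\<exists>\<^sub>F t in at 0. Q x t > q)}" for p q
  define M where "M = (\<Union>(p,q)\<in>{(p,q). p \<in> \<rat> \<and> q \<in> \<rat> \<and> p < q}. P p q)"
  \<comment> \<open>Scales of the form 1 / (n + 1) suffice, which turns each oscillation set into a
    countable intersection of open sets.\<close>
  have fr: "(\<exists>\<^sub>F t in at (0::real). R t) \<longleftrightarrow> (\<forall>n::nat. \<exists>t. t \<noteq> 0 \<and> \<bar>t\<bar> < 1 / Suc n \<and> R t)" for R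
  proof -
    have "(\<exists>\<^sub>F t in at (0::real). R t) \<longleftrightarrow> (\<forall>d>0. \<exists>t. t \<noteq> 0 \<and> \<bar>t\<bar> < d \<and> R t)"
      by (auto simp: frequently_def eventually_at)
    also have "\<dots> \<longleftrightarrow> (\<forall>n::nat. \<exists>t. t \<noteq> 0 \<and> \<bar>t\<bar> < 1 / Suc n \<and> R t)"
    proof (intro iffI allI impI)
      fix d :: real assume *: "\<forall>n::nat. \<exists>t. t \<noteq> 0 \<and> \<bar>t\<bar> < 1 / Suc n \<and> R t" and "d > 0"
      then obtain n where "1 / Suc n < d" by (metis nat_approx_posE)
      then show "\<exists>t. t \<noteq> 0 \<and> \<bar>t\<bar> < d \<and> R t" using * by (meson less_trans)
    qed auto
    finally show ?thesis .
  qed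
  have Pm: "P p q \<in> sets borel" for p q
  proof -
    have o1: "open {x. \<exists>t. t \<noteq> 0 \<and> \<bar>t\<bar> < e \<and> Q x t < p}" for e
    proof -
      \<comment> \<open>The union over \<open>t\<close> is uncountable; it is openness, rather than
        mere measurability, that survives it.\<close>
      have "{x. \<exists>t. t \<noteq> 0 \<and> \<bar>t\<bar> < e \<and> Q x t < p} = (\<Union>t\<in>{t. t \<noteq> 0 \<and> \<bar>t\<bar> < e}. {x. Q x t < p})" by auto
      also have "open \<dots>" by (intro open_UN ballI open_Collect_less Qc continuous_intros)
      finally show ?thesis .
    qed
    have o2: "open {x. \<exists>t. t \<noteq> 0 \<and> \<bar>t\<bar> < e \<and> Q x t > q}" for e
    proof -
      have "{x. \<exists>t. t \<noteq> 0 \<and> \<bar>t\<bar> < e \<and> Q x t > q} = (\<Union>t\<in>{t. t \<noteq> 0 \<and> \<bar>t\<bar> < e}. {x. Q x t > q})" by auto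
      also have "open \<dots>" by (intro open_UN ballI open_Collect_less Qc continuous_intros)
      finally show ?thesis .
    qed
    have "P p q = (\<Inter>n::nat. {x. \<exists>t. t \<noteq> 0 \<and> \<bar>t\<bar> < 1 / Suc n \<and> Q x t < p}) \<inter>
        (\<Inter>n::nat. {x. \<exists>t. t \<noteq> 0 \<and> \<bar>t\<bar> < 1 / Suc n \<and> Q x t > q})"
      unfolding P_def fr by auto
    also have "\<dots> \<in> sets borel"
      using o1 o2 by (intro sets.Int sets.countable_INT'') auto
    finally show ?thesis .
  qed
  have c: "countable {(p,q). p \<in> (\<rat>::real set) \<and> q \<in> (\<rat>::real set) \<and> p < q}"
  proof -
    have "countable (\<rat> \<times> \<rat> :: (real \<times> real) set)" by (simp add: countable_rat)
    then show ?thesis by (rule countable_subset[rotated]) auto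
  qed
  have "negligible M"
  proof (rule negligible_if_slices_negligible[where u = u])
    show "M \<in> sets borel" unfolding M_def using c Pm by (intro sets.countable_UN') auto
    fix x
    define \<phi> where "\<phi> t = f (x + t *\<^sub>R u)" for t
    have "(L * norm u)-lipschitz_on UNIV \<phi>"
      unfolding lipschitz_on_def dist_real_def
    proof (intro conjI ballI)
      fix s t :: real
      show "\<bar>\<phi> s - \<phi> t\<bar> \<le> L * norm u * \<bar>s - t\<bar>"
        using fl[of "x + s *\<^sub>R u" "x + t *\<^sub>R u"] by (simp add: \<phi>_def scaleR_left_diff_distrib[symmetric] mult_ac)
    qed (use L in auto)
    then have "negligible {t. \<not> (\<exists>l. (\<phi> has_real_derivative l) (at t))}" by (rule Lipschitz_real_ae_differentiable)
    moreover have "{t. x + t *\<^sub>R u \<in> M} \<subseteq> {t. \<not> (\<exists>l. (\<phi> has_real_derivative l) (at t))}"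
    proof clarify
      fix t l assume t: "x + t *\<^sub>R u \<in> M" and l: "(\<phi> has_real_derivative l) (at t)"
      have "((\<lambda>h. (\<phi> (t + h) - \<phi> t) / h) \<longlongrightarrow> l) (at 0)" using l by (simp add: DERIV_def)
      then have lim: "(Q (x + t *\<^sub>R u) \<longlongrightarrow> l) (at 0)"
        by (simp add: Q_def[abs_def] \<phi>_def scaleR_left_distrib add_ac)
      obtain p q where pq: "p < q" "\<exists>\<^sub>F s in at 0. Q (x + t *\<^sub>R u) s < p" "\<exists>\<^sub>F s in at 0. Q (x + t *\<^sub>R u) s > q"
        using t by (auto simp: M_def P_def)
      have "l \<le> p"
      proof (rule ccontr)
        assume "\<not> l \<le> p"
        then have "\<forall>\<^sub>F s in at 0. p < Q (x + t *\<^sub>R u) s" using lim by (intro order_tendstoD) auto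
        then show False using frequently_ex[OF frequently_eventually_frequently[OF pq(2)]] by force
      qed
      moreover have "l \<ge> q"
      proof (rule ccontr)
        assume "\<not> l \<ge> q"
        then have "\<forall>\<^sub>F s in at 0. Q (x + t *\<^sub>R u) s < q" using lim by (intro order_tendstoD) auto
        then show False using frequently_ex[OF frequently_eventually_frequently[OF pq(3)]] by force
      qed
      ultimately show False using pq(1) by simp
    qed
    ultimately show "negligible {t. x + t *\<^sub>R u \<in> M}" by (rule negligible_subset)
  qed
  moreover have "{x. \<not> (\<exists>l. has_dir_deriv f x u l)} \<subseteq> M"
  proof (rule ccontr)
    assume "\<not> {x. \<not> (\<exists>l. has_dir_deriv f x u l)} \<subseteq> M"
    then obtain x where x: "\<not> (\<exists>l. has_dir_deriv f x u l)" "x \<notin> M" by auto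
    have "\<exists>l. (Q x \<longlongrightarrow> l) (at 0)"
      by (rule tendsto_if_no_oscillation[where B = "L * norm u"]) (use x(2) Qb in \<open>auto simp: M_def P_def\<close>)
    then show False using x(1) unfolding has_dir_deriv_def Q_def by blast
  qed
  ultimately show ?thesis by (rule negligible_subset)
qed

text \<open>Nekvinda and Zajicek: at a point of non-porosity of the set where the difference quotients in
  direction \<open>v\<close> are uniformly close to \<open>\<beta>\<close>, the point \<open>x + t u\<close> can be moved into that set.\<close>

lemma Lipschitz_ae_dir_deriv_add:
  fixes f :: "'a::euclidean_space \<Rightarrow> real"
  assumes lip: "L-lipschitz_on UNIV f"
  shows "negligible {x. \<exists>a b. has_dir_deriv f x u a \<and> has_dir_deriv f x v b \<and> \<not> has_dir_deriv f x (u + v) (a + b)}"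
    (is "negligible ?B")
proof -
  have L: "L \<ge> 0" using lip lipschitz_on_nonneg by blast
  have fl: "\<bar>f y - f x\<bar> \<le> L * norm (y - x)" for x y
    using lip by (auto simp: lipschitz_on_def dist_norm)
  \<comment> \<open>The quotients in direction \<open>v\<close> are within \<open>e\<close> of
    \<open>\<beta>\<close> at all scales below \<open>d\<close>. Rational parameters give countably
    many such sets, and the porous points of each are negligible.\<close>
  define A where "A \<beta> e d = {x. \<forall>t. \<bar>t\<bar> < d \<longrightarrow> \<bar>f (x + t *\<^sub>R v) - f x - t * \<beta>\<bar> \<le> e * \<bar>t\<bar>}" for \<beta> e d :: real
  define N where "N \<beta> e d = {x\<in>A \<beta> e d. \<forall>\<delta>>0. \<exists>t. 0 < \<bar>t\<bar> \<and> \<bar>t\<bar> < \<delta> \<and> ball (x + t *\<^sub>R u) (e * \<bar>t\<bar>) \<inter> A \<beta> e d = {}}" for \<beta> e d :: real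
  define J where "J = (\<rat> \<times> \<rat> \<times> \<rat> :: (real \<times> real \<times> real) set) \<inter> {(\<beta>, e, d). e > 0}"
  have "countable J" unfolding J_def by (intro countable_Int1) (simp add: countable_rat)
  then have "negligible (\<Union>(\<beta>,e,d)\<in>J. N \<beta> e d)"
    using negligible_porous by (intro negligible_countable_Union) (auto simp: N_def J_def)
  moreover have "?B \<subseteq> (\<Union>(\<beta>,e,d)\<in>J. N \<beta> e d)"
  proof (rule ccontr)
    assume "\<not> ?B \<subseteq> (\<Union>(\<beta>,e,d)\<in>J. N \<beta> e d)"
    then obtain x where "x \<in> ?B" and x: "x \<notin> (\<Union>(\<beta>,e,d)\<in>J. N \<beta> e d)" by blast
    then obtain a b where ab: "has_dir_deriv f x u a" "has_dir_deriv f x v b"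
      and nd: "\<not> has_dir_deriv f x (u + v) (a + b)" by blast
    have "has_dir_deriv f x (u + v) (a + b)"
    proof (rule has_dir_derivI)
      fix \<epsilon> :: real assume \<epsilon>: "\<epsilon> > 0"
      \<comment> \<open>Five errors are summed at the end: three of size
        \<open>e * \<bar>t\<bar>\<close> (the increments along \<open>u\<close> and
        \<open>v\<close>, and the change from \<open>b\<close> to \<open>\<beta>\<close>) and two of
        size \<open>L * (e * \<bar>t\<bar>)\<close> for replacing \<open>x + t u\<close> by
        \<open>z\<close> before and after the step along \<open>v\<close>.\<close>
      obtain e where e: "0 < e" "e < \<epsilon> / (3 + 2 * L)" "e \<in> \<rat>"
        using Rats_dense_in_real[of 0 "\<epsilon> / (3 + 2 * L)"] \<epsilon> L by auto
      \<comment> \<open>Half of \<open>e\<close> is spent on the rational approximation of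
        \<open>b\<close>, the other half on the differentiability of \<open>f\<close> at
        \<open>x\<close> in direction \<open>v\<close>.\<close>
      obtain \<beta> where \<beta>: "b < \<beta>" "\<beta> < b + e / 2" "\<beta> \<in> \<rat>"
        using Rats_dense_in_real[of b "b + e / 2"] e by auto
      obtain d0 where d0: "d0 > 0" "\<And>t. \<bar>t\<bar> < d0 \<Longrightarrow> \<bar>f (x + t *\<^sub>R v) - f x - t * b\<bar> \<le> (e/2) * \<bar>t\<bar>"
        using has_dir_derivD[OF ab(2), of "e/2"] e by auto
      obtain d where d: "0 < d" "d < d0" "d \<in> \<rat>" using Rats_dense_in_real[of 0 d0] d0 by auto
      have xA: "x \<in> A \<beta> e d"
      proof -
        have "\<bar>f (x + t *\<^sub>R v) - f x - t * \<beta>\<bar> \<le> e * \<bar>t\<bar>" if "\<bar>t\<bar> < d" for t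
        proof -
          have "\<bar>t * b - t * \<beta>\<bar> = \<bar>\<beta> - b\<bar> * \<bar>t\<bar>" unfolding abs_mult[symmetric] by (simp add: algebra_simps abs_minus_commute)
          also have "\<dots> \<le> e / 2 * \<bar>t\<bar>" using \<beta> by (intro mult_right_mono) auto
          finally show ?thesis using d0(2)[of t] that d by linarith
        qed
        then show ?thesis by (simp add: A_def)
      qed
      have "(\<beta>, e, d) \<in> J" using e \<beta> d by (auto simp: J_def)
      then have "x \<notin> N \<beta> e d" using x by auto
      then obtain \<delta> where \<delta>: "\<delta> > 0" "\<And>t. 0 < \<bar>t\<bar> \<Longrightarrow> \<bar>t\<bar> < \<delta> \<Longrightarrow> ball (x + t *\<^sub>R u) (e * \<bar>t\<bar>) \<inter> A \<beta> e d \<noteq> {}"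
        using xA unfolding N_def by blast
      obtain d1 where d1: "d1 > 0" "\<And>t. \<bar>t\<bar> < d1 \<Longrightarrow> \<bar>f (x + t *\<^sub>R u) - f x - t * a\<bar> \<le> e * \<bar>t\<bar>"
        using has_dir_derivD[OF ab(1), of e] e by auto
      have "\<bar>f (x + t *\<^sub>R (u + v)) - f x - t * (a + b)\<bar> \<le> \<epsilon> * \<bar>t\<bar>"
        if t: "0 < \<bar>t\<bar>" "\<bar>t\<bar> < min \<delta> (min d d1)" for t
      proof -
        obtain z where z: "dist (x + t *\<^sub>R u) z < e * \<bar>t\<bar>" "z \<in> A \<beta> e d"
          using \<delta>(2)[of t] t by auto
        have "\<bar>f (z + t *\<^sub>R v) - f z - t * \<beta>\<bar> \<le> e * \<bar>t\<bar>" using z t by (auto simp: A_def)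
        moreover have "\<bar>f (x + t *\<^sub>R (u + v)) - f (z + t *\<^sub>R v)\<bar> \<le> L * (e * \<bar>t\<bar>)"
        proof -
          have "\<bar>f (x + t *\<^sub>R (u + v)) - f (z + t *\<^sub>R v)\<bar> \<le> L * dist (x + t *\<^sub>R u) z"
            using fl[of "x + t *\<^sub>R (u + v)" "z + t *\<^sub>R v"] by (simp add: dist_norm scaleR_right_distrib)
          also have "\<dots> \<le> L * (e * \<bar>t\<bar>)" using z L by (intro mult_left_mono) auto
          finally show ?thesis .
        qed
        moreover have "\<bar>f (x + t *\<^sub>R u) - f z\<bar> \<le> L * (e * \<bar>t\<bar>)"
        proof -
          have "\<bar>f (x + t *\<^sub>R u) - f z\<bar> \<le> L * dist (x + t *\<^sub>R u) z"
            using fl[of "x + t *\<^sub>R u" z] by (simp add: dist_norm)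
          also have "\<dots> \<le> L * (e * \<bar>t\<bar>)" using z L by (intro mult_left_mono) auto
          finally show ?thesis .
        qed
        moreover have "\<bar>t * b - t * \<beta>\<bar> \<le> e * \<bar>t\<bar>"
        proof -
          have "\<bar>t * b - t * \<beta>\<bar> = \<bar>\<beta> - b\<bar> * \<bar>t\<bar>" unfolding abs_mult[symmetric] by (simp add: algebra_simps abs_minus_commute)
          also have "\<dots> \<le> e * \<bar>t\<bar>" using \<beta> e by (intro mult_right_mono) auto
          finally show ?thesis .
        qed
        moreover have "\<bar>f (x + t *\<^sub>R u) - f x - t * a\<bar> \<le> e * \<bar>t\<bar>" using d1(2)[of t] t by auto
        ultimately have "\<bar>f (x + t *\<^sub>R (u + v)) - f x - t * (a + b)\<bar> \<le> 3 * (e * \<bar>t\<bar>) + 2 * (L * (e * \<bar>t\<bar>))"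
          unfolding distrib_left by linarith
        also have "\<dots> = (e * (3 + 2 * L)) * \<bar>t\<bar>" by (simp add: algebra_simps)
        also have "\<dots> \<le> \<epsilon> * \<bar>t\<bar>" using e L by (intro mult_right_mono) (auto simp: field_simps)
        finally show ?thesis .
      qed
      then show "\<exists>d>0. \<forall>t. 0 < \<bar>t\<bar> \<longrightarrow> \<bar>t\<bar> < d \<longrightarrow> \<bar>f (x + t *\<^sub>R (u + v)) - f x - t * (a + b)\<bar> \<le> \<epsilon> * \<bar>t\<bar>"
        using \<delta>(1) d(1) d1(1) by (intro exI[of _ "min \<delta> (min d d1)"]) auto
    qed
    then show False using nd by blast
  qed
  ultimately show ?thesis by (rule negligible_subset)
qed

text \<open>The exceptional set depends on the coefficients, so this treats one linear combination
  at a time and is later applied to countably many. The values \<open>D\<close> are chosen inside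
  the set because they vary with \<open>x\<close>.\<close>

lemma Lipschitz_ae_dir_deriv_linear:
  fixes f :: "'a::euclidean_space \<Rightarrow> real"
  assumes lip: "L-lipschitz_on UNIV f" and "finite S"
  shows "negligible {x. \<exists>D. (\<forall>b\<in>S. has_dir_deriv f x b (D b)) \<and> \<not> has_dir_deriv f x (\<Sum>b\<in>S. c b *\<^sub>R b) (\<Sum>b\<in>S. c b * D b)}"
  using assms(2)
proof (induction S rule: finite_induct)
  case empty
  have "has_dir_deriv f x 0 0" for x by (rule has_dir_derivI) (auto intro: exI[of _ 1])
  then show ?case by simp
next
  case (insert k S)
  let ?B = "{x. \<exists>a b. has_dir_deriv f x (c k *\<^sub>R k) a \<and> has_dir_deriv f x (\<Sum>b\<in>S. c b *\<^sub>R b) b \<and> \<not> has_dir_deriv f x (c k *\<^sub>R k + (\<Sum>b\<in>S. c b *\<^sub>R b)) (a + b)}"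
  have "negligible (?B \<union> {x. \<exists>D. (\<forall>b\<in>S. has_dir_deriv f x b (D b)) \<and> \<not> has_dir_deriv f x (\<Sum>b\<in>S. c b *\<^sub>R b) (\<Sum>b\<in>S. c b * D b)})"
    by (rule negligible_Un[OF Lipschitz_ae_dir_deriv_add[OF lip] insert.IH])
  then show ?case
  proof (rule negligible_subset)
    show "{x. \<exists>D. (\<forall>b\<in>insert k S. has_dir_deriv f x b (D b)) \<and> \<not> has_dir_deriv f x (\<Sum>b\<in>insert k S. c b *\<^sub>R b) (\<Sum>b\<in>insert k S. c b * D b)}
      \<subseteq> ?B \<union> {x. \<exists>D. (\<forall>b\<in>S. has_dir_deriv f x b (D b)) \<and> \<not> has_dir_deriv f x (\<Sum>b\<in>S. c b *\<^sub>R b) (\<Sum>b\<in>S. c b * D b)}"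
      (is "?L \<subseteq> ?B \<union> ?R")
    proof (rule subsetI, rule ccontr)
      fix x assume "x \<in> ?L" and nx: "x \<notin> ?B \<union> ?R"
      then obtain D where *: "\<forall>b\<in>insert k S. has_dir_deriv f x b (D b)"
        "\<not> has_dir_deriv f x (\<Sum>b\<in>insert k S. c b *\<^sub>R b) (\<Sum>b\<in>insert k S. c b * D b)" by blast
      have "has_dir_deriv f x (\<Sum>b\<in>S. c b *\<^sub>R b) (\<Sum>b\<in>S. c b * D b)" using * nx by auto
      moreover have "has_dir_deriv f x (c k *\<^sub>R k) (c k * D k)" using * by (intro has_dir_deriv_scaleR) auto
      ultimately show False using *(2) nx insert.hyps by auto
    qed
  qed
qed

text \<open>Off a null set, the directional derivatives in a countable dense set of directions agree
  with one linear map \<open>T\<close>. The Lipschitz bound and compactness of the unit sphere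
  extend the approximation to all directions, uniformly.\<close>

theorem Rademacher_real:
  fixes f :: "'a::euclidean_space \<Rightarrow> real"
  assumes lip: "L-lipschitz_on UNIV f"
  shows "negligible {x. \<not> f differentiable (at x)}"
proof -
  have L: "L \<ge> 0" using lip lipschitz_on_nonneg by blast
  have fl: "\<bar>f y - f x\<bar> \<le> L * norm (y - x)" for x y
    using lip by (auto simp: lipschitz_on_def dist_norm)
  obtain Q :: "'a set" where Q: "countable Q" "\<And>X. open X \<Longrightarrow> X \<noteq> {} \<Longrightarrow> \<exists>d\<in>Q. d \<in> X"
    using countable_dense_setE by blast
  define N1 where "N1 = (\<Union>b\<in>Basis. {x. \<not> (\<exists>l. has_dir_deriv f x b l)})"
  define N2 where "N2 = (\<Union>u\<in>Q. {x. \<exists>D. (\<forall>b\<in>Basis. has_dir_deriv f x b (D b)) \<and>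
      \<not> has_dir_deriv f x (\<Sum>b\<in>Basis. (u \<bullet> b) *\<^sub>R b) (\<Sum>b\<in>Basis. (u \<bullet> b) * D b)})"
  have "negligible N1" unfolding N1_def
    using Lipschitz_ae_has_dir_deriv[OF lip] by (intro negligible_countable_Union) (auto intro: countable_finite)
  moreover have "negligible N2" unfolding N2_def
    using Lipschitz_ae_dir_deriv_linear[OF lip finite_Basis] Q(1) by (intro negligible_countable_Union) auto
  ultimately have "negligible (N1 \<union> N2)" by (rule negligible_Un)
  moreover have "f differentiable (at x)" if x: "x \<notin> N1 \<union> N2" for x
  proof -
    obtain D where D: "\<And>b. b \<in> Basis \<Longrightarrow> has_dir_deriv f x b (D b)"
      using x unfolding N1_def by simp metis
    define T where "T u = (\<Sum>b\<in>Basis. (u \<bullet> b) * D b)" for u :: 'a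
    have TQ: "has_dir_deriv f x u (T u)" if "u \<in> Q" for u
      using x that D unfolding N2_def T_def by (auto simp: euclidean_representation)
    have lin: "linear T"
      unfolding T_def by (intro linearI) (simp_all add: inner_add_left distrib_right sum.distrib sum_distrib_left mult.assoc)
    then obtain B where B: "B > 0" "\<And>u. norm (T u) \<le> B * norm u"
      using linear_bounded_pos by blast
    have "(f has_derivative T) (at x)"
      unfolding has_derivative_at_alt
    proof (intro conjI allI impI)
      show "bounded_linear T" using lin by (simp add: linear_conv_bounded_linear)
      fix \<epsilon> :: real assume \<epsilon>: "\<epsilon> > 0"
      \<comment> \<open>Three errors: the derivative in a direction of the net, and the cost of
        moving to that direction in \<open>T\<close> (factor \<open>B\<close>) and in
        \<open>f\<close> (factor \<open>L\<close>).\<close>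
      define e where "e = \<epsilon> / (1 + B + L)"
      have e: "e > 0" "e * (1 + B + L) = \<epsilon>" using \<epsilon> B L by (auto simp: e_def)
      have cov: "sphere 0 1 \<subseteq> (\<Union>u\<in>Q. ball u e)"
      proof
        fix w :: 'a
        obtain u where "u \<in> Q" "u \<in> ball w e" using Q(2)[of "ball w e"] e by auto
        then show "w \<in> (\<Union>u\<in>Q. ball u e)" by (auto simp: dist_commute)
      qed
      \<comment> \<open>Finiteness of the net is what gives a common scale for the approximation in
        all its directions.\<close>
      obtain F where F: "finite F" "F \<subseteq> Q" "sphere (0::'a) 1 \<subseteq> (\<Union>u\<in>F. ball u e)"
        by (rule compactE_image[OF compact_sphere _ cov]) auto
      have "\<forall>\<^sub>F d in at_right 0. \<forall>u\<in>F. \<forall>t. \<bar>t\<bar> < d \<longrightarrow> \<bar>f (x + t *\<^sub>R u) - f x - t * T u\<bar> \<le> e * \<bar>t\<bar>"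
      proof (intro eventually_ball_finite F(1) ballI)
        fix u assume "u \<in> F"
        then obtain d where "d > 0" "\<forall>t. \<bar>t\<bar> < d \<longrightarrow> \<bar>f (x + t *\<^sub>R u) - f x - t * T u\<bar> \<le> e * \<bar>t\<bar>"
          using has_dir_derivD[OF TQ e(1), of u] F by blast
        then show "\<forall>\<^sub>F d in at_right 0. \<forall>t. \<bar>t\<bar> < d \<longrightarrow> \<bar>f (x + t *\<^sub>R u) - f x - t * T u\<bar> \<le> e * \<bar>t\<bar>"
          unfolding eventually_at_right_field by (intro exI[of _ d]) auto
      qed
      then obtain d0 where d0: "d0 > 0"
        "\<And>d. 0 < d \<Longrightarrow> d < d0 \<Longrightarrow> \<forall>u\<in>F. \<forall>t. \<bar>t\<bar> < d \<longrightarrow> \<bar>f (x + t *\<^sub>R u) - f x - t * T u\<bar> \<le> e * \<bar>t\<bar>"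
        unfolding eventually_at_right_field by blast
      define d where "d = d0 / 2"
      have d: "d > 0" "\<forall>u\<in>F. \<forall>t. \<bar>t\<bar> < d \<longrightarrow> \<bar>f (x + t *\<^sub>R u) - f x - t * T u\<bar> \<le> e * \<bar>t\<bar>"
        using d0(1) d0(2)[of d] by (auto simp: d_def)
      have "norm (f y - f x - T (y - x)) \<le> \<epsilon> * norm (y - x)" if y: "norm (y - x) < d" for y
      proof (cases "y = x")
        case False
        define t where "t = norm (y - x)"
        define w where "w = (1 / t) *\<^sub>R (y - x)"
        have t: "t > 0" and w: "norm w = 1" "y - x = t *\<^sub>R w" using False by (auto simp: t_def w_def)
        obtain u where u: "u \<in> F" "norm (u - w) < e" using F(3) w by (force simp: dist_norm)
        have "\<bar>f (x + t *\<^sub>R u) - f x - t * T u\<bar> \<le> e * t" using d(2)[rule_format, of u t] u y t by (simp add: t_def)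
        moreover have "\<bar>f y - f (x + t *\<^sub>R u)\<bar> \<le> L * (e * t)"
        proof -
          have "y - (x + t *\<^sub>R u) = t *\<^sub>R (w - u)" using w by (simp add: algebra_simps)
          then have "\<bar>f y - f (x + t *\<^sub>R u)\<bar> \<le> L * (t * norm (w - u))"
            using fl[of y "x + t *\<^sub>R u"] t by simp
          also have "\<dots> \<le> L * (t * e)" using u t L by (intro mult_left_mono) (auto simp: norm_minus_commute)
          finally show ?thesis by (simp add: mult_ac)
        qed
        moreover have "\<bar>t * T u - T (y - x)\<bar> \<le> B * (e * t)"
        proof -
          have "t * T u - T (y - x) = t * T (u - w)" using lin w by (simp add: linear_cmul linear_diff algebra_simps)
          then have "\<bar>t * T u - T (y - x)\<bar> = t * \<bar>T (u - w)\<bar>" using t by (simp add: abs_mult)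
          also have "\<dots> \<le> t * (B * e)"
            using B(2)[of "u - w"] u t B(1) by (intro mult_left_mono) (auto intro: order_trans mult_left_mono)
          finally show ?thesis by (simp add: mult_ac)
        qed
        ultimately have "\<bar>f y - f x - T (y - x)\<bar> \<le> e * t + L * (e * t) + B * (e * t)" by linarith
        also have "\<dots> = (e * (1 + B + L)) * t" by (simp add: algebra_simps)
        finally show ?thesis unfolding e(2) t_def by simp
      qed (use lin in \<open>simp add: linear_0\<close>)
      then show "\<exists>d>0. \<forall>y. norm (y - x) < d \<longrightarrow> norm (f y - f x - T (y - x)) \<le> \<epsilon> * norm (y - x)"
        using d(1) by blast
    qed
    then show ?thesis unfolding differentiable_def by blast
  qed
  then have "{x. \<not> f differentiable (at x)} \<subseteq> N1 \<union> N2" by blast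
  ultimately show ?thesis by (rule negligible_subset)
qed

theorem Rademacher:
  fixes f :: "'a::euclidean_space \<Rightarrow> 'b::euclidean_space"
  assumes lip: "L-lipschitz_on UNIV f"
  shows "negligible {x. \<not> f differentiable (at x)}"
proof -
  have "L-lipschitz_on UNIV (\<lambda>x. f x \<bullet> b)" if "b \<in> Basis" for b
  proof -
    have "\<bar>f x \<bullet> b - f y \<bullet> b\<bar> \<le> L * dist x y" for x y
      using norm_nth_le[OF that, of "f x - f y"] lip
      by (auto simp: lipschitz_on_def dist_norm inner_diff_left intro: order_trans)
    then show ?thesis using lip by (auto simp: lipschitz_on_def dist_real_def)
  qed
  then have "negligible (\<Union>b\<in>Basis. {x. \<not> (\<lambda>x. f x \<bullet> b) differentiable (at x)})"
    using Rademacher_real by (intro negligible_countable_Union) (auto intro: countable_finite)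
  then show ?thesis
    by (rule negligible_subset) (auto simp: differentiable_componentwise_within[of f])
qed

section \<open>Hausdorff measures\<close>

lemma ediameter_empty [simp]: "ediameter d {} = 0"
  by (simp add: ediameter_def bot_ennreal)

lemma ediameter_le:
  assumes "\<And>p q. p \<in> A \<Longrightarrow> q \<in> A \<Longrightarrow> d p q \<le> \<rho>"
  shows "ediameter d A \<le> ennreal \<rho>"
  unfolding ediameter_def using assms by (intro SUP_least ennreal_leI) auto

lemma le_ediameter: "p \<in> A \<Longrightarrow> q \<in> A \<Longrightarrow> ennreal (d p q) \<le> ediameter d A"
  unfolding ediameter_def by (meson SUP_upper2 order_refl)

lemma hausdorff_pre_le:
  assumes "A \<subseteq> (\<Union>i. U i)" "\<And>i. ediameter d (U i) < ennreal \<delta>"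
  shows "hausdorff_pre d k \<delta> A \<le> (\<Sum>i. ediameter d (U i) ^ k)"
  unfolding hausdorff_pre_def using assms by (intro INF_lower) auto

lemma hausdorff_pre_mono: "A \<subseteq> B \<Longrightarrow> hausdorff_pre d k \<delta> A \<le> hausdorff_pre d k \<delta> B"
  unfolding hausdorff_pre_def by (rule INF_superset_mono) auto

lemma hausdorff_pre_le_power:
  assumes "ediameter d A \<le> ennreal \<rho>" "0 \<le> \<rho>" "\<rho> < \<delta>" "k \<ge> 1"
  shows "hausdorff_pre d k \<delta> A \<le> ennreal (\<rho> ^ k)"
proof -
  \<comment> \<open>A single set is padded to a sequence; the empty sets add \<open>0 ^ k\<close>,
    which vanishes because \<open>k\<close> is at least 1.\<close>
  let ?U = "\<lambda>i::nat. if i = 0 then A else {}"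
  have lt: "ediameter d A < ennreal \<delta>"
    using assms by (metis ennreal_less_iff le_less_trans)
  have "hausdorff_pre d k \<delta> A \<le> (\<Sum>i. ediameter d (?U i) ^ k)"
    using lt le_less_trans[OF zero_le lt] by (intro hausdorff_pre_le) (auto split: if_splits)
  also have "\<dots> = (\<Sum>i\<in>{0}. ediameter d (?U i) ^ k)"
    using assms by (intro suminf_finite) (auto simp: power_0_left)
  also have "\<dots> \<le> ennreal (\<rho> ^ k)"
    using assms by (simp add: power_mono flip: ennreal_power)
  finally show ?thesis .
qed

lemma hausdorff_pre_empty: "\<delta> > 0 \<Longrightarrow> k \<ge> 1 \<Longrightarrow> hausdorff_pre d k \<delta> {} = 0"
  using hausdorff_pre_le_power[of d "{}" 0 \<delta> k] by (simp add: power_0_left)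

text \<open>Merging covers preserves the bound on the diameters, so subadditivity holds at each
  fixed scale. The covering estimates rely on this, since they count pieces before the scale tends
  to 0.\<close>

lemma hausdorff_pre_UN_nat:
  fixes A :: "nat \<Rightarrow> 'a set"
  shows "hausdorff_pre d k \<delta> (\<Union>i. A i) \<le> (\<Sum>i. hausdorff_pre d k \<delta> (A i))"
proof (rule ennreal_le_epsilon)
  fix e :: real assume fin: "(\<Sum>i. hausdorff_pre d k \<delta> (A i)) < top" and e: "0 < e"
  have "\<exists>U. A i \<subseteq> (\<Union>j::nat. U j) \<and> (\<forall>j. ediameter d (U j) < ennreal \<delta>) \<and>
      (\<Sum>j. ediameter d (U j) ^ k) \<le> hausdorff_pre d k \<delta> (A i) + ennreal (e * (1/2) ^ Suc i)" for i
  proof -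
    have "hausdorff_pre d k \<delta> (A i) < top" using ennreal_suminf_lessD[OF fin] .
    then have "hausdorff_pre d k \<delta> (A i) < hausdorff_pre d k \<delta> (A i) + ennreal (e * (1/2) ^ Suc i)"
      using e by (cases "hausdorff_pre d k \<delta> (A i)") (auto simp: ennreal_less_iff simp flip: ennreal_plus)
    then show ?thesis
      unfolding hausdorff_pre_def[of d k \<delta> "A i"] by (subst (asm) (1) INF_less_iff) (auto intro: less_imp_le)
  qed
  then obtain U where U: "\<And>i. A i \<subseteq> (\<Union>j::nat. U i j)" "\<And>i j. ediameter d (U i j) < ennreal \<delta>"
    "\<And>i. (\<Sum>j. ediameter d (U i j) ^ k) \<le> hausdorff_pre d k \<delta> (A i) + ennreal (e * (1/2) ^ Suc i)"
    by metis
  define W where "W = (\<lambda>(i, j). U i j)"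
  have "(\<Union>i. A i) \<subseteq> (\<Union>n. W (prod_decode n))"
  proof clarify
    fix x i assume "x \<in> A i"
    then obtain j where "x \<in> U i j" using U(1) by blast
    then have "x \<in> W (prod_decode (prod_encode (i, j)))" by (simp add: W_def)
    then show "x \<in> (\<Union>n. W (prod_decode n))" by blast
  qed
  then have "hausdorff_pre d k \<delta> (\<Union>i. A i) \<le> (\<Sum>n. ediameter d (W (prod_decode n)) ^ k)"
    using U(2) by (intro hausdorff_pre_le) (auto simp: W_def split: prod.splits)
  also have "\<dots> = (\<Sum>i. \<Sum>j. ediameter d (U i j) ^ k)"
    by (rule suminf_ennreal_2dimen[of _ "\<lambda>p. ediameter d (W p) ^ k"]) (simp add: W_def)
  also have "\<dots> \<le> (\<Sum>i. hausdorff_pre d k \<delta> (A i) + ennreal (e * (1/2) ^ Suc i))"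
    by (intro suminf_le U(3)) auto
  also have "\<dots> = (\<Sum>i. hausdorff_pre d k \<delta> (A i)) + (\<Sum>i. ennreal (e * (1/2) ^ Suc i))"
    by (intro suminf_add[symmetric]) auto
  also have "(\<Sum>i. ennreal (e * (1/2) ^ Suc i)) = ennreal e"
    using sums_mult[OF power_half_series, of e] e by (intro suminf_ennreal_eq) auto
  finally show "hausdorff_pre d k \<delta> (\<Union>i. A i) \<le> (\<Sum>i. hausdorff_pre d k \<delta> (A i)) + ennreal e" .
qed

lemma hausdorff_pre_Un:
  assumes "\<delta> > 0" "k \<ge> 1"
  shows "hausdorff_pre d k \<delta> (A \<union> B) \<le> hausdorff_pre d k \<delta> A + hausdorff_pre d k \<delta> B"
proof -
  let ?A = "\<lambda>i::nat. if i = 0 then A else if i = 1 then B else {}"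
  have "hausdorff_pre d k \<delta> (A \<union> B) \<le> hausdorff_pre d k \<delta> (\<Union>i. ?A i)"
    by (intro hausdorff_pre_mono) (auto split: if_splits)
  also have "\<dots> \<le> (\<Sum>i. hausdorff_pre d k \<delta> (?A i))" by (rule hausdorff_pre_UN_nat)
  also have "\<dots> = (\<Sum>i\<in>{0,1}. hausdorff_pre d k \<delta> (?A i))"
    using assms by (intro suminf_finite) (auto simp: hausdorff_pre_empty)
  finally show ?thesis by simp
qed

lemma hausdorff_pre_UN_finite:
  assumes "\<delta> > 0" "k \<ge> 1" "finite I"
  shows "hausdorff_pre d k \<delta> (\<Union>i\<in>I. A i) \<le> (\<Sum>i\<in>I. hausdorff_pre d k \<delta> (A i))"
  using assms(3)
proof (induction I rule: finite_induct)
  case (insert i I)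
  have "hausdorff_pre d k \<delta> (\<Union>i\<in>insert i I. A i) \<le> hausdorff_pre d k \<delta> (A i) + hausdorff_pre d k \<delta> (\<Union>i\<in>I. A i)"
    using hausdorff_pre_Un[OF assms(1,2)] by simp
  also have "\<dots> \<le> hausdorff_pre d k \<delta> (A i) + (\<Sum>i\<in>I. hausdorff_pre d k \<delta> (A i))"
    by (intro add_left_mono insert.IH)
  finally show ?case using insert.hyps by simp
qed (use assms hausdorff_pre_empty in auto)

lemma hausdorff_pre_UN_countable:
  assumes "\<delta> > 0" "k \<ge> 1" and C: "countable C"
  shows "hausdorff_pre d k \<delta> (\<Union>i\<in>C. A i) \<le> (\<integral>\<^sup>+i. hausdorff_pre d k \<delta> (A i) \<partial>count_space C)"
proof (cases "finite C")
  case True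
  then show ?thesis
    using hausdorff_pre_UN_finite[OF assms(1,2)] by (simp add: nn_integral_count_space_finite)
next
  case False
  then have bij: "bij_betw (from_nat_into C) UNIV C" using C by (simp add: bij_betw_from_nat_into)
  then have "(\<Union>i\<in>C. A i) = (\<Union>n. A (from_nat_into C n))" by (metis bij_betw_imp_surj_on image_image)
  then show ?thesis
    using hausdorff_pre_UN_nat[of d k \<delta> "\<lambda>n. A (from_nat_into C n)"]
      nn_integral_bij_count_space[OF bij, of "\<lambda>i. hausdorff_pre d k \<delta> (A i)"]
    by (simp add: nn_integral_count_space_nat)
qed

lemma hausdorff_pre_le_hausdorff: "\<delta> > 0 \<Longrightarrow> hausdorff_pre d k \<delta> A \<le> hausdorff d k A"
  unfolding hausdorff_eq_SUP by (intro SUP_upper) auto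

lemma hausdorff_le: "(\<And>\<delta>. \<delta> > 0 \<Longrightarrow> hausdorff_pre d k \<delta> A \<le> B) \<Longrightarrow> hausdorff d k A \<le> B"
  unfolding hausdorff_eq_SUP by (intro SUP_least) auto

lemma hausdorff_mono: "A \<subseteq> B \<Longrightarrow> hausdorff d k A \<le> hausdorff d k B"
  by (meson hausdorff_le hausdorff_pre_le_hausdorff hausdorff_pre_mono order_trans)

lemma hausdorff_null_subset: "hausdorff d k B = 0 \<Longrightarrow> A \<subseteq> B \<Longrightarrow> hausdorff d k A = 0"
  using hausdorff_mono[of A B d k] by simp

lemma hausdorff_UN_nat: "hausdorff d k (\<Union>i. A i) \<le> (\<Sum>i::nat. hausdorff d k (A i))"
proof (rule hausdorff_le)
  fix \<delta> :: real assume "\<delta> > 0"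
  then have "(\<Sum>i. hausdorff_pre d k \<delta> (A i)) \<le> (\<Sum>i. hausdorff d k (A i))"
    by (intro suminf_le hausdorff_pre_le_hausdorff) auto
  then show "hausdorff_pre d k \<delta> (\<Union>i. A i) \<le> (\<Sum>i. hausdorff d k (A i))"
    using hausdorff_pre_UN_nat order_trans by blast
qed

lemma hausdorff_Un:
  assumes "k \<ge> 1"
  shows "hausdorff d k (A \<union> B) \<le> hausdorff d k A + hausdorff d k B"
proof (rule hausdorff_le)
  fix \<delta> :: real assume "\<delta> > 0"
  then show "hausdorff_pre d k \<delta> (A \<union> B) \<le> hausdorff d k A + hausdorff d k B"
    using hausdorff_pre_Un[OF _ assms] hausdorff_pre_le_hausdorff by (meson add_mono order_trans)
qed

lemma hausdorff_UN_finite: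
  assumes "k \<ge> 1" "finite I"
  shows "hausdorff d k (\<Union>i\<in>I. A i) \<le> (\<Sum>i\<in>I. hausdorff d k (A i))"
proof (rule hausdorff_le)
  fix \<delta> :: real assume "\<delta> > 0"
  then show "hausdorff_pre d k \<delta> (\<Union>i\<in>I. A i) \<le> (\<Sum>i\<in>I. hausdorff d k (A i))"
    by (intro order_trans[OF hausdorff_pre_UN_finite[OF _ assms] sum_mono] hausdorff_pre_le_hausdorff)
qed

lemma hausdorff_null_empty: "k \<ge> 1 \<Longrightarrow> hausdorff d k {} = 0"
  using hausdorff_le[of d k "{}" 0] by (simp add: hausdorff_pre_empty)

lemma hausdorff_null_UN:
  assumes "k \<ge> 1" "countable I" "\<And>i. i \<in> I \<Longrightarrow> hausdorff d k (A i) = 0"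
  shows "hausdorff d k (\<Union>i\<in>I. A i) = 0"
proof (cases "I = {}")
  case False
  then have "hausdorff d k (A (from_nat_into I n)) = 0" for n
    by (intro assms(3) from_nat_into)
  then have "hausdorff d k (\<Union>n. A (from_nat_into I n)) = 0"
    using hausdorff_UN_nat[of d k "\<lambda>n. A (from_nat_into I n)"] by simp
  moreover have "(\<Union>i\<in>I. A i) \<subseteq> (\<Union>n. A (from_nat_into I n))"
  proof
    fix x assume "x \<in> (\<Union>i\<in>I. A i)"
    then obtain i where i: "i \<in> I" "x \<in> A i" by blast
    then obtain n where "from_nat_into I n = i" using from_nat_into_surj[OF assms(2)] by blast
    then show "x \<in> (\<Union>n. A (from_nat_into I n))" using i by blast
  qed
  ultimately show ?thesis by (rule hausdorff_null_subset)
qed (use assms hausdorff_null_empty in auto)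

lemma hausdorff_null_Un:
  assumes "k \<ge> 1" "hausdorff d k A = 0" "hausdorff d k B = 0"
  shows "hausdorff d k (A \<union> B) = 0"
  using hausdorff_Un[OF assms(1), of d A B] assms by simp

section \<open>Images under maps defined on Euclidean space\<close>

text \<open>The radii come from the \<open>5 r\<close> covering lemma, so no negligible remainder is left over.\<close>

lemma hausdorff_pre_image_le:
  fixes F :: "'a::euclidean_space \<Rightarrow> 'b"
  assumes \<delta>: "\<delta> > 0" and k: "k \<ge> 1" and \<eta>: "\<eta> \<ge> 0" and G: "open G" "S \<subseteq> G"
    and S: "\<And>x s. x \<in> S \<Longrightarrow> s > 0 \<Longrightarrow>
      \<exists>r. 0 < r \<and> r < s \<and> hausdorff_pre d k \<delta> (F ` (S \<inter> cball x (5 * r))) \<le> ennreal (\<eta> * r ^ DIM('a))"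
  shows "hausdorff_pre d k \<delta> (F ` S) \<le> ennreal (\<eta> / unit_ball_vol DIM('a)) * emeasure lebesgue G"
proof -
  \<comment> \<open>\<open>r \<le> 1\<close> gives the bounded radii that the covering lemma needs;
    the inclusion in \<open>G\<close> lets the volumes of the disjoint balls be summed against the
    measure of \<open>G\<close>.\<close>
  define K where "K = {(x, r). x \<in> S \<and> 0 < r \<and> r \<le> 1 \<and> cball x r \<subseteq> G \<and>
     hausdorff_pre d k \<delta> (F ` (S \<inter> cball x (5 * r))) \<le> ennreal (\<eta> * r ^ DIM('a))}"
  have cov: "S \<subseteq> (\<Union>i\<in>K. cball (fst i) (snd i))"
  proof
    fix x assume x: "x \<in> S"
    obtain s where s: "s > 0" "cball x s \<subseteq> G" using G x by (meson open_contains_cball subsetD)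
    obtain r where r: "0 < r" "r < min s 1"
      "hausdorff_pre d k \<delta> (F ` (S \<inter> cball x (5 * r))) \<le> ennreal (\<eta> * r ^ DIM('a))"
      using S[OF x, of "min s 1"] s by auto
    then have "(x, r) \<in> K" using x s by (auto simp: K_def)
    then show "x \<in> (\<Union>i\<in>K. cball (fst i) (snd i))" using r by force
  qed
  have K1: "0 < snd i \<and> snd i \<le> 1" if "i \<in> K" for i
    using that by (auto simp: K_def)
  obtain C where C: "countable C" "C \<subseteq> K"
     "pairwise (\<lambda>i j. disjnt (cball (fst i) (snd i)) (cball (fst j) (snd j))) C"
     "S \<subseteq> (\<Union>i\<in>C. cball (fst i) (5 * snd i))"
    using Vitali_covering_lemma_cballs[OF cov K1] by blast
  have "F ` S \<subseteq> (\<Union>i\<in>C. F ` (S \<inter> cball (fst i) (5 * snd i)))" using C(4) by blast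
  then have "hausdorff_pre d k \<delta> (F ` S) \<le> hausdorff_pre d k \<delta> (\<Union>i\<in>C. F ` (S \<inter> cball (fst i) (5 * snd i)))"
    by (rule hausdorff_pre_mono)
  also have "\<dots> \<le> (\<integral>\<^sup>+i. hausdorff_pre d k \<delta> (F ` (S \<inter> cball (fst i) (5 * snd i))) \<partial>count_space C)"
    by (rule hausdorff_pre_UN_countable[OF \<delta> k C(1)])
  also have "\<dots> \<le> (\<integral>\<^sup>+i. ennreal (\<eta> / unit_ball_vol DIM('a)) * emeasure lebesgue (cball (fst i) (snd i)) \<partial>count_space C)"
  proof (intro nn_integral_mono)
    fix i assume "i \<in> space (count_space C)"
    then have i: "i \<in> K" using C(2) by auto
    have "hausdorff_pre d k \<delta> (F ` (S \<inter> cball (fst i) (5 * snd i))) \<le> ennreal (\<eta> * snd i ^ DIM('a))"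
      using i by (auto simp: K_def)
    also have "\<dots> = ennreal (\<eta> / unit_ball_vol DIM('a)) * emeasure lebesgue (cball (fst i) (snd i))"
    proof -
      have "unit_ball_vol (real DIM('a)) \<noteq> 0" by (metis less_irrefl of_nat_0_le_iff unit_ball_vol_pos)
      then show ?thesis using K1[OF i] \<eta> by (simp add: emeasure_cball ennreal_mult[symmetric])
    qed
    finally show "hausdorff_pre d k \<delta> (F ` (S \<inter> cball (fst i) (5 * snd i))) \<le> \<dots>" .
  qed
  also have "\<dots> = ennreal (\<eta> / unit_ball_vol DIM('a)) * (\<integral>\<^sup>+i. emeasure lebesgue (cball (fst i) (snd i)) \<partial>count_space C)"
    by (intro nn_integral_cmult) auto
  also have "(\<integral>\<^sup>+i. emeasure lebesgue (cball (fst i) (snd i)) \<partial>count_space C)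
      = emeasure lebesgue (\<Union>i\<in>C. cball (fst i) (snd i))"
    using C(1,3) by (intro emeasure_UN_countable[symmetric]) (auto simp: disjoint_family_on_def pairwise_def disjnt_def)
  also have "\<dots> \<le> emeasure lebesgue G"
    using C(2) G(1) unfolding K_def by (intro emeasure_mono UN_least) (force, simp)
  finally show ?thesis by (simp add: mult_left_mono)
qed

text \<open>Here the local constant \<open>\<eta>\<close> is arbitrarily small, so a large ball can
  serve as the open set \<open>G\<close>.\<close>

lemma hausdorff_image_null:
  fixes F :: "'a::euclidean_space \<Rightarrow> 'b"
  assumes k: "k \<ge> 1"
    and S: "\<And>x \<delta> \<eta> s. x \<in> S \<Longrightarrow> \<delta> > 0 \<Longrightarrow> \<eta> > 0 \<Longrightarrow> s > 0 \<Longrightarrow>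
      \<exists>r. 0 < r \<and> r < s \<and> hausdorff_pre d k \<delta> (F ` (S \<inter> cball x (5 * r))) \<le> ennreal (\<eta> * r ^ DIM('a))"
  shows "hausdorff d k (F ` S) = 0"
proof -
  have *: "hausdorff_pre d k \<delta> (F ` (S \<inter> ball 0 (real n))) = 0" if \<delta>: "\<delta> > 0" for \<delta> n
  proof -
    \<comment> \<open>The division below is by \<open>c + 1\<close>, because \<open>c\<close> is 0
      for the empty ball of radius 0.\<close>
    define c where "c = measure lebesgue (ball 0 (real n) :: 'a set) / unit_ball_vol DIM('a)"
    have c: "c \<ge> 0" by (simp add: c_def)
    have "hausdorff_pre d k \<delta> (F ` (S \<inter> ball 0 (real n))) \<le> 0"
    proof (rule ennreal_le_epsilon)
      fix e :: real assume e: "e > 0"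
      have "hausdorff_pre d k \<delta> (F ` (S \<inter> ball 0 (real n)))
          \<le> ennreal ((e / (c + 1)) / unit_ball_vol DIM('a)) * emeasure lebesgue (ball 0 (real n) :: 'a set)"
      proof (rule hausdorff_pre_image_le[OF \<delta> k])
        fix x s :: "_" assume x: "x \<in> S \<inter> ball 0 (real n)" and s: "(s::real) > 0"
        obtain r where r: "0 < r" "r < s"
          "hausdorff_pre d k \<delta> (F ` (S \<inter> cball x (5 * r))) \<le> ennreal ((e / (c + 1)) * r ^ DIM('a))"
          using S[of x \<delta> "e / (c + 1)" s] x s \<delta> e c by auto
        moreover have "hausdorff_pre d k \<delta> (F ` (S \<inter> ball 0 (real n) \<inter> cball x (5 * r))) \<le> hausdorff_pre d k \<delta> (F ` (S \<inter> cball x (5 * r)))"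
          by (intro hausdorff_pre_mono) auto
        ultimately show "\<exists>r. 0 < r \<and> r < s \<and> hausdorff_pre d k \<delta> (F ` (S \<inter> ball 0 (real n) \<inter> cball x (5 * r))) \<le> ennreal (e / (c + 1) * r ^ DIM('a))"
          using order_trans by blast
      qed (use e c in auto)
      also have "emeasure lebesgue (ball 0 (real n) :: 'a set) = ennreal (measure lebesgue (ball 0 (real n) :: 'a set))"
        by (intro emeasure_eq_ennreal_measure) (simp add: emeasure_ball)
      also have "ennreal ((e / (c + 1)) / unit_ball_vol DIM('a)) * \<dots> = ennreal (e / (c + 1) * c)"
        using e c by (simp add: ennreal_mult[symmetric] c_def)
      also have "\<dots> \<le> ennreal e" using e c by (intro ennreal_leI) (simp add: field_simps)
      finally show "hausdorff_pre d k \<delta> (F ` (S \<inter> ball 0 (real n))) \<le> 0 + ennreal e" by simp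
    qed
    then show ?thesis by simp
  qed
  have "hausdorff d k (F ` (S \<inter> ball 0 (real n))) = 0" for n
    using hausdorff_le[of d k "F ` (S \<inter> ball 0 (real n))" 0] * by simp
  then have "hausdorff d k (\<Union>n. F ` (S \<inter> ball 0 (real n))) = 0"
    using hausdorff_null_UN[OF k, of UNIV d "\<lambda>n. F ` (S \<inter> ball 0 (real n))"] by simp
  moreover have "F ` S \<subseteq> (\<Union>n. F ` (S \<inter> ball 0 (real n)))"
  proof clarify
    fix x assume "x \<in> S"
    obtain n :: nat where "norm x < n" using reals_Archimedean2 by blast
    then have "x \<in> S \<inter> ball 0 (real n)" using \<open>x \<in> S\<close> by simp
    then show "F x \<in> (\<Union>n. F ` (S \<inter> ball 0 (real n)))" by blast
  qed
  ultimately show ?thesis by (rule hausdorff_null_subset)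
qed

text \<open>The counterpart of the preceding lemma: the local constant \<open>B\<close> is fixed,
  and the smallness comes from an open set \<open>G\<close> of small measure around
  \<open>N\<close>.\<close>

lemma hausdorff_image_negligible:
  fixes F :: "'a::euclidean_space \<Rightarrow> 'b"
  assumes k: "k \<ge> 1" and N: "negligible N"
    and S: "\<And>x \<delta> s. x \<in> N \<Longrightarrow> \<delta> > 0 \<Longrightarrow> s > 0 \<Longrightarrow>
      \<exists>r. 0 < r \<and> r < s \<and> hausdorff_pre d k \<delta> (F ` (N \<inter> cball x (5 * r))) \<le> ennreal (B * r ^ DIM('a))"
  shows "hausdorff d k (F ` N) = 0"
proof -
  have "hausdorff_pre d k \<delta> (F ` N) \<le> 0" if \<delta>: "\<delta> > 0" for \<delta>
  proof (rule ennreal_le_epsilon)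
    fix e :: real assume e: "e > 0"
    define c where "c = max B 0 / unit_ball_vol DIM('a)"
    have c: "c \<ge> 0" by (simp add: c_def)
    have "emeasure lebesgue N = 0" "N \<in> sets lebesgue" using N by (auto simp: negligible_iff_null_sets)
    moreover have "e / (c + 1) > 0" using e c by simp
    ultimately obtain G where G: "open G" "N \<subseteq> G" "G - N \<in> lmeasurable" "emeasure lebesgue (G - N) < ennreal (e / (c + 1))"
      using sets_lebesgue_outer_open by metis
    have "emeasure lebesgue G \<le> emeasure lebesgue ((G - N) \<union> N)"
      using G \<open>N \<in> sets lebesgue\<close> by (intro emeasure_mono) auto
    also have "\<dots> \<le> emeasure lebesgue (G - N) + emeasure lebesgue N"
      using G \<open>N \<in> sets lebesgue\<close> by (intro emeasure_subadditive) auto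
    finally have Gm: "emeasure lebesgue G \<le> ennreal (e / (c + 1))" using G(4) \<open>emeasure lebesgue N = 0\<close> by simp
    have "hausdorff_pre d k \<delta> (F ` N) \<le> ennreal c * emeasure lebesgue G"
      unfolding c_def
    proof (rule hausdorff_pre_image_le[OF \<delta> k _ G(1,2)])
      fix x s :: "_" assume x: "x \<in> N" and s: "(s::real) > 0"
      then obtain r where r: "0 < r" "r < s" "hausdorff_pre d k \<delta> (F ` (N \<inter> cball x (5 * r))) \<le> ennreal (B * r ^ DIM('a))"
        using S[OF x \<delta> s] by blast
      moreover have "ennreal (B * r ^ DIM('a)) \<le> ennreal (max B 0 * r ^ DIM('a))"
        using r by (intro ennreal_leI mult_right_mono) auto
      ultimately show "\<exists>r. 0 < r \<and> r < s \<and> hausdorff_pre d k \<delta> (F ` (N \<inter> cball x (5 * r))) \<le> ennreal (max B 0 * r ^ DIM('a))"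
        using order_trans by blast
    qed simp
    also have "\<dots> \<le> ennreal c * ennreal (e / (c + 1))" using Gm by (intro mult_left_mono) auto
    also have "\<dots> \<le> ennreal e" using e c by (simp add: ennreal_mult[symmetric] field_simps)
    finally show "hausdorff_pre d k \<delta> (F ` N) \<le> 0 + ennreal e" by simp
  qed
  then show ?thesis using hausdorff_le[of d k "F ` N" 0] by simp
qed

section \<open>Parabolic and Euclidean Hausdorff measures\<close>

lemma pdist_le:
  assumes "norm (fst p - fst q) \<le> \<rho>" "\<bar>snd p - snd q\<bar> \<le> \<rho>\<^sup>2" "\<rho> \<ge> 0"
  shows "pdist p q \<le> 2 * \<rho>"
proof -
  have "norm (fst (p - q)) ^ 2 + \<bar>snd (p - q)\<bar> \<le> \<rho>\<^sup>2 + \<rho>\<^sup>2"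
    using assms by (intro add_mono power_mono) auto
  also have "\<dots> \<le> (2 * \<rho>)\<^sup>2" by (simp add: power_mult_distrib)
  finally show ?thesis unfolding pdist_def pnorm_def using assms(3) by (intro real_le_lsqrt) auto
qed

text \<open>Cutting a set of Euclidean size \<open>\<rho>\<close> into time slices of height \<open>\<rho>\<^sup>2\<close> makes all pieces
  of parabolic size comparable to \<open>\<rho>\<close>.\<close>

lemma hausdorff_pre_pdist_slices:
  fixes U :: "'n::finite pspace set"
  assumes U: "\<And>p q. p \<in> U \<Longrightarrow> q \<in> U \<Longrightarrow> norm (fst p - fst q) \<le> \<rho>"
      "\<And>p q. p \<in> U \<Longrightarrow> q \<in> U \<Longrightarrow> \<bar>snd p - snd q\<bar> \<le> \<tau>"
    and \<rho>: "0 < \<rho>" "2 * \<rho> < \<delta>" and \<tau>: "\<tau> \<ge> 0" and k: "k \<ge> 1"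
  shows "hausdorff_pre pdist k \<delta> U \<le> ennreal ((\<tau> / \<rho>\<^sup>2 + 1) * (2 * \<rho>) ^ k)"
proof (cases "U = {}")
  case True
  have "hausdorff_pre pdist k \<delta> U = 0" unfolding True using \<rho> k by (intro hausdorff_pre_empty) auto
  then show ?thesis by simp
next
  case False
  then obtain p0 where p0: "p0 \<in> U" by blast
  \<comment> \<open>Times are measured from the infimum, so that the slice indices are natural
    numbers.\<close>
  define t0 where "t0 = Inf (snd ` U)"
  have bdd: "bdd_below (snd ` U)"
  proof (rule bdd_belowI2)
    fix q assume "q \<in> U"
    then show "snd p0 - \<tau> \<le> snd q" using U(2)[OF p0, of q] by linarith
  qed
  have t0: "t0 \<le> snd p" "snd p - t0 \<le> \<tau>" if "p \<in> U" for p
  proof -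
    show "t0 \<le> snd p" unfolding t0_def using bdd that by (intro cInf_lower) auto
    have "snd p - \<tau> \<le> t0" unfolding t0_def
    proof (rule cINF_greatest[OF False])
      fix q assume "q \<in> U"
      then show "snd p - \<tau> \<le> snd q" using U(2)[OF that, of q] by linarith
    qed
    then show "snd p - t0 \<le> \<tau>" by simp
  qed
  define N where "N = nat \<lfloor>\<tau> / \<rho>\<^sup>2\<rfloor> + 1"
  define P where "P j = {p\<in>U. nat \<lfloor>(snd p - t0) / \<rho>\<^sup>2\<rfloor> = j}" for j
  have "U \<subseteq> (\<Union>j\<in>{..<N}. P j)"
  proof
    fix p assume p: "p \<in> U"
    have "\<lfloor>(snd p - t0) / \<rho>\<^sup>2\<rfloor> \<le> \<lfloor>\<tau> / \<rho>\<^sup>2\<rfloor>"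
      using t0[OF p] \<rho> by (intro floor_mono divide_right_mono) auto
    then have "nat \<lfloor>(snd p - t0) / \<rho>\<^sup>2\<rfloor> < N" unfolding N_def by linarith
    then show "p \<in> (\<Union>j\<in>{..<N}. P j)" using p by (auto simp: P_def)
  qed
  then have "hausdorff_pre pdist k \<delta> U \<le> hausdorff_pre pdist k \<delta> (\<Union>j\<in>{..<N}. P j)"
    by (rule hausdorff_pre_mono)
  also have "\<dots> \<le> (\<Sum>j<N. hausdorff_pre pdist k \<delta> (P j))"
    using \<rho> k by (intro hausdorff_pre_UN_finite) auto
  also have "\<dots> \<le> (\<Sum>j<N. ennreal ((2 * \<rho>) ^ k))"
  proof (intro sum_mono hausdorff_pre_le_power ediameter_le pdist_le)
    fix j p q assume "p \<in> P j" "q \<in> P j"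
    then have pq: "p \<in> U" "q \<in> U" "nat \<lfloor>(snd p - t0) / \<rho>\<^sup>2\<rfloor> = j" "nat \<lfloor>(snd q - t0) / \<rho>\<^sup>2\<rfloor> = j" by (auto simp: P_def)
    show "norm (fst p - fst q) \<le> \<rho>" using U pq by blast
    have "0 \<le> \<lfloor>(snd p - t0) / \<rho>\<^sup>2\<rfloor>" "0 \<le> \<lfloor>(snd q - t0) / \<rho>\<^sup>2\<rfloor>" using t0 pq by auto
    then have "\<lfloor>(snd p - t0) / \<rho>\<^sup>2\<rfloor> = \<lfloor>(snd q - t0) / \<rho>\<^sup>2\<rfloor>" using pq by linarith
    then have "\<bar>(snd p - t0) / \<rho>\<^sup>2 - (snd q - t0) / \<rho>\<^sup>2\<bar> \<le> 1" by linarith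
    then show "\<bar>snd p - snd q\<bar> \<le> \<rho>\<^sup>2"
      using \<rho> by (simp add: diff_divide_distrib[symmetric] abs_divide divide_le_eq)
  qed (use \<rho> k in auto)
  also have "\<dots> = ennreal (real N * (2 * \<rho>) ^ k)"
    using \<rho> by (simp add: ennreal_of_nat_eq_real_of_nat flip: ennreal_mult)
  also have "\<dots> \<le> ennreal ((\<tau> / \<rho>\<^sup>2 + 1) * (2 * \<rho>) ^ k)"
  proof (intro ennreal_leI mult_right_mono)
    have "0 \<le> \<tau> / \<rho>\<^sup>2" using \<tau> by simp
    then show "real N \<le> \<tau> / \<rho>\<^sup>2 + 1" unfolding N_def by linarith
  qed (use \<rho> in auto)
  finally show ?thesis .
qed

text \<open>About \<open>1 / \<rho>\<close> slices, each contributing a multiple of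
  \<open>\<rho> ^ (m + 1)\<close>: one power of \<open>\<rho>\<close> is lost.
  \<open>\<rho> \<le> 1\<close> absorbs the extra slice into \<open>2 / \<rho>\<close>.\<close>

lemma hausdorff_pre_pdist_Suc_le:
  fixes U :: "'n::finite pspace set"
  assumes U: "\<And>p q. p \<in> U \<Longrightarrow> q \<in> U \<Longrightarrow> dist p q \<le> \<rho>"
    and \<rho>: "0 < \<rho>" "2 * \<rho> < \<delta>" "\<rho> \<le> 1"
  shows "hausdorff_pre pdist (m + 1) \<delta> U \<le> ennreal (2 ^ (m + 2) * \<rho> ^ m)"
proof -
  have "hausdorff_pre pdist (m + 1) \<delta> U \<le> ennreal ((\<rho> / \<rho>\<^sup>2 + 1) * (2 * \<rho>) ^ (m + 1))"
  proof (rule hausdorff_pre_pdist_slices)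
    fix p q assume "p \<in> U" "q \<in> U"
    then have "norm (p - q) \<le> \<rho>" using U by (simp add: dist_norm)
    moreover have "(fst p - fst q, snd p - snd q) = p - q" by (simp add: prod_eq_iff)
    ultimately show "norm (fst p - fst q) \<le> \<rho>" "\<bar>snd p - snd q\<bar> \<le> \<rho>"
      using norm_fst_le[of "fst (p - q)" "snd (p - q)"] norm_snd_le[of "snd (p - q)" "fst (p - q)"] by auto
  qed (use \<rho> in auto)
  also have "\<dots> \<le> ennreal ((2 / \<rho>) * (2 * \<rho>) ^ (m + 1))"
    using \<rho> by (intro ennreal_leI mult_right_mono) (auto simp: power2_eq_square field_simps)
  also have "(2 / \<rho>) * (2 * \<rho>) ^ (m + 1) = 2 ^ (m + 2) * \<rho> ^ m"
    using \<rho> by (simp add: power_mult_distrib)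
  finally show ?thesis .
qed

text \<open>The slicing estimate is applied to every member of an efficient Euclidean cover and
  costs only a factor that depends on \<open>m\<close>.\<close>

lemma hausdorff_pdist_null:
  fixes A :: "'n::finite pspace set"
  assumes m: "m \<ge> 1" and null: "hausdorff dist m A = 0"
  shows "hausdorff pdist (m + 1) A = 0"
proof -
  have "hausdorff_pre pdist (m + 1) \<delta> A \<le> 0" if \<delta>: "\<delta> > 0" for \<delta>
  proof (rule ennreal_le_epsilon)
    fix e :: real assume e: "e > 0"
    \<comment> \<open>Half of \<open>\<delta>\<close> because the bound for the parabolic size of a
      slice is \<open>2 * \<rho>\<close>; 1 because the slice count is estimated for sizes up to
      1.\<close>
    define \<delta>' where "\<delta>' = min (\<delta> / 2) 1"
    have \<delta>': "\<delta>' > 0" using \<delta> by (simp add: \<delta>'_def)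
    have "hausdorff_pre dist m \<delta>' A \<le> 0" using hausdorff_pre_le_hausdorff[OF \<delta>', of dist m A] null by simp
    then have "hausdorff_pre dist m \<delta>' A < ennreal (e / 2 ^ (m + 2))" using e by (simp add: le_less_trans)
    then obtain U where U: "A \<subseteq> (\<Union>i::nat. U i)" "\<And>i. ediameter dist (U i) < ennreal \<delta>'"
      "(\<Sum>i. ediameter dist (U i) ^ m) < ennreal (e / 2 ^ (m + 2))"
      unfolding hausdorff_pre_def INF_less_iff by auto
    have *: "hausdorff_pre pdist (m + 1) \<delta> (U i) \<le> ennreal (2 ^ (m + 2)) * ediameter dist (U i) ^ m" for i
    proof -
      obtain \<rho> where \<rho>: "ediameter dist (U i) = ennreal \<rho>" "\<rho> \<ge> 0" "\<rho> < \<delta>'"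
        using U(2)[of i] \<delta>' by (cases "ediameter dist (U i)") (auto simp: ennreal_less_iff)
      have d: "dist p q \<le> \<rho>" if "p \<in> U i" "q \<in> U i" for p q
        using le_ediameter[OF that, of dist] \<rho> by simp
      show ?thesis
      \<comment> \<open>Slices of height \<open>\<rho>\<^sup>2\<close> need a positive
        \<open>\<rho>\<close>; a set of diameter 0 has at most one point.\<close>
      proof (cases "\<rho> = 0")
        case True
        have "hausdorff_pre pdist (m + 1) \<delta> (U i) \<le> ennreal (0 ^ (m + 1))"
        proof (intro hausdorff_pre_le_power ediameter_le)
          fix p q assume "p \<in> U i" "q \<in> U i"
          then have "p = q" using d True by fastforce
          then show "pdist p q \<le> 0" by (simp add: pdist_def pnorm_def)
        qed (use \<delta> in auto)
        then show ?thesis by simp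
      next
        case False
        then have "hausdorff_pre pdist (m + 1) \<delta> (U i) \<le> ennreal (2 ^ (m + 2) * \<rho> ^ m)"
          using \<rho> d by (intro hausdorff_pre_pdist_Suc_le) (auto simp: \<delta>'_def)
        then show ?thesis using \<rho> by (simp add: ennreal_mult ennreal_power)
      qed
    qed
    have "hausdorff_pre pdist (m + 1) \<delta> A \<le> hausdorff_pre pdist (m + 1) \<delta> (\<Union>i. U i)"
      by (rule hausdorff_pre_mono[OF U(1)])
    also have "\<dots> \<le> (\<Sum>i. hausdorff_pre pdist (m + 1) \<delta> (U i))" by (rule hausdorff_pre_UN_nat)
    also have "\<dots> \<le> (\<Sum>i. ennreal (2 ^ (m + 2)) * ediameter dist (U i) ^ m)"
      using * by (intro suminf_le) auto
    also have "\<dots> = ennreal (2 ^ (m + 2)) * (\<Sum>i. ediameter dist (U i) ^ m)" by (rule ennreal_suminf_cmult)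
    also have "\<dots> \<le> ennreal (2 ^ (m + 2)) * ennreal (e / 2 ^ (m + 2))"
      using U(3) by (intro mult_left_mono) auto
    also have "\<dots> = ennreal e" using e by (simp add: ennreal_mult[symmetric])
    finally show "hausdorff_pre pdist (m + 1) \<delta> A \<le> 0 + ennreal e" by simp
  qed
  then show ?thesis using hausdorff_le[of pdist "m + 1" A 0] by simp
qed

text \<open>If \<open>k $ i\<close> is nonzero, the other coordinates determine coordinate
  \<open>i\<close> up to a multiple of R/M within the slab. It is enough to cut these m - 1
  coordinates into cells of side R/M, which saves a factor of order M against a ball.
  \<open>C\<close> is chosen before \<open>M\<close> and \<open>R\<close>.\<close>

lemma slab_cover:
  fixes k :: "real ^ 'm::finite"
  assumes "k \<noteq> 0"
  obtains C where "C > 0"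
    "\<And>M R. M \<ge> 1 \<Longrightarrow> R > 0 \<Longrightarrow> \<exists>\<U>. finite \<U> \<and> card \<U> \<le> (2 * M + 1) ^ (CARD('m) - 1) \<and>
       {v. norm v \<le> R \<and> \<bar>k \<bullet> v\<bar> \<le> R / real M} \<subseteq> \<Union>\<U> \<and>
       (\<forall>U\<in>\<U>. \<forall>v\<in>U. \<forall>w\<in>U. norm (v - w) \<le> C * (R / real M))"
proof -
  obtain i where i: "k $ i \<noteq> 0" using assms by (metis vec_eq_iff zero_index)
  \<comment> \<open>The first summand accounts for the coordinates other than \<open>i\<close>; the
    second bounds coordinate \<open>i\<close> by solving the formula for
    \<open>k \<bullet> u\<close> for it, with \<open>\<bar>k \<bullet> u\<bar>\<close> at most twice
    the width of the slab.\<close>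
  define C where "C = real CARD('m) + (2 + (\<Sum>j\<in>UNIV. \<bar>k $ j\<bar>)) / \<bar>k $ i\<bar>"
  have "C > 0" unfolding C_def by (intro add_pos_nonneg divide_nonneg_nonneg add_nonneg_nonneg sum_nonneg) auto
  moreover have "\<exists>\<U>. finite \<U> \<and> card \<U> \<le> (2 * M + 1) ^ (CARD('m) - 1) \<and>
       {v. norm v \<le> R \<and> \<bar>k \<bullet> v\<bar> \<le> R / real M} \<subseteq> \<Union>\<U> \<and>
       (\<forall>U\<in>\<U>. \<forall>v\<in>U. \<forall>w\<in>U. norm (v - w) \<le> C * (R / real M))" if M: "M \<ge> 1" and R: "R > 0" for M R
  proof -
    define h where "h = R / real M"
    have h: "h > 0" "R / h = real M" using M R by (auto simp: h_def)
    \<comment> \<open>After rescaling the coordinates lie between -M and M, so their floors take at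
      most 2M + 1 values; coordinate \<open>i\<close> carries no index.\<close>
    define J where "J = PiE (UNIV - {i}) (\<lambda>_. {- int M..int M})"
    have finJ: "finite J" unfolding J_def by (intro finite_PiE) auto
    have cardJ: "card J = (2 * M + 1) ^ (CARD('m) - 1)"
    proof -
      have "card {- int M..int M} = 2 * M + 1" unfolding card_atLeastAtMost_int by linarith
      then show ?thesis unfolding J_def by (subst card_PiE) (auto simp: card_Diff_singleton)
    qed
    define P where "P z = {v. norm v \<le> R \<and> \<bar>k \<bullet> v\<bar> \<le> h \<and> (\<forall>j\<in>UNIV - {i}. \<lfloor>v $ j / h\<rfloor> = z j)}" for z
    have "{v. norm v \<le> R \<and> \<bar>k \<bullet> v\<bar> \<le> h} \<subseteq> \<Union>(P ` J)"
    proof clarify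
      fix v :: "real ^ 'm" assume v: "norm v \<le> R" "\<bar>k \<bullet> v\<bar> \<le> h"
      define z where "z = restrict (\<lambda>j. \<lfloor>v $ j / h\<rfloor>) (UNIV - {i})"
      have "\<lfloor>v $ j / h\<rfloor> \<in> {- int M..int M}" for j
      proof -
        have "\<bar>v $ j\<bar> \<le> R" using component_le_norm_cart[of v j] v by simp
        then have "\<bar>v $ j / h\<bar> \<le> real M" unfolding h(2)[symmetric] using h(1) by (simp add: abs_divide divide_right_mono)
        then have "v $ j / h \<le> real M" "- real M \<le> v $ j / h" by linarith+
        then show ?thesis by (auto simp: le_floor_iff floor_le_iff)
      qed
      then have "z \<in> J" unfolding z_def J_def by auto
      moreover have "v \<in> P z" using v by (auto simp: P_def z_def)
      ultimately show "v \<in> \<Union>(P ` J)" by blast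
    qed
    moreover have "norm (v - w) \<le> C * h" if vw: "v \<in> P z" "w \<in> P z" for v w z
    proof -
      define u where "u = v - w"
      have uj: "\<bar>u $ j\<bar> \<le> h" if "j \<noteq> i" for j
      proof -
        have "\<lfloor>v $ j / h\<rfloor> = \<lfloor>w $ j / h\<rfloor>" using vw that by (auto simp: P_def)
        then have "\<bar>v $ j / h - w $ j / h\<bar> \<le> 1" by linarith
        then show ?thesis using h(1) by (simp add: u_def diff_divide_distrib[symmetric] abs_divide divide_le_eq)
      qed
      have "k \<bullet> u = (\<Sum>j\<in>UNIV. k $ j * u $ j)" by (simp add: inner_vec_def)
      also have "\<dots> = k $ i * u $ i + (\<Sum>j\<in>UNIV - {i}. k $ j * u $ j)"
        by (simp add: sum.remove[of UNIV i])
      finally have "\<bar>k $ i * u $ i\<bar> \<le> \<bar>k \<bullet> u\<bar> + \<bar>\<Sum>j\<in>UNIV - {i}. k $ j * u $ j\<bar>" by linarith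
      also have "\<bar>k \<bullet> u\<bar> \<le> 2 * h" using vw by (auto simp: P_def u_def inner_diff_right)
      also have "\<bar>\<Sum>j\<in>UNIV - {i}. k $ j * u $ j\<bar> \<le> (\<Sum>j\<in>UNIV - {i}. \<bar>k $ j\<bar> * h)"
        by (rule order_trans[OF sum_abs]) (auto intro!: sum_mono mult_left_mono uj simp: abs_mult)
      also have "\<dots> \<le> (\<Sum>j\<in>UNIV. \<bar>k $ j\<bar> * h)" using h by (intro sum_mono2) auto
      also have "\<dots> = (\<Sum>j\<in>UNIV. \<bar>k $ j\<bar>) * h" by (simp add: sum_distrib_right)
      finally have "\<bar>k $ i\<bar> * \<bar>u $ i\<bar> \<le> (2 + (\<Sum>j\<in>UNIV. \<bar>k $ j\<bar>)) * h" by (simp add: abs_mult algebra_simps)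
      then have ui: "\<bar>u $ i\<bar> \<le> (2 + (\<Sum>j\<in>UNIV. \<bar>k $ j\<bar>)) / \<bar>k $ i\<bar> * h" using i by (simp add: field_simps)
      have "norm u \<le> (\<Sum>j\<in>UNIV. \<bar>u $ j\<bar>)" by (rule norm_le_l1_cart)
      also have "\<dots> = \<bar>u $ i\<bar> + (\<Sum>j\<in>UNIV - {i}. \<bar>u $ j\<bar>)" by (simp add: sum.remove[of UNIV i])
      also have "(\<Sum>j\<in>UNIV - {i}. \<bar>u $ j\<bar>) \<le> (\<Sum>j\<in>UNIV - {i}. h)" by (intro sum_mono uj) auto
      also have "\<dots> \<le> real CARD('m) * h" using h by (simp add: card_Diff_singleton)
      finally show ?thesis using ui by (simp add: u_def C_def algebra_simps)
    qed
    ultimately show ?thesis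
      using finJ cardJ card_image_le[OF finJ, of P] unfolding h_def by (intro exI[of _ "P ` J"]) auto
  qed
  ultimately show thesis using that by blast
qed

section \<open>Degenerate derivatives of Lipschitz maps\<close>

lemma Lipschitz_extension_real:
  fixes f :: "'a::metric_space \<Rightarrow> real"
  assumes lip: "C-lipschitz_on A f"
  obtains g where "C-lipschitz_on UNIV g" "\<And>x. x \<in> A \<Longrightarrow> g x = f x"
proof (cases "A = {}")
  case True
  show thesis
    by (rule that[of "\<lambda>_. 0"]) (use True lipschitz_on_nonneg[OF lip] in \<open>auto simp: lipschitz_on_def\<close>)
next
  case False
  then obtain a0 where a0: "a0 \<in> A" by blast
  have C: "C \<ge> 0" by (rule lipschitz_on_nonneg[OF lip])
  have fl: "f x \<le> f y + C * dist x y" if "x \<in> A" "y \<in> A" for x y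
    using lipschitz_onD[OF lip that] by (simp add: dist_real_def abs_le_iff)
  \<comment> \<open>The lower envelope of the cones of slope \<open>C\<close> with tips on the graph
    of \<open>f\<close>; it requires \<open>A\<close> to be nonempty.\<close>
  define g where "g x = (INF a\<in>A. f a + C * dist x a)" for x
  have lb: "f a0 - C * dist x a0 \<le> f a + C * dist x a" if "a \<in> A" for x a
  proof -
    have "f a0 \<le> f a + C * dist a0 a" using fl a0 that by blast
    also have "C * dist a0 a \<le> C * (dist x a0 + dist x a)"
      using C by (intro mult_left_mono) (metis dist_commute dist_triangle2)
    finally show ?thesis by (simp add: algebra_simps)
  qed
  then have bdd: "bdd_below ((\<lambda>a. f a + C * dist x a) ` A)" for x
    by (intro bdd_belowI2)
  have gle: "g x \<le> f a + C * dist x a" if "a \<in> A" for x a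
    unfolding g_def using bdd that by (rule cINF_lower)
  have "g x = f x" if "x \<in> A" for x
  proof (rule antisym)
    show "g x \<le> f x" using gle[OF that, of x] by simp
    show "f x \<le> g x" unfolding g_def using False fl[OF that] by (intro cINF_greatest)
  qed
  moreover have gl: "g x \<le> g y + C * dist x y" for x y
  proof -
    have "g x - C * dist x y \<le> f a + C * dist y a" if "a \<in> A" for a
    proof -
      have "g x \<le> f a + C * dist x a" using gle that .
      also have "C * dist x a \<le> C * (dist x y + dist y a)" using C by (intro mult_left_mono dist_triangle)
      finally show ?thesis by (simp add: algebra_simps)
    qed
    then have "g x - C * dist x y \<le> g y" unfolding g_def[of y] using False by (intro cINF_greatest)
    then show ?thesis by simp
  qed
  have "C-lipschitz_on UNIV g"
    unfolding lipschitz_on_def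
  proof (intro conjI ballI C)
    fix x y show "dist (g x) (g y) \<le> C * dist x y"
      using gl[of x y] gl[of y x] by (simp add: dist_real_def dist_commute abs_le_iff)
  qed
  ultimately show thesis using that by blast
qed

lemma Lipschitz_extension:
  fixes f :: "'a::metric_space \<Rightarrow> 'b::euclidean_space"
  assumes lip: "C-lipschitz_on A f"
  obtains B g where "B-lipschitz_on UNIV g" "\<And>x. x \<in> A \<Longrightarrow> g x = f x"
proof -
  have C: "C \<ge> 0" by (rule lipschitz_on_nonneg[OF lip])
  have "\<exists>g. C-lipschitz_on UNIV g \<and> (\<forall>x\<in>A. g x = f x \<bullet> b)" if "b \<in> Basis" for b
  proof -
    have "C-lipschitz_on A (\<lambda>x. f x \<bullet> b)"
      unfolding lipschitz_on_def
    proof (intro conjI ballI C)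
      fix x y assume "x \<in> A" "y \<in> A"
      then show "dist (f x \<bullet> b) (f y \<bullet> b) \<le> C * dist x y"
        using lipschitz_onD[OF lip, of x y] Basis_le_norm[OF that, of "f x - f y"]
        by (simp add: dist_real_def dist_norm inner_diff_left)
    qed
    then obtain g where "C-lipschitz_on UNIV g" "\<And>x. x \<in> A \<Longrightarrow> g x = f x \<bullet> b"
      by (rule Lipschitz_extension_real) blast
    then show ?thesis by blast
  qed
  then obtain g where g: "\<And>b. b \<in> Basis \<Longrightarrow> C-lipschitz_on UNIV (g b)" "\<And>b x. b \<in> Basis \<Longrightarrow> x \<in> A \<Longrightarrow> g b x = f x \<bullet> b"
    by metis
  define h where "h x = (\<Sum>b\<in>Basis. g b x *\<^sub>R b)" for x
  have "h x = f x" if "x \<in> A" for x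
    using that g(2) by (simp add: h_def euclidean_representation)
  moreover have "(real DIM('b) * C)-lipschitz_on UNIV h"
    unfolding lipschitz_on_def
  proof (intro conjI ballI)
    fix x y
    have "dist (h x) (h y) \<le> (\<Sum>b\<in>Basis. \<bar>(h x - h y) \<bullet> b\<bar>)" unfolding dist_norm by (rule norm_le_l1)
    also have "\<dots> \<le> (\<Sum>b\<in>(Basis::'b set). C * dist x y)"
    proof (intro sum_mono)
      fix b :: 'b assume b: "b \<in> Basis"
      then have "(h x - h y) \<bullet> b = g b x - g b y" by (simp add: h_def inner_diff_left)
      then show "\<bar>(h x - h y) \<bullet> b\<bar> \<le> C * dist x y"
        using lipschitz_onD[OF g(1)[OF b], of x y] by (simp add: dist_real_def)
    qed
    finally show "dist (h x) (h y) \<le> real DIM('b) * C * dist x y" by simp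
  qed (use C in auto)
  ultimately show thesis using that by blast
qed

text \<open>The number of cells grows like M^(m-1) while each contributes (R/M)^m, so a factor 1/M
  remains against R^m.\<close>

lemma slab_count_bound:
  fixes M m :: nat and c R :: real
  assumes "M \<ge> 1" "m \<ge> 1" "c \<ge> 0" "R \<ge> 0"
  shows "real ((2 * M + 1) ^ (m - 1)) * (c * (R / real M)) ^ m \<le> (3 * c) ^ m * R ^ m / real M"
proof -
  obtain l where m: "m = Suc l" using assms(2) by (cases m) auto
  have "(2 * real M + 1) ^ l \<le> (3 * real M) ^ l" using assms by (intro power_mono) auto
  also have "\<dots> = 3 ^ l * real M ^ l" by (simp add: power_mult_distrib)
  also have "\<dots> \<le> 3 ^ m * real M ^ l" by (intro mult_right_mono power_increasing) (auto simp: m)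
  finally have "real ((2 * M + 1) ^ (m - 1)) * (c * (R / real M)) ^ m \<le> (3 ^ m * real M ^ l) * (c * (R / real M)) ^ m"
    using assms by (intro mult_right_mono) (simp_all add: m add.commute)
  also have "\<dots> = (3 * c) ^ m * R ^ m * (real M ^ l / real M ^ m)"
    by (simp add: power_mult_distrib power_divide)
  also have "real M ^ l / real M ^ m = 1 / real M" using assms by (simp add: m)
  finally show ?thesis by simp
qed

lemma has_derivative_atD:
  assumes "(F has_derivative T) (at x)" "e > 0"
  obtains d where "d > 0" "\<And>y. norm (y - x) < d \<Longrightarrow> norm (F y - F x - T (y - x)) \<le> e * norm (y - x)"
  using assms unfolding has_derivative_at_alt by blast

text \<open>A Lipschitz constant may be enlarged, so \<open>L \<ge> 1\<close> is a normalisation; it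
  allows division by \<open>L\<close> in the choice of radii.\<close>

context
  fixes F :: "real ^ 'm::finite \<Rightarrow> 'n::finite pspace" and L :: real
  assumes lip: "L-lipschitz_on UNIV F" and L: "L \<ge> 1"
begin

lemma dist_F_cball:
  assumes "y \<in> cball x R" "z \<in> cball x R"
  shows "dist (F y) (F z) \<le> 2 * L * R"
proof -
  have "dist (F y) (F z) \<le> L * dist y z" using lip by (auto simp: lipschitz_on_def)
  also have "dist y z \<le> 2 * R" using assms dist_triangle3[of y z x] by simp
  finally show ?thesis using L by simp
qed

text \<open>A ball of radius \<open>5 * r\<close> has an image of Euclidean diameter at most
  \<open>10 * L * r\<close>, so slicing gives a fixed multiple of r^m and the estimate for
  negligible parameter sets applies.\<close>

lemma negligible_image_null:
  assumes "negligible N"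
  shows "hausdorff pdist (CARD('m) + 1) (F ` N) = 0"
proof (rule hausdorff_image_negligible[where B = "2 ^ (CARD('m) + 2) * (10 * L) ^ CARD('m)"])
  fix x :: "real ^ 'm" and \<delta> s :: real assume \<delta>: "\<delta> > 0" and s: "s > 0"
  define r where "r = min (s / 2) (min (\<delta> / (40 * L)) (1 / (10 * L)))"
  have r: "r > 0" "r < s" "10 * L * r \<le> 1" "2 * (10 * L * r) < \<delta>"
  proof -
    have 1: "r \<le> 1 / (10 * L)" "r \<le> \<delta> / (40 * L)" by (auto simp: r_def)
    show "r > 0" "r < s" using \<delta> s L by (auto simp: r_def)
    show "10 * L * r \<le> 1" using 1(1) L by (simp add: field_simps)
    have "40 * L * r \<le> \<delta>" using 1(2) L by (simp add: field_simps)
    moreover have "L * r > 0" using L \<open>r > 0\<close> by simp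
    ultimately show "2 * (10 * L * r) < \<delta>" by linarith
  qed
  have "hausdorff_pre pdist (CARD('m) + 1) \<delta> (F ` (N \<inter> cball x (5 * r))) \<le> ennreal (2 ^ (CARD('m) + 2) * (10 * L * r) ^ CARD('m))"
  proof (rule hausdorff_pre_pdist_Suc_le)
    fix p q assume "p \<in> F ` (N \<inter> cball x (5 * r))" "q \<in> F ` (N \<inter> cball x (5 * r))"
    then obtain y z where "p = F y" "q = F z" "y \<in> cball x (5 * r)" "z \<in> cball x (5 * r)" by blast
    then show "dist p q \<le> 10 * L * r" using dist_F_cball[of y x "5 * r" z] by simp
  qed (use r L in auto)
  then show "\<exists>r>0. r < s \<and> hausdorff_pre pdist (CARD('m) + 1) \<delta> (F ` (N \<inter> cball x (5 * r)))
          \<le> ennreal (2 ^ (CARD('m) + 2) * (10 * L) ^ CARD('m) * r ^ DIM(real ^ 'm))"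
    using r by (intro exI[of _ r]) (simp add: power_mult_distrib mult_ac)
qed (use assms in auto)

text \<open>Over a ball of radius R the times vary by only 2 e R. About e/R slices of parabolic size
  R therefore suffice in place of 1/R, and e is arbitrary.\<close>

lemma horizontal_derivative_image_null:
  "hausdorff pdist (CARD('m) + 1) (F ` {x. \<exists>T. (F has_derivative T) (at x) \<and> (\<forall>v. snd (T v) = 0)}) = 0"
    (is "hausdorff _ _ (F ` ?S) = 0")
proof (rule hausdorff_image_null)
  let ?m = "CARD('m)"
  fix x :: "real ^ 'm" and \<delta> \<eta> s :: real
  assume x: "x \<in> ?S" and \<delta>: "\<delta> > 0" and \<eta>: "\<eta> > 0" and s: "s > 0"
  obtain T where T: "(F has_derivative T) (at x)" "\<And>v. snd (T v) = 0" using x by blast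
  \<comment> \<open>\<open>4 * L * R\<close> bounds the parabolic size of a slice; the power of 5 is
    the price of stating the estimate for the radius \<open>R / 5\<close>.\<close>
  define c where "c = (4 * L) ^ (?m + 1) * 5 ^ ?m"
  have c: "c > 0" using L by (simp add: c_def)
  define e where "e = \<eta> / (2 * c)"
  have e: "e > 0" using \<eta> c by (simp add: e_def)
  obtain d where d: "d > 0" "\<And>y. norm (y - x) < d \<Longrightarrow> norm (F y - F x - T (y - x)) \<le> e * norm (y - x)"
    using has_derivative_atD[OF T(1) e] by blast
  \<comment> \<open>\<open>R \<le> e\<close> makes the one extra slice no more expensive than the
    \<open>e / R\<close> others.\<close>
  define R where "R = min (min s (d / 2)) (min e (\<delta> / (8 * L)))"
  have R: "R > 0" "R \<le> s" "R < d" "R \<le> e" "2 * (2 * L * R) < \<delta>"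
  proof -
    show "R > 0" "R \<le> s" "R < d" "R \<le> e" using s d e \<delta> L by (auto simp: R_def)
    have "R \<le> \<delta> / (8 * L)" by (simp add: R_def)
    then have "8 * L * R \<le> \<delta>" using L by (simp add: field_simps)
    moreover have "L * R > 0" using L \<open>R > 0\<close> by simp
    ultimately show "2 * (2 * L * R) < \<delta>" by linarith
  qed
  have "hausdorff_pre pdist (?m + 1) \<delta> (F ` (?S \<inter> cball x R)) \<le> ennreal ((2 * e * R / (2 * L * R)\<^sup>2 + 1) * (2 * (2 * L * R)) ^ (?m + 1))"
  proof (rule hausdorff_pre_pdist_slices)
    have st: "\<bar>snd (F y) - snd (F x)\<bar> \<le> e * R" if "y \<in> cball x R" for y
    proof -
      have y: "norm (y - x) \<le> R" using that by (simp add: dist_norm norm_minus_commute)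
      have "\<bar>snd (F y) - snd (F x)\<bar> = norm (snd (F y - F x - T (y - x)))" using T(2) by simp
      also have "\<dots> \<le> norm (F y - F x - T (y - x))" by (metis norm_snd_le prod.collapse)
      also have "\<dots> \<le> e * norm (y - x)" using y R d by auto
      also have "\<dots> \<le> e * R" using y e by (intro mult_left_mono) auto
      finally show ?thesis .
    qed
    fix p q assume "p \<in> F ` (?S \<inter> cball x R)" "q \<in> F ` (?S \<inter> cball x R)"
    then obtain y z where yz: "p = F y" "q = F z" "y \<in> cball x R" "z \<in> cball x R" by blast
    show "norm (fst p - fst q) \<le> 2 * L * R"
      using dist_F_cball[OF yz(3,4)] dist_fst_le[of p q] yz by (simp add: dist_norm)
    show "\<bar>snd p - snd q\<bar> \<le> 2 * e * R"
      using st[OF yz(3)] st[OF yz(4)] unfolding yz(1,2) by linarith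
  qed (use R L e in auto)
  also have "\<dots> \<le> ennreal (\<eta> * (R / 5) ^ ?m)"
  proof (intro ennreal_leI)
    have "2 * e * R / (2 * L * R)\<^sup>2 + 1 \<le> e / R + 1"
    proof -
      have "2 * e * R / (2 * L * R)\<^sup>2 = (e / R) * (1 / (2 * L\<^sup>2))" using R L by (simp add: power2_eq_square field_simps)
      also have "\<dots> \<le> (e / R) * 1"
      proof (intro mult_left_mono)
        have "1 \<le> L\<^sup>2" using L by (rule one_le_power)
        then show "1 / (2 * L\<^sup>2) \<le> 1" using divide_le_eq_1_pos[of "2 * L\<^sup>2" 1] by linarith
      qed (use e R in auto)
      finally show ?thesis by simp
    qed
    then have "(2 * e * R / (2 * L * R)\<^sup>2 + 1) * (2 * (2 * L * R)) ^ (?m + 1) \<le> (e / R + 1) * (2 * (2 * L * R)) ^ (?m + 1)"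
      using R L by (intro mult_right_mono) auto
    also have "\<dots> = (e + R) * ((4 * L) ^ (?m + 1) * R ^ ?m)"
    proof -
      have "2 * (2 * L * R) = (4 * L) * R" by simp
      then have "(2 * (2 * L * R)) ^ (?m + 1) = (4 * L) ^ (?m + 1) * (R ^ ?m * R)"
        by (simp add: power_mult_distrib mult_ac)
      then have "(e / R + 1) * (2 * (2 * L * R)) ^ (?m + 1) = ((e / R + 1) * R) * ((4 * L) ^ (?m + 1) * R ^ ?m)"
        by (simp only: mult_ac)
      also have "(e / R + 1) * R = e + R" using R by (simp add: distrib_right)
      finally show ?thesis .
    qed
    also have "\<dots> \<le> (2 * e) * ((4 * L) ^ (?m + 1) * R ^ ?m)"
      using R L by (intro mult_right_mono) auto
    also have "\<dots> = (2 * e * c) * (R / 5) ^ ?m"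
      by (simp add: c_def power_divide)
    also have "2 * e * c = \<eta>" using c by (simp add: e_def)
    finally show "(2 * e * R / (2 * L * R)\<^sup>2 + 1) * (2 * (2 * L * R)) ^ (?m + 1) \<le> \<eta> * (R / 5) ^ ?m" .
  qed
  finally have "hausdorff_pre pdist (?m + 1) \<delta> (F ` (?S \<inter> cball x (5 * (R / 5)))) \<le> ennreal (\<eta> * (R / 5) ^ DIM(real ^ 'm))"
    by simp
  then show "\<exists>r>0. r < s \<and> hausdorff_pre pdist (?m + 1) \<delta> (F ` (?S \<inter> cball x (5 * r))) \<le> ennreal (\<eta> * r ^ DIM(real ^ 'm))"
    using R by (intro exI[of _ "R / 5"]) auto
qed simp

text \<open>The image of a ball under \<open>T\<close> is the image of its section orthogonal to the kernel vector
  \<open>k\<close>, so only about \<open>M^(m-1)\<close> pieces of relative size \<open>1 / M\<close> are needed to cover it.\<close>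

lemma singular_derivative_image_null:
  "hausdorff pdist (CARD('m) + 1) (F ` {x. \<exists>T k. (F has_derivative T) (at x) \<and> k \<noteq> 0 \<and> T k = 0}) = 0"
    (is "hausdorff _ _ (F ` ?S) = 0")
proof (rule hausdorff_image_null)
  let ?m = "CARD('m)"
  fix x :: "real ^ 'm" and \<delta> \<eta> s :: real
  assume x: "x \<in> ?S" and \<delta>: "\<delta> > 0" and \<eta>: "\<eta> > 0" and s: "s > 0"
  obtain T k where T: "(F has_derivative T) (at x)" and k: "k \<noteq> 0" "T k = 0" using x by blast
  have lin: "linear T" using T has_derivative_linear by blast
  obtain B where B: "B > 0" "\<And>v. norm (T v) \<le> B * norm v" using linear_bounded_pos[OF lin] by blast
  obtain C where C: "C > 0"
    "\<And>M R. M \<ge> 1 \<Longrightarrow> R > 0 \<Longrightarrow> \<exists>\<U>. finite \<U> \<and> card \<U> \<le> (2 * M + 1) ^ (?m - 1) \<and>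
       {v. norm v \<le> R \<and> \<bar>k \<bullet> v\<bar> \<le> R / real M} \<subseteq> \<Union>\<U> \<and>
       (\<forall>U\<in>\<U>. \<forall>v\<in>U. \<forall>w\<in>U. norm (v - w) \<le> C * (R / real M))"
    using slab_cover[OF k(1)] by blast
  \<comment> \<open>\<open>B * C\<close> comes from the linear part on a cell, 2 from the
    linearisation errors at the two points compared.\<close>
  define D where "D = B * C + 2"
  have D: "D > 0" using B C by (simp add: D_def add_pos_pos)
  define c where "c = 2 ^ (?m + 2) * (3 * D) ^ ?m * 5 ^ ?m"
  have c: "c > 0" using D by (simp add: c_def)
  obtain M0 :: nat where M0: "c / \<eta> < M0" using reals_Archimedean2 by blast
  define M where "M = M0 + 1"
  have M: "M \<ge> 1" "c / real M \<le> \<eta>" using M0 \<eta> by (auto simp: M_def field_simps)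
  obtain d where d: "d > 0" "\<And>y. norm (y - x) < d \<Longrightarrow> norm (F y - F x - T (y - x)) \<le> (1 / M) * norm (y - x)"
    using has_derivative_atD[OF T, of "1 / M"] M by auto
  define R where "R = min (min s (d / 2)) (min (1 / D) (\<delta> / (4 * D)))"
  have R: "R > 0" "R \<le> s" "R < d" "D * R \<le> 1" "2 * (D * R) < \<delta>"
  proof -
    have 1: "R \<le> 1 / D" "R \<le> \<delta> / (4 * D)" by (simp_all add: R_def)
    show "R > 0" "R \<le> s" "R < d" using s d \<delta> D by (auto simp: R_def)
    show "D * R \<le> 1" using 1 D by (simp add: field_simps)
    have "4 * (D * R) \<le> \<delta>" using 1 D by (simp add: field_simps)
    moreover have "D * R > 0" using D \<open>R > 0\<close> by simp
    ultimately show "2 * (D * R) < \<delta>" by linarith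
  qed
  have RM: "D * (R / M) > 0" "D * (R / M) \<le> D * R"
  proof -
    show "D * (R / M) > 0" using R D M by simp
    have "R / M \<le> R / 1" using M R by (intro divide_left_mono) auto
    then show "D * (R / M) \<le> D * R" using D by (intro mult_left_mono) auto
  qed
  obtain \<U> where U: "finite \<U>" "card \<U> \<le> (2 * M + 1) ^ (?m - 1)"
       "{v. norm v \<le> R \<and> \<bar>k \<bullet> v\<bar> \<le> R / real M} \<subseteq> \<Union>\<U>"
       "\<forall>U\<in>\<U>. \<forall>v\<in>U. \<forall>w\<in>U. norm (v - w) \<le> C * (R / real M)"
    using C(2)[OF M(1) R(1)] by blast
  \<comment> \<open>Projection along the kernel vector changes no value of \<open>T\<close> and
    increases no norm. The points \<open>y\<close> are sorted by the cell of
    \<open>\<pi> (y - x)\<close>, although \<open>y - x\<close> itself need not lie in the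
    slab.\<close>
  define \<pi> where "\<pi> v = v - ((k \<bullet> v) / (k \<bullet> k)) *\<^sub>R k" for v
  have T\<pi>: "T (\<pi> v) = T v" for v using lin k by (simp add: \<pi>_def linear_diff linear_cmul)
  have k\<pi>: "k \<bullet> \<pi> v = 0" for v using k by (simp add: \<pi>_def inner_diff_right)
  have n\<pi>: "norm (\<pi> v) \<le> norm v" for v
  proof -
    have "orthogonal (\<pi> v) (((k \<bullet> v) / (k \<bullet> k)) *\<^sub>R k)"
      using k\<pi>[of v] by (simp add: orthogonal_def inner_commute)
    then have "(norm (\<pi> v + ((k \<bullet> v) / (k \<bullet> k)) *\<^sub>R k))\<^sup>2 = (norm (\<pi> v))\<^sup>2 + (norm (((k \<bullet> v) / (k \<bullet> k)) *\<^sub>R k))\<^sup>2"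
      by (rule norm_add_Pythagorean)
    then have "(norm (\<pi> v))\<^sup>2 \<le> (norm v)\<^sup>2" by (simp add: \<pi>_def)
    then show ?thesis by (rule power2_le_imp_le) simp
  qed
  define P where "P U = F ` {y \<in> cball x R. \<pi> (y - x) \<in> U}" for U
  have "F ` (?S \<inter> cball x R) \<subseteq> (\<Union>U\<in>\<U>. P U)"
  proof
    fix p assume "p \<in> F ` (?S \<inter> cball x R)"
    then obtain y where p: "p = F y" and y: "y \<in> cball x R" by blast
    then have "norm (\<pi> (y - x)) \<le> R" using n\<pi>[of "y - x"] by (simp add: dist_norm norm_minus_commute)
    then have "\<pi> (y - x) \<in> \<Union>\<U>" using U(3) k\<pi>[of "y - x"] R by auto
    then show "p \<in> (\<Union>U\<in>\<U>. P U)" using y p unfolding P_def by blast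
  qed
  then have "hausdorff_pre pdist (?m + 1) \<delta> (F ` (?S \<inter> cball x R)) \<le> hausdorff_pre pdist (?m + 1) \<delta> (\<Union>U\<in>\<U>. P U)"
    by (rule hausdorff_pre_mono)
  also have "\<dots> \<le> (\<Sum>U\<in>\<U>. hausdorff_pre pdist (?m + 1) \<delta> (P U))"
    using \<delta> U(1) by (intro hausdorff_pre_UN_finite) auto
  also have "\<dots> \<le> (\<Sum>U\<in>\<U>. ennreal (2 ^ (?m + 2) * (D * (R / M)) ^ ?m))"
  proof (intro sum_mono hausdorff_pre_pdist_Suc_le)
    have err: "norm (F y - F x - T (y - x)) \<le> R / M" if "y \<in> cball x R" for y
    proof -
      have y: "norm (y - x) \<le> R" using that by (simp add: dist_norm norm_minus_commute)
      have "norm (F y - F x - T (y - x)) \<le> (1 / M) * norm (y - x)" using y R d by auto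
      also have "\<dots> \<le> (1 / M) * R" using y by (intro mult_left_mono) auto
      finally show ?thesis by simp
    qed
    fix U p q assume U': "U \<in> \<U>" and "p \<in> P U" "q \<in> P U"
    then obtain y z where yz: "p = F y" "q = F z" "y \<in> cball x R" "z \<in> cball x R" "\<pi> (y - x) \<in> U" "\<pi> (z - x) \<in> U"
      unfolding P_def by blast
    have "norm (T (y - x) - T (z - x)) = norm (T (\<pi> (y - x) - \<pi> (z - x)))"
      using lin by (simp add: linear_diff T\<pi>)
    also have "\<dots> \<le> B * norm (\<pi> (y - x) - \<pi> (z - x))" by (rule B)
    also have "\<dots> \<le> B * (C * (R / M))" using U(4) U' yz B by (intro mult_left_mono) auto
    finally have "norm (T (y - x) - T (z - x)) \<le> B * (C * (R / M))" .
    moreover have "p - q = (T (y - x) - T (z - x)) + ((F y - F x - T (y - x)) - (F z - F x - T (z - x)))"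
      by (simp add: yz)
    ultimately have "norm (p - q) \<le> B * (C * (R / M)) + (R / M + R / M)"
      using err[OF yz(3)] err[OF yz(4)] by (metis add_mono norm_triangle_le norm_triangle_le_diff)
    then show "dist p q \<le> D * (R / M)" by (simp add: dist_norm D_def algebra_simps)
  qed (use RM R in auto)
  also have "\<dots> = ennreal (real (card \<U>) * (2 ^ (?m + 2) * (D * (R / M)) ^ ?m))"
    using RM by (simp add: ennreal_of_nat_eq_real_of_nat flip: ennreal_mult)
  also have "\<dots> \<le> ennreal (\<eta> * (R / 5) ^ ?m)"
  proof (intro ennreal_leI)
    have "real (card \<U>) * (2 ^ (?m + 2) * (D * (R / M)) ^ ?m) \<le> real ((2 * M + 1) ^ (?m - 1)) * (2 ^ (?m + 2) * (D * (R / M)) ^ ?m)"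
      using U(2) RM by (intro mult_right_mono) (auto simp only: of_nat_le_iff, simp)
    also have "\<dots> = 2 ^ (?m + 2) * (real ((2 * M + 1) ^ (?m - 1)) * (D * (R / M)) ^ ?m)" by simp
    also have "\<dots> \<le> 2 ^ (?m + 2) * ((3 * D) ^ ?m * R ^ ?m / M)"
      using M D R by (intro mult_left_mono slab_count_bound) auto
    also have "\<dots> = c / M * (R / 5) ^ ?m" by (simp add: c_def power_divide)
    also have "\<dots> \<le> \<eta> * (R / 5) ^ ?m" using M R by (intro mult_right_mono) auto
    finally show "real (card \<U>) * (2 ^ (?m + 2) * (D * (R / M)) ^ ?m) \<le> \<eta> * (R / 5) ^ ?m" .
  qed
  finally have "hausdorff_pre pdist (?m + 1) \<delta> (F ` (?S \<inter> cball x (5 * (R / 5)))) \<le> ennreal (\<eta> * (R / 5) ^ DIM(real ^ 'm))"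
    by simp
  then show "\<exists>r>0. r < s \<and> hausdorff_pre pdist (?m + 1) \<delta> (F ` (?S \<inter> cball x (5 * r))) \<le> ennreal (\<eta> * r ^ DIM(real ^ 'm))"
    using R by (intro exI[of _ "R / 5"]) auto
qed simp

lemma hausdorff_image_le_diameter:
  assumes U: "\<And>y z. y \<in> U \<Longrightarrow> z \<in> U \<Longrightarrow> norm (y - z) \<le> \<rho>" and \<rho>: "\<rho> > 0"
  shows "hausdorff dist CARD('m) (F ` U) \<le> ennreal ((20 * L * \<rho>) ^ CARD('m))"
proof (cases "U = {}")
  case True
  then show ?thesis using hausdorff_null_empty[of "CARD('m)" "dist :: 'n pspace \<Rightarrow> _"] by simp
next
  case False
  let ?m = "CARD('m)"
  obtain z where z: "z \<in> U" using False by blast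
  have U2: "U \<subseteq> ball z (2 * \<rho>)"
  proof
    fix y assume "y \<in> U"
    then show "y \<in> ball z (2 * \<rho>)" using U[OF z, of y] \<rho> by (simp add: dist_norm)
  qed
  show ?thesis
  proof (rule hausdorff_le)
    fix \<delta> :: real assume \<delta>: "\<delta> > 0"
    have "hausdorff_pre dist ?m \<delta> (F ` U) \<le> ennreal ((10 * L) ^ ?m / unit_ball_vol DIM(real ^ 'm)) * emeasure lebesgue (ball z (2 * \<rho>))"
    proof (rule hausdorff_pre_image_le[OF \<delta> _ _ open_ball U2])
      fix x :: "real ^ 'm" and s :: real assume "x \<in> U" and s: "s > 0"
      define r where "r = min (s / 2) (\<delta> / (20 * L))"
      have r: "r > 0" "r < s" "10 * L * r < \<delta>"
      proof -
        show "r > 0" "r < s" using s \<delta> L by (auto simp: r_def)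
        have "r \<le> \<delta> / (20 * L)" by (simp add: r_def)
        then have "20 * (L * r) \<le> \<delta>" using L by (simp add: field_simps)
        moreover have "L * r > 0" using L \<open>r > 0\<close> by simp
        ultimately show "10 * L * r < \<delta>" by linarith
      qed
      have "hausdorff_pre dist ?m \<delta> (F ` (U \<inter> cball x (5 * r))) \<le> ennreal ((10 * L * r) ^ ?m)"
      proof (intro hausdorff_pre_le_power ediameter_le)
        fix p q assume "p \<in> F ` (U \<inter> cball x (5 * r))" "q \<in> F ` (U \<inter> cball x (5 * r))"
        then obtain y z where "p = F y" "q = F z" "y \<in> cball x (5 * r)" "z \<in> cball x (5 * r)" by blast
        then show "dist p q \<le> 10 * L * r" using dist_F_cball[of y x "5 * r" z] by simp
      qed (use r L in auto)
      then show "\<exists>r>0. r < s \<and> hausdorff_pre dist ?m \<delta> (F ` (U \<inter> cball x (5 * r))) \<le> ennreal ((10 * L) ^ ?m * r ^ DIM(real ^ 'm))"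
        using r by (intro exI[of _ r]) (simp add: power_mult_distrib)
    qed (use L in auto)
    also have "\<dots> = ennreal ((20 * L * \<rho>) ^ ?m)"
    proof -
      have "unit_ball_vol (real ?m) \<noteq> 0" by (metis less_irrefl of_nat_0_le_iff unit_ball_vol_pos)
      then have "ennreal ((10 * L) ^ ?m / unit_ball_vol DIM(real ^ 'm)) * emeasure lebesgue (ball z (2 * \<rho>)) = ennreal ((10 * L) ^ ?m * (2 * \<rho>) ^ ?m)"
        using \<rho> L by (simp add: emeasure_ball flip: ennreal_mult)
      also have "(10 * L) ^ ?m * (2 * \<rho>) ^ ?m = (20 * L * \<rho>) ^ ?m"
        by (subst power_mult_distrib[symmetric]) (simp add: mult_ac)
      finally show ?thesis .
    qed
    finally show "hausdorff_pre dist ?m \<delta> (F ` U) \<le> ennreal ((20 * L * \<rho>) ^ ?m)" .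
  qed
qed

end

section \<open>Vertical Lipschitz graphs\<close>

lemma orthogonal_projection_exists:
  fixes W :: "'a::euclidean_space set"
  assumes W: "subspace W"
  obtains P where "linear P" "\<And>x. P x \<in> W" "\<And>x w. w \<in> W \<Longrightarrow> w \<bullet> (x - P x) = 0" "\<And>w. w \<in> W \<Longrightarrow> P w = w"
proof -
  obtain B where B: "B \<subseteq> W" "pairwise orthogonal B" "\<And>x. x \<in> B \<Longrightarrow> norm x = 1" "independent B" "card B = dim W" "span B = W"
    using orthonormal_basis_subspace[OF W] by blast
  have fin: "finite B" using B(4) independent_imp_finite by blast
  define P where "P x = (\<Sum>b\<in>B. (x \<bullet> b) *\<^sub>R b)" for x
  have lin: "linear P"
    unfolding P_def by (intro linearI) (simp_all add: inner_add_left scaleR_add_left sum.distrib scaleR_sum_right)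
  have PW: "P x \<in> W" for x
    unfolding P_def using B(1) W by (intro subspace_sum subspace_scale) auto
  have orthB: "b \<bullet> (x - P x) = 0" if "b \<in> B" for b x
  proof -
    have "b \<bullet> P x = (\<Sum>c\<in>B. (x \<bullet> c) * (b \<bullet> c))" by (simp add: P_def inner_sum_right)
    also have "\<dots> = (\<Sum>c\<in>B. if c = b then x \<bullet> b else 0)"
    proof (intro sum.cong refl)
      fix c assume c: "c \<in> B"
      show "(x \<bullet> c) * (b \<bullet> c) = (if c = b then x \<bullet> b else 0)"
      proof (cases "c = b")
        case True
        then show ?thesis using B(3)[OF that] by (simp add: dot_square_norm)
      next
        case False
        then have "b \<bullet> c = 0" using B(2) c that by (auto simp: pairwise_def orthogonal_def)
        then show ?thesis using False by simp
      qed
    qed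
    also have "\<dots> = x \<bullet> b" using fin that by simp
    finally show ?thesis by (simp add: inner_diff_right inner_commute)
  qed
  have orth: "w \<bullet> (x - P x) = 0" if "w \<in> W" for w x
  proof -
    have "orthogonal (x - P x) w"
    proof (rule orthogonal_to_span[of w B])
      show "w \<in> span B" using that B by simp
    qed (use orthB in \<open>auto simp: orthogonal_def inner_commute\<close>)
    then show ?thesis by (simp add: orthogonal_def inner_commute)
  qed
  have "P w = w" if "w \<in> W" for w
  proof -
    have "w - P w \<in> W" using that PW W by (intro subspace_diff)
    then have "(w - P w) \<bullet> (w - P w) = 0" using orth by blast
    then show ?thesis by simp
  qed
  then show thesis using that lin PW orth by blast
qed

lemma norm_complement_le:
  fixes x :: "'a::real_inner"
  assumes "p \<bullet> (x - p) = 0"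
  shows "norm (x - p) \<le> norm x"
proof -
  have "(norm (p + (x - p)))\<^sup>2 = (norm p)\<^sup>2 + (norm (x - p))\<^sup>2"
    by (rule norm_add_Pythagorean) (use assms in \<open>simp add: orthogonal_def\<close>)
  then have "(norm (x - p))\<^sup>2 \<le> (norm x)\<^sup>2" by simp
  then show ?thesis by (rule power2_le_imp_le) simp
qed

text \<open>The two-point condition makes the projection to \<open>W \<times> UNIV\<close> injective
  on \<open>S\<close>, so \<open>S\<close> is a graph. The graph function has time component 0,
  hence its parabolic norm is the Euclidean norm in the condition.\<close>

lemma vertical_lipschitz_graphI:
  fixes S :: "'n::finite pspace set"
  assumes W: "subspace W" "dim W + 1 = m" "m < CARD('n) + 1"
    and P: "linear P" "\<And>x. P x \<in> W" "\<And>x w. w \<in> W \<Longrightarrow> w \<bullet> (x - P x) = 0"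
    and S: "\<And>p q. p \<in> S \<Longrightarrow> q \<in> S \<Longrightarrow> norm (fst (p - q) - P (fst (p - q))) \<le> L * pnorm (P (fst (p - q)), snd (p - q))"
  shows "vertical_lipschitz_graph (m + 1) L S"
proof -
  define V :: "'n pspace set" where "V = W \<times> UNIV"
  have V: "V \<in> planes_V (m + 1)"
  proof -
    have "dim (W \<times> (UNIV :: real set)) = dim W + dim (UNIV :: real set)"
      using W by (intro dim_Times) auto
    then have "dim V = m" unfolding V_def using W by simp
    moreover have "subspace V" unfolding V_def using W by (intro subspace_Times) auto
    moreover have "{0} \<times> UNIV \<subseteq> V" using W by (auto simp: V_def subspace_0)
    ultimately show ?thesis using W by (auto simp: planes_V_def)
  qed
  define \<phi> where "\<phi> p = (P (fst p), snd p)" for p :: "'n pspace"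
  have \<phi>d: "\<phi> p - \<phi> q = (P (fst (p - q)), snd (p - q))" for p q
    using P(1) by (simp add: \<phi>_def linear_diff)
  have inj: "inj_on \<phi> S"
  proof (rule inj_onI)
    fix p q assume pq: "p \<in> S" "q \<in> S" "\<phi> p = \<phi> q"
    then have z: "P (fst (p - q)) = 0" "snd (p - q) = 0" using \<phi>d[of p q] by (auto simp: zero_prod_def)
    then have "norm (fst (p - q)) \<le> 0" using S[OF pq(1,2)] by (simp add: pnorm_def)
    then show "p = q" using z by (simp add: prod_eq_iff)
  qed
  define \<psi> where "\<psi> = inv_into S \<phi>"
  have \<psi>: "\<psi> (\<phi> p) = p" if "p \<in> S" for p using inj that by (simp add: \<psi>_def)
  define g where "g a = (fst (\<psi> a) - P (fst (\<psi> a)), 0 :: real)" for a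
  have "lipschitz_graph_over V L S"
    unfolding lipschitz_graph_over_def
  proof (intro exI conjI)
    show "\<phi> ` S \<subseteq> V" using P(2) by (auto simp: \<phi>_def V_def)
    show "g ` \<phi> ` S \<subseteq> V\<^sup>\<bottom>"
      using P(3) by (auto simp: g_def V_def orthogonal_comp_def orthogonal_def inner_prod_def)
    show "\<forall>x\<in>\<phi> ` S. \<forall>y\<in>\<phi> ` S. pnorm (g x - g y) \<le> L * pnorm (x - y)"
    proof (intro ballI)
      fix x y assume "x \<in> \<phi> ` S" "y \<in> \<phi> ` S"
      then obtain p q where pq: "p \<in> S" "q \<in> S" "x = \<phi> p" "y = \<phi> q" by blast
      have "g x - g y = (fst (p - q) - P (fst (p - q)), 0)"
        using P(1) pq by (simp add: g_def \<psi> linear_diff)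
      then have "pnorm (g x - g y) = norm (fst (p - q) - P (fst (p - q)))" by (simp add: pnorm_def)
      then show "pnorm (g x - g y) \<le> L * pnorm (x - y)" using S[OF pq(1,2)] pq by (simp add: \<phi>d)
    qed
    show "S = (\<lambda>x. x + g x) ` \<phi> ` S"
    proof -
      have "\<phi> p + g (\<phi> p) = p" if "p \<in> S" for p
      proof -
        have "g (\<phi> p) = (fst p - P (fst p), 0)" using that by (simp add: g_def \<psi>)
        then show ?thesis by (simp add: \<phi>_def prod_eq_iff)
      qed
      then show ?thesis by (simp add: image_image)
    qed
  qed
  then show ?thesis using V by (auto simp: vertical_lipschitz_graph_def)
qed

text \<open>A filler for sequences of graphs; the dimension bounds ensure that there is a plane to
  carry even the empty graph.\<close>

lemma vertical_lipschitz_graph_empty: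
  assumes "m \<ge> 1" "m < CARD('n::finite) + 1"
  shows "vertical_lipschitz_graph (m + 1) L ({} :: 'n pspace set)"
proof -
  have "m - 1 \<le> dim (UNIV :: (real ^ 'n) set)" using assms by simp
  then obtain W :: "(real ^ 'n) set" where W: "subspace W" "dim W = m - 1"
    by (rule choose_subspace_of_subspace)
  obtain P where "linear P" "\<And>x. P x \<in> W" "\<And>x w. w \<in> W \<Longrightarrow> w \<bullet> (x - P x) = 0" "\<And>w. w \<in> W \<Longrightarrow> P w = w"
    by (rule orthogonal_projection_exists[OF W(1)]) (rule that)
  then show ?thesis using W assms by (intro vertical_lipschitz_graphI[where W = W and P = P]) auto
qed

lemma pnorm_ge:
  "norm (fst p) \<le> pnorm p" "sqrt \<bar>snd p\<bar> \<le> pnorm p" "0 \<le> pnorm p"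
  unfolding pnorm_def by (auto intro!: real_le_rsqrt)

text \<open>With \<open>W\<close> the horizontal part of the plane \<open>T (\<real>\<^sup>m)\<close>, the component of an increment
  orthogonal to \<open>W \<times> \<real>\<close> is a multiple of its time component plus a small error; on a small
  time scale the time component is negligible against its square root, whatever the slope.\<close>

lemma nearly_linear_image_vertical_graph:
  fixes T :: "real ^ 'm::finite \<Rightarrow> 'n::finite pspace"
  assumes lin: "linear T" and inj: "inj T" and v: "\<exists>h. snd (T h) \<noteq> 0"
    and L: "L > 0" and dims: "CARD('m) < CARD('n) + 1"
  shows "\<exists>\<epsilon>>0. \<exists>\<sigma>>0. \<forall>(F :: real ^ 'm \<Rightarrow> 'n pspace) S.
     (\<forall>x\<in>S. \<forall>y\<in>S. norm (F x - F y - T (x - y)) \<le> \<epsilon> * norm (x - y)) \<and>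
     (\<forall>x\<in>S. \<forall>y\<in>S. \<bar>snd (F x) - snd (F y)\<bar> \<le> \<sigma>) \<longrightarrow>
     vertical_lipschitz_graph (CARD('m) + 1) L (F ` S)"
proof -
  obtain h0 where h0: "snd (T h0) \<noteq> 0" using v by blast
  \<comment> \<open>A direction of unit speed in time, complementary to the kernel \<open>K\<close>
    of the time component.\<close>
  define h where "h = (1 / snd (T h0)) *\<^sub>R h0"
  have h: "snd (T h) = 1" using h0 lin by (simp add: h_def linear_cmul)
  have linst: "linear (\<lambda>v. snd (T v))" using linear_compose[OF lin linear_snd] by (simp add: o_def)
  have linft: "linear (\<lambda>v. fst (T v))" using linear_compose[OF lin linear_fst] by (simp add: o_def)
  define a where "a = adjoint (\<lambda>v. snd (T v)) 1"
  have a: "a \<bullet> v = snd (T v)" for v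
    using adjoint_works[OF linst, of v 1] by (simp add: a_def inner_commute)
  have "a \<noteq> 0" using a[of h] h by auto
  define K where "K = {v. snd (T v) = 0}"
  have K: "subspace K" "dim K = CARD('m) - 1"
  proof -
    have "K = {v. a \<bullet> v = 0}" by (simp add: K_def a)
    then show "subspace K" "dim K = CARD('m) - 1"
      using subspace_hyperplane dim_hyperplane[OF \<open>a \<noteq> 0\<close>] by auto
  qed
  define W where "W = (\<lambda>v. fst (T v)) ` K"
  have W: "subspace W" unfolding W_def using linft K by (intro linear_subspace_image)
  have "inj_on (\<lambda>v. fst (T v)) K"
  proof (rule inj_onI)
    fix x y assume "x \<in> K" "y \<in> K" "fst (T x) = fst (T y)"
    then have "T x = T y" by (simp add: K_def prod_eq_iff)
    then show "x = y" using inj by (simp add: inj_eq)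
  qed
  then have "dim W = dim K" unfolding W_def
    using linft K by (intro dim_image_eq) (auto simp: span_eq_iff[THEN iffD2])
  then have dimW: "dim W + 1 = CARD('m)" using K by simp
  obtain P where P: "linear P" "\<And>x. P x \<in> W" "\<And>x w. w \<in> W \<Longrightarrow> w \<bullet> (x - P x) = 0" "\<And>w. w \<in> W \<Longrightarrow> P w = w"
    by (rule orthogonal_projection_exists[OF W]) (rule that)
  define Q where "Q x = x - P x" for x
  have Q: "norm (Q x) \<le> norm x" for x
    unfolding Q_def using P(3)[OF P(2)] by (intro norm_complement_le)
  have Qadd: "Q (x + y) = Q x + Q y" "Q (c *\<^sub>R x) = c *\<^sub>R Q x" for x y c
    using P(1) by (simp_all add: Q_def linear_add linear_cmul algebra_simps)
  obtain c where c: "c > 0" "\<And>v. c * norm v \<le> norm (T v)"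
    using linear_inj_bounded_below_pos[OF lin inj] by (metis mult.commute)
  define b where "b = norm (fst (T h))"
  have b: "b \<ge> 0" by (simp add: b_def)
  \<comment> \<open>Subtracting a multiple of \<open>h\<close> moves \<open>v\<close> into
    \<open>K\<close>, whose image lies in \<open>W\<close> and is killed by \<open>Q\<close>. The
    slope of the plane enters only through \<open>b\<close>.\<close>
  have QT: "norm (Q (fst (T v))) \<le> b * \<bar>snd (T v)\<bar>" for v
  proof -
    have "T (v - snd (T v) *\<^sub>R h) = T v - snd (T v) *\<^sub>R T h" using lin by (simp add: linear_diff linear_cmul)
    then have "v - snd (T v) *\<^sub>R h \<in> K" using h by (simp add: K_def)
    then have w: "fst (T (v - snd (T v) *\<^sub>R h)) \<in> W" by (auto simp: W_def)
    have "fst (T v) = fst (T (v - snd (T v) *\<^sub>R h)) + snd (T v) *\<^sub>R fst (T h)"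
      using lin by (simp add: linear_diff linear_cmul)
    then have "Q (fst (T v)) = Q (fst (T (v - snd (T v) *\<^sub>R h))) + snd (T v) *\<^sub>R Q (fst (T h))"
      by (metis Qadd)
    also have "Q (fst (T (v - snd (T v) *\<^sub>R h))) = 0" using P(4)[OF w] by (simp add: Q_def)
    finally have "norm (Q (fst (T v))) = \<bar>snd (T v)\<bar> * norm (Q (fst (T h)))" by simp
    also have "\<dots> \<le> \<bar>snd (T v)\<bar> * b" unfolding b_def by (intro mult_left_mono Q) auto
    finally show ?thesis by (simp add: mult.commute)
  qed
  \<comment> \<open>\<open>e \<le> 1 / 2\<close> lets the term with \<open>Q\<close> on the right be
    absorbed on the left; the doubled remainder \<open>2 * e\<close> is then at most half of
    \<open>L\<close>.\<close>
  define e where "e = min (1 / 2) (L / 4)"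
  have e: "e > 0" "e \<le> 1 / 2" "2 * e \<le> L / 2" using L by (auto simp: e_def)
  \<comment> \<open>The first bound keeps the lower bound of \<open>T\<close> up to a factor 2 after
    linearisation; the second makes the total error orthogonal to the plane at most \<open>e\<close>
    times the increment.\<close>
  define \<epsilon> where "\<epsilon> = min (c / 2) (e * c / (2 * (1 + b)))"
  have \<epsilon>: "\<epsilon> > 0" "\<epsilon> \<le> c / 2" "2 * \<epsilon> * (1 + b) / c \<le> e"
  proof -
    show "\<epsilon> > 0" using c(1) e b by (simp add: \<epsilon>_def)
    show "\<epsilon> \<le> c / 2" by (simp only: \<epsilon>_def min.cobounded1)
    have "\<epsilon> \<le> e * c / (2 * (1 + b))" by (simp add: \<epsilon>_def)
    then show "2 * \<epsilon> * (1 + b) / c \<le> e" using c b by (simp add: field_simps)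
  qed
  \<comment> \<open>Chosen so that \<open>2 * (b + 1) * sqrt \<sigma>\<close> is the other half of
    \<open>L\<close>: time increments up to \<open>\<sigma>\<close> are at most
    \<open>sqrt \<sigma>\<close> times their square root, which the parabolic norm
    dominates.\<close>
  define \<sigma> where "\<sigma> = (L / (4 * (b + 1)))\<^sup>2"
  have \<sigma>: "\<sigma> > 0" "2 * (b + 1) * sqrt \<sigma> = L / 2"
  proof -
    show "\<sigma> > 0" using L b by (simp add: \<sigma>_def)
    have "sqrt \<sigma> = L / (4 * (b + 1))" using L b by (simp add: \<sigma>_def real_sqrt_unique)
    then show "2 * (b + 1) * sqrt \<sigma> = L / 2" using b by (simp add: field_simps)
  qed
  have main: "vertical_lipschitz_graph (CARD('m) + 1) L (F ` S)"
    if F1: "\<forall>x\<in>S. \<forall>y\<in>S. norm (F x - F y - T (x - y)) \<le> \<epsilon> * norm (x - y)"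
      and F2: "\<forall>x\<in>S. \<forall>y\<in>S. \<bar>snd (F x) - snd (F y)\<bar> \<le> \<sigma>" for F :: "real ^ 'm \<Rightarrow> 'n pspace" and S
  proof (rule vertical_lipschitz_graphI[OF W dimW dims P(1-3)])
    fix p q assume "p \<in> F ` S" "q \<in> F ` S"
    then obtain x y where xy: "x \<in> S" "y \<in> S" "p = F x" "q = F y" by blast
    define v where "v = x - y"
    define D where "D = p - q"
    define E where "E = D - T v"
    have E: "norm E \<le> \<epsilon> * norm v" using F1 xy by (auto simp: E_def D_def v_def)
    have Ef: "norm (fst E) \<le> \<epsilon> * norm v" "\<bar>snd E\<bar> \<le> \<epsilon> * norm v"
      using E norm_fst_le[of "fst E" "snd E"] norm_snd_le[of "snd E" "fst E"] by auto
    have DT: "D = T v + E" by (simp add: E_def)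
    have nv: "norm v \<le> 2 / c * norm D"
    proof -
      have "c * norm v \<le> norm (T v)" by (rule c)
      also have "\<dots> \<le> norm D + norm E" unfolding DT by (metis add_diff_cancel_right' norm_triangle_ineq4)
      also have "norm E \<le> c / 2 * norm v" using E \<epsilon>(2) by (meson mult_right_mono norm_ge_zero order_trans)
      finally show ?thesis using c by (simp add: field_simps)
    qed
    have "norm (Q (fst D)) \<le> norm (Q (fst (T v))) + norm (Q (fst E))"
      unfolding DT fst_add Qadd by (rule norm_triangle_ineq)
    also have "norm (Q (fst E)) \<le> \<epsilon> * norm v" using Q Ef(1) order_trans by blast
    also have "norm (Q (fst (T v))) \<le> b * (\<bar>snd D\<bar> + \<epsilon> * norm v)"
    proof -
      have "\<bar>snd (T v)\<bar> \<le> \<bar>snd D\<bar> + \<epsilon> * norm v" using Ef(2) unfolding DT by simp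
      then show ?thesis using QT[of v] b by (meson mult_left_mono order_trans)
    qed
    finally have "norm (Q (fst D)) \<le> b * \<bar>snd D\<bar> + \<epsilon> * (1 + b) * norm v" by (simp add: algebra_simps)
    also have "\<epsilon> * (1 + b) * norm v \<le> \<epsilon> * (1 + b) * (2 / c * norm D)"
      using \<epsilon> b nv by (intro mult_left_mono) auto
    also have "\<dots> = 2 * \<epsilon> * (1 + b) / c * norm D" by simp
    also have "\<dots> \<le> e * norm D" using \<epsilon>(3) by (intro mult_right_mono) auto
    also have "\<dots> \<le> e * (norm (P (fst D)) + norm (Q (fst D)) + \<bar>snd D\<bar>)"
    proof (intro mult_left_mono)
      have "norm D \<le> norm (fst D) + norm (snd D)"
        using norm_Pair_le[of "fst D" "snd D"] by simp
      also have "norm (fst D) \<le> norm (P (fst D)) + norm (Q (fst D))"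
        using norm_triangle_ineq[of "P (fst D)" "Q (fst D)"] by (simp add: Q_def)
      finally show "norm D \<le> norm (P (fst D)) + norm (Q (fst D)) + \<bar>snd D\<bar>" by simp
    qed (use e in auto)
    finally have 1: "norm (Q (fst D)) \<le> b * \<bar>snd D\<bar> + e * (norm (P (fst D)) + norm (Q (fst D)) + \<bar>snd D\<bar>)" by simp
    have "e * norm (Q (fst D)) \<le> 1 / 2 * norm (Q (fst D))" "e * \<bar>snd D\<bar> \<le> 1 * \<bar>snd D\<bar>"
      using e by (intro mult_right_mono; simp)+
    then have 2: "norm (Q (fst D)) \<le> 2 * (b + 1) * \<bar>snd D\<bar> + 2 * e * norm (P (fst D))"
      using 1 by (simp add: algebra_simps)
    let ?N = "pnorm (P (fst D), snd D)"
    have "2 * (b + 1) * \<bar>snd D\<bar> \<le> L / 2 * ?N"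
    proof -
      have "\<bar>snd D\<bar> \<le> \<sigma>" using F2 xy by (auto simp: D_def)
      then have "sqrt \<bar>snd D\<bar> \<le> sqrt \<sigma>" by simp
      then have "sqrt \<bar>snd D\<bar> * sqrt \<bar>snd D\<bar> \<le> sqrt \<sigma> * ?N"
        using pnorm_ge(2)[of "(P (fst D), snd D)"] by (intro mult_mono) auto
      then have "\<bar>snd D\<bar> \<le> sqrt \<sigma> * ?N" by simp
      then have "2 * (b + 1) * \<bar>snd D\<bar> \<le> 2 * (b + 1) * (sqrt \<sigma> * ?N)" using b by (intro mult_left_mono) auto
      also have "\<dots> = (2 * (b + 1) * sqrt \<sigma>) * ?N" by simp
      finally show ?thesis unfolding \<sigma>(2) .
    qed
    moreover have "2 * e * norm (P (fst D)) \<le> L / 2 * ?N"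
      using e L pnorm_ge(1,3)[of "(P (fst D), snd D)"] by (intro mult_mono) auto
    ultimately have "norm (Q (fst D)) \<le> L * ?N" using 2 by (simp add: field_simps)
    then show "norm (fst (p - q) - P (fst (p - q))) \<le> L * pnorm (P (fst (p - q)), snd (p - q))"
      by (simp add: Q_def D_def)
  qed
  show ?thesis
    by (intro exI[of _ \<epsilon>] exI[of _ \<sigma>] conjI allI impI \<epsilon>(1) \<sigma>(1)) (elim conjE, rule main)
qed

text \<open>What remains after Rademacher's theorem and the two degenerate cases: injectivity rules
  out a kernel, the last clause a vanishing time component.\<close>

definition vertical_point :: "(real ^ 'm::finite \<Rightarrow> 'n::finite pspace) \<Rightarrow> real ^ 'm \<Rightarrow> bool" where
  "vertical_point F x \<longleftrightarrow> (\<exists>T. (F has_derivative T) (at x) \<and> inj T \<and> (\<exists>h. snd (T h) \<noteq> 0))"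

lemma non_vertical_points_image_null:
  fixes F :: "real ^ 'm::finite \<Rightarrow> 'n::finite pspace"
  assumes lip: "L-lipschitz_on UNIV F"
  shows "hausdorff pdist (CARD('m) + 1) (F ` {x. \<not> vertical_point F x}) = 0"
proof -
  have lip': "(max L 1)-lipschitz_on UNIV F" and L: "max L 1 \<ge> 1"
    using lipschitz_on_mono[OF lip, of UNIV "max L 1"] by auto
  let ?A = "{x. \<not> F differentiable (at x)}"
  let ?B = "{x. \<exists>T. (F has_derivative T) (at x) \<and> (\<forall>v. snd (T v) = 0)}"
  let ?C = "{x. \<exists>T k. (F has_derivative T) (at x) \<and> k \<noteq> 0 \<and> T k = 0}"
  have "hausdorff pdist (CARD('m) + 1) (F ` ?A \<union> (F ` ?B \<union> F ` ?C)) = 0"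
    by (intro hausdorff_null_Un negligible_image_null[OF lip' L Rademacher[OF lip]]
        horizontal_derivative_image_null[OF lip' L] singular_derivative_image_null[OF lip' L]) auto
  moreover have "F ` {x. \<not> vertical_point F x} \<subseteq> F ` ?A \<union> (F ` ?B \<union> F ` ?C)"
  proof -
    have "x \<in> ?A \<union> (?B \<union> ?C)" if "\<not> vertical_point F x" for x
    proof (cases "F differentiable (at x)")
      case True
      then obtain T where T: "(F has_derivative T) (at x)" by (auto simp: differentiable_def)
      then have lin: "linear T" using has_derivative_linear by blast
      have "\<not> inj T \<or> (\<forall>h. snd (T h) = 0)" using that T by (auto simp: vertical_point_def)
      then show ?thesis
      proof
        assume "\<not> inj T"
        then obtain k where "k \<noteq> 0" "T k = 0" using linear_injective_0[OF lin] by blast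
        then show ?thesis using T by blast
      qed (use T in blast)
    qed simp
    then show ?thesis by blast
  qed
  ultimately show ?thesis by (rule hausdorff_null_subset)
qed

text \<open>A linear map is encoded by its columns, which puts the derivatives into a second countable
  space; by Lindelof, countably many of them serve as models for all points.\<close>

lemma vertical_points_image_covered:
  fixes F :: "real ^ 'm::finite \<Rightarrow> 'n::finite pspace"
  assumes lip: "B-lipschitz_on UNIV F" and L: "L > 0" and dims: "CARD('m) < CARD('n) + 1"
  shows "\<exists>\<G>. countable \<G> \<and> (\<forall>G\<in>\<G>. vertical_lipschitz_graph (CARD('m) + 1) L G) \<and> F ` {x. vertical_point F x} \<subseteq> \<Union>\<G>"
proof -
  define A where "A \<tau> v = (\<Sum>i\<in>UNIV. v $ i *\<^sub>R \<tau> $ i)" for \<tau> :: "'n pspace ^ 'm" and v :: "real ^ 'm"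
  have Alin: "linear (A \<tau>)" for \<tau>
    unfolding A_def by (intro linearI) (simp_all add: scaleR_add_left sum.distrib scaleR_sum_right)
  have Adiff: "norm (A \<tau> v - A \<tau>' v) \<le> real CARD('m) * norm (\<tau> - \<tau>') * norm v" for \<tau> \<tau>' v
  proof -
    have "norm (A \<tau> v - A \<tau>' v) = norm (\<Sum>i\<in>UNIV. v $ i *\<^sub>R (\<tau> - \<tau>') $ i)"
      by (simp add: A_def sum_subtractf[symmetric] scaleR_diff_right)
    also have "\<dots> \<le> (\<Sum>i\<in>UNIV. norm (v $ i *\<^sub>R (\<tau> - \<tau>') $ i))" by (rule norm_sum)
    also have "\<dots> \<le> (\<Sum>i\<in>(UNIV :: 'm set). norm v * norm (\<tau> - \<tau>'))"
    proof (intro sum_mono)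
      fix i :: 'm
      show "norm (v $ i *\<^sub>R (\<tau> - \<tau>') $ i) \<le> norm v * norm (\<tau> - \<tau>')"
        unfolding norm_scaleR using Finite_Cartesian_Product.norm_nth_le[of "\<tau> - \<tau>'" i] component_le_norm_cart[of v i]
        by (intro mult_mono) auto
    qed
    finally show ?thesis by (simp add: mult_ac)
  qed
  have Arep: "\<exists>\<tau>. T = A \<tau>" if "linear T" for T :: "real ^ 'm \<Rightarrow> 'n pspace"
  proof
    show "T = A (\<chi> i. T (axis i 1))"
    proof
      fix v :: "real ^ 'm"
      have "T v = T (\<Sum>i\<in>UNIV. v $ i *\<^sub>R axis i 1)" by (simp add: basis_expansion flip: scalar_mult_eq_scaleR)
      also have "\<dots> = A (\<chi> i. T (axis i 1)) v" using that by (simp add: A_def linear_sum linear_cmul)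
      finally show "T v = A (\<chi> i. T (axis i 1)) v" .
    qed
  qed
  define good where "good = {\<tau>. inj (A \<tau>) \<and> (\<exists>h. snd (A \<tau> h) \<noteq> 0)}"
  have "\<forall>\<tau>\<in>good. \<exists>\<epsilon> \<sigma>. \<epsilon> > 0 \<and> \<sigma> > 0 \<and> (\<forall>(F :: real ^ 'm \<Rightarrow> 'n pspace) S.
     (\<forall>x\<in>S. \<forall>y\<in>S. norm (F x - F y - A \<tau> (x - y)) \<le> \<epsilon> * norm (x - y)) \<and>
     (\<forall>x\<in>S. \<forall>y\<in>S. \<bar>snd (F x) - snd (F y)\<bar> \<le> \<sigma>) \<longrightarrow>
     vertical_lipschitz_graph (CARD('m) + 1) L (F ` S))"
  proof
    fix \<tau> assume "\<tau> \<in> good"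
    then show "\<exists>\<epsilon> \<sigma>. \<epsilon> > 0 \<and> \<sigma> > 0 \<and> (\<forall>(F :: real ^ 'm \<Rightarrow> 'n pspace) S.
     (\<forall>x\<in>S. \<forall>y\<in>S. norm (F x - F y - A \<tau> (x - y)) \<le> \<epsilon> * norm (x - y)) \<and>
     (\<forall>x\<in>S. \<forall>y\<in>S. \<bar>snd (F x) - snd (F y)\<bar> \<le> \<sigma>) \<longrightarrow>
     vertical_lipschitz_graph (CARD('m) + 1) L (F ` S))"
      using nearly_linear_image_vertical_graph[OF Alin _ _ L dims, of \<tau>] unfolding good_def by blast
  qed
  then obtain \<epsilon> \<sigma> where \<epsilon>\<sigma>: "\<And>\<tau>. \<tau> \<in> good \<Longrightarrow> \<epsilon> \<tau> > 0" "\<And>\<tau>. \<tau> \<in> good \<Longrightarrow> \<sigma> \<tau> > 0"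
    "\<And>\<tau> S. \<tau> \<in> good \<Longrightarrow> (\<forall>x\<in>S. \<forall>y\<in>S. norm (F x - F y - A \<tau> (x - y)) \<le> \<epsilon> \<tau> * norm (x - y)) \<Longrightarrow>
     (\<forall>x\<in>S. \<forall>y\<in>S. \<bar>snd (F x) - snd (F y)\<bar> \<le> \<sigma> \<tau>) \<Longrightarrow> vertical_lipschitz_graph (CARD('m) + 1) L (F ` S)"
    by metis
  \<comment> \<open>Replacing a derivative by a model within \<open>r \<tau>\<close> costs at most
    half of \<open>\<epsilon> \<tau>\<close>; the other half is left for differentiability.\<close>
  define r where "r \<tau> = \<epsilon> \<tau> / (2 * real CARD('m))" for \<tau>
  have r: "r \<tau> > 0" if "\<tau> \<in> good" for \<tau> using \<epsilon>\<sigma>(1)[OF that] by (simp add: r_def)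
  obtain \<B> where \<B>: "\<B> \<subseteq> (\<lambda>\<tau>. ball \<tau> (r \<tau>)) ` good" "countable \<B>" "\<Union>\<B> = \<Union>((\<lambda>\<tau>. ball \<tau> (r \<tau>)) ` good)"
    using Lindelof[of "(\<lambda>\<tau>. ball \<tau> (r \<tau>)) ` good"] by blast
  obtain N where N: "countable N" "N \<subseteq> good" "\<B> = (\<lambda>\<tau>. ball \<tau> (r \<tau>)) ` N"
    using countable_subset_image[of \<B> "\<lambda>\<tau>. ball \<tau> (r \<tau>)" good] \<B> by blast
  obtain D :: "(real ^ 'm) set" where D: "countable D" "\<And>X. open X \<Longrightarrow> X \<noteq> {} \<Longrightarrow> \<exists>d\<in>D. d \<in> X"
    using countable_dense_setE by blast
  have B: "B \<ge> 0" by (rule lipschitz_on_nonneg[OF lip])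
  \<comment> \<open>The first bound keeps any two points of a piece within the scale of
    linearisation, the second keeps the variation of time over a piece below
    \<open>\<sigma> \<tau>\<close>.\<close>
  define \<rho> where "\<rho> \<tau> j = min (1 / (2 * real (Suc j))) (\<sigma> \<tau> / (2 * (B + 1)))" for \<tau> and j :: nat
  have \<rho>: "\<rho> \<tau> j > 0" "2 * \<rho> \<tau> j \<le> 1 / Suc j" "B * (2 * \<rho> \<tau> j) \<le> \<sigma> \<tau>" if "\<tau> \<in> good" for \<tau> j
  proof -
    show "\<rho> \<tau> j > 0" using \<epsilon>\<sigma>(2)[OF that] B by (simp add: \<rho>_def)
    have 1: "\<rho> \<tau> j \<le> 1 / (2 * real (Suc j))" "\<rho> \<tau> j \<le> \<sigma> \<tau> / (2 * (B + 1))" by (simp_all add: \<rho>_def)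
    show "2 * \<rho> \<tau> j \<le> 1 / Suc j" using 1(1) by (simp add: field_simps)
    have "B * (2 * \<rho> \<tau> j) \<le> (B + 1) * (2 * \<rho> \<tau> j)" using \<open>\<rho> \<tau> j > 0\<close> by (intro mult_right_mono) auto
    also have "\<dots> \<le> \<sigma> \<tau>" using 1(2) B by (simp add: field_simps)
    finally show "B * (2 * \<rho> \<tau> j) \<le> \<sigma> \<tau>" .
  qed
  \<comment> \<open>The linearisation is required at each point \<open>x\<close> of the piece, with
    the same model, so any two points can be compared directly.\<close>
  define piece where "piece = (\<lambda>(\<tau>, j, d). {x \<in> ball d (\<rho> \<tau> j). \<forall>y. norm (y - x) < 1 / Suc j \<longrightarrow> norm (F y - F x - A \<tau> (y - x)) \<le> \<epsilon> \<tau> * norm (y - x)})"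
  define \<G> where "\<G> = (\<lambda>i. F ` piece i) ` (N \<times> (UNIV :: nat set) \<times> D)"
  have "countable \<G>" unfolding \<G>_def using N D by (intro countable_image countable_SIGMA) auto
  moreover have "vertical_lipschitz_graph (CARD('m) + 1) L G" if "G \<in> \<G>" for G
  proof -
    obtain \<tau> j d where G: "\<tau> \<in> N" "G = F ` piece (\<tau>, j, d)" using \<open>G \<in> \<G>\<close> by (auto simp: \<G>_def)
    have \<tau>: "\<tau> \<in> good" using G N by blast
    have close: "norm (x - y) < 2 * \<rho> \<tau> j" if "x \<in> piece (\<tau>, j, d)" "y \<in> piece (\<tau>, j, d)" for x y
      using that dist_triangle3[of x y d] by (auto simp: piece_def dist_norm[symmetric])
    show ?thesis
      unfolding G(2)
    proof (rule \<epsilon>\<sigma>(3)[OF \<tau>]; intro ballI)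
      fix x y assume xy: "x \<in> piece (\<tau>, j, d)" "y \<in> piece (\<tau>, j, d)"
      have "norm (x - y) < 1 / Suc j" using close[OF xy] \<rho>(2)[OF \<tau>, of j] by linarith
      then show "norm (F x - F y - A \<tau> (x - y)) \<le> \<epsilon> \<tau> * norm (x - y)" using xy(2) by (simp add: piece_def)
      have "\<bar>snd (F x) - snd (F y)\<bar> \<le> dist (F x) (F y)" using dist_snd_le[of "F x" "F y"] by (simp add: dist_real_def)
      also have "\<dots> \<le> B * dist x y" using lip by (auto simp: lipschitz_on_def)
      also have "\<dots> \<le> B * (2 * \<rho> \<tau> j)" using close[OF xy] B by (intro mult_left_mono) (auto simp: dist_norm)
      also have "\<dots> \<le> \<sigma> \<tau>" by (rule \<rho>(3)[OF \<tau>])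
      finally show "\<bar>snd (F x) - snd (F y)\<bar> \<le> \<sigma> \<tau>" .
    qed
  qed
  moreover have "F ` {x. vertical_point F x} \<subseteq> \<Union>\<G>"
  proof
    fix p assume "p \<in> F ` {x. vertical_point F x}"
    then obtain x T where x: "p = F x" "(F has_derivative T) (at x)" "inj T" "\<exists>h. snd (T h) \<noteq> 0"
      unfolding vertical_point_def by blast
    obtain \<tau> where \<tau>: "T = A \<tau>" using Arep has_derivative_linear[OF x(2)] by blast
    then have "\<tau> \<in> good" using x by (simp add: good_def)
    then have "\<tau> \<in> \<Union>\<B>" unfolding \<B>(3) using r[of \<tau>] by force
    then obtain \<tau>' where \<tau>': "\<tau>' \<in> N" "dist \<tau>' \<tau> < r \<tau>'" using N(3) by auto
    have g': "\<tau>' \<in> good" using \<tau>' N by blast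
    obtain d where d: "d > 0" "\<And>y. norm (y - x) < d \<Longrightarrow> norm (F y - F x - A \<tau> (y - x)) \<le> \<epsilon> \<tau>' / 2 * norm (y - x)"
      using has_derivative_atD[OF x(2), of "\<epsilon> \<tau>' / 2"] \<epsilon>\<sigma>(1)[OF g'] unfolding \<tau> by auto
    obtain j where j: "1 / Suc j < d" using d(1) by (metis nat_approx_posE)
    have "ball x (\<rho> \<tau>' j) \<noteq> {}" using \<rho>(1)[OF g', of j] by simp
    then obtain z where z: "z \<in> D" "z \<in> ball x (\<rho> \<tau>' j)" using D(2)[OF open_ball] by blast
    have "x \<in> piece (\<tau>', j, z)"
      unfolding piece_def
    proof (clarsimp, intro conjI allI impI)
      show "dist z x < \<rho> \<tau>' j" using z by (simp add: dist_commute)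
      fix y assume "norm (y - x) < 1 / (1 + real j)"
      then have y: "norm (y - x) < d" using j by simp
      have "norm (A \<tau> (y - x) - A \<tau>' (y - x)) \<le> real CARD('m) * norm (\<tau> - \<tau>') * norm (y - x)" by (rule Adiff)
      also have "\<dots> \<le> real CARD('m) * r \<tau>' * norm (y - x)"
        using \<tau>' by (intro mult_right_mono mult_left_mono) (auto simp: dist_norm norm_minus_commute)
      also have "\<dots> = \<epsilon> \<tau>' / 2 * norm (y - x)" by (simp add: r_def)
      finally have 1: "norm (A \<tau> (y - x) - A \<tau>' (y - x)) \<le> \<epsilon> \<tau>' / 2 * norm (y - x)" .
      have "F y - F x - A \<tau>' (y - x) = (F y - F x - A \<tau> (y - x)) + (A \<tau> (y - x) - A \<tau>' (y - x))" by simp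
      then have "norm (F y - F x - A \<tau>' (y - x)) \<le> \<epsilon> \<tau>' / 2 * norm (y - x) + \<epsilon> \<tau>' / 2 * norm (y - x)"
        using d(2)[OF y] 1 norm_triangle_le add_mono by metis
      then show "norm (F y - F x - A \<tau>' (y - x)) \<le> \<epsilon> \<tau>' * norm (y - x)" by simp
    qed
    then show "p \<in> \<Union>\<G>" unfolding \<G>_def using \<tau>' z x(1) by blast
  qed
  ultimately show ?thesis by blast
qed

section \<open>Horizontal approximate tangent planes\<close>

text \<open>A small set \<open>U\<close> that meets the set lies in a ball about one of their common
  points with radius the diameter of \<open>U\<close>, so it catches at most half of its own cost.
  Every fine cover thus costs at least twice the measure, which is finite. The constant 1/2 fits
  because \<open>hausdorff\<close> sums powers of diameters without a volume factor.\<close>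

lemma hausdorff_null_if_density_small:
  fixes S :: "'a::metric_space set"
  assumes m: "m \<ge> 1" and fin: "hausdorff dist m S < \<infinity>"
    and dens: "\<And>a. a \<in> S \<Longrightarrow> \<exists>r0>0. \<forall>r. 0 < r \<and> r < r0 \<longrightarrow> hausdorff dist m (S \<inter> cball a r) \<le> ennreal (r ^ m / 2)"
  shows "hausdorff dist m S = 0"
proof -
  \<comment> \<open>The scale below which the density bound holds depends on the point; here it is
    made uniform.\<close>
  define S' where "S' l = {a\<in>S. \<forall>r. 0 < r \<and> r < 1 / Suc l \<longrightarrow> hausdorff dist m (S \<inter> cball a r) \<le> ennreal (r ^ m / 2)}" for l
  have "hausdorff dist m (S' l) = 0" for l
  proof -
    have half: "2 * hausdorff dist m (S' l \<inter> U) \<le> ediameter dist U ^ m" if U: "ediameter dist U < ennreal (1 / Suc l)" for U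
    proof (cases "S' l \<inter> U = {}")
      case True
      then show ?thesis using hausdorff_null_empty[OF m, of "dist :: 'a \<Rightarrow> _"] by simp
    next
      case False
      then obtain a where a: "a \<in> S' l" "a \<in> U" by blast
      obtain \<rho> where \<rho>: "ediameter dist U = ennreal \<rho>" "\<rho> \<ge> 0" "\<rho> < 1 / Suc l"
        using U by (cases "ediameter dist U") (auto simp: ennreal_less_iff)
      have d: "dist p q \<le> \<rho>" if "p \<in> U" "q \<in> U" for p q
        using le_ediameter[OF that, of dist] \<rho> by simp
      show ?thesis
      \<comment> \<open>The density bound is available for positive radii only.\<close>
      proof (cases "\<rho> = 0")
        case True
        have "hausdorff dist m (S' l \<inter> U) \<le> 0"
        proof (rule hausdorff_le)
          fix \<delta> :: real assume "\<delta> > 0"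
          then have "hausdorff_pre dist m \<delta> (S' l \<inter> U) \<le> ennreal (0 ^ m)"
            using m d True by (intro hausdorff_pre_le_power ediameter_le) auto
          then show "hausdorff_pre dist m \<delta> (S' l \<inter> U) \<le> 0" using m by (simp add: power_0_left)
        qed
        then show ?thesis by simp
      next
        case False
        have "S' l \<inter> U \<subseteq> S \<inter> cball a \<rho>" using a d by (auto simp: S'_def)
        then have "hausdorff dist m (S' l \<inter> U) \<le> hausdorff dist m (S \<inter> cball a \<rho>)" by (rule hausdorff_mono)
        also have "\<dots> \<le> ennreal (\<rho> ^ m / 2)" using a \<rho> False by (auto simp: S'_def)
        finally have "2 * hausdorff dist m (S' l \<inter> U) \<le> 2 * ennreal (\<rho> ^ m / 2)" by (rule mult_left_mono) simp
        also have "\<dots> = ennreal 2 * ennreal (\<rho> ^ m / 2)" by simp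
        also have "\<dots> = ennreal (\<rho> ^ m)" using \<rho> by (subst ennreal_mult[symmetric]) auto
        finally show ?thesis using \<rho> by (simp add: ennreal_power)
      qed
    qed
    have "2 * hausdorff dist m (S' l) \<le> hausdorff_pre dist m (1 / Suc l) (S' l)"
      unfolding hausdorff_pre_def
    proof (rule INF_greatest, clarify)
      fix U :: "nat \<Rightarrow> 'a set" assume U: "S' l \<subseteq> (\<Union>i. U i)" "\<forall>i. ediameter dist (U i) < ennreal (1 / Suc l)"
      have "hausdorff dist m (S' l) \<le> hausdorff dist m (\<Union>i. S' l \<inter> U i)" using U(1) by (intro hausdorff_mono) blast
      also have "\<dots> \<le> (\<Sum>i. hausdorff dist m (S' l \<inter> U i))" by (rule hausdorff_UN_nat)
      finally have "2 * hausdorff dist m (S' l) \<le> 2 * (\<Sum>i. hausdorff dist m (S' l \<inter> U i))" by (rule mult_left_mono) simp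
      also have "\<dots> = (\<Sum>i. 2 * hausdorff dist m (S' l \<inter> U i))" by (rule ennreal_suminf_cmult[symmetric])
      also have "\<dots> \<le> (\<Sum>i. ediameter dist (U i) ^ m)" using U(2) by (intro suminf_le half) auto
      finally show "2 * hausdorff dist m (S' l) \<le> (\<Sum>i. ediameter dist (U i) ^ m)" .
    qed
    also have "\<dots> \<le> hausdorff dist m (S' l)" by (intro hausdorff_pre_le_hausdorff) simp
    finally have 2: "2 * hausdorff dist m (S' l) \<le> hausdorff dist m (S' l)" .
    have "hausdorff dist m (S' l) \<le> hausdorff dist m S" by (rule hausdorff_mono) (auto simp: S'_def)
    then have "hausdorff dist m (S' l) < \<infinity>" using fin by (rule le_less_trans)
    then obtain h where h: "hausdorff dist m (S' l) = ennreal h" "h \<ge> 0" by (cases "hausdorff dist m (S' l)") auto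
    have "ennreal (2 * h) \<le> ennreal h" using 2 h by (simp add: ennreal_mult)
    then show ?thesis using h by simp
  qed
  then have "hausdorff dist m (\<Union>l. S' l) = 0" using hausdorff_null_UN[OF m, of UNIV dist S'] by simp
  moreover have "S \<subseteq> (\<Union>l. S' l)"
  proof
    fix a assume a: "a \<in> S"
    then obtain r0 where r0: "r0 > 0" "\<forall>r. 0 < r \<and> r < r0 \<longrightarrow> hausdorff dist m (S \<inter> cball a r) \<le> ennreal (r ^ m / 2)"
      using dens by blast
    obtain l where "1 / Suc l < r0" using r0(1) by (metis nat_approx_posE)
    then have "a \<in> S' l" using a r0 by (auto simp: S'_def)
    then show "a \<in> (\<Union>l. S' l)" by blast
  qed
  ultimately show ?thesis by (rule hausdorff_null_subset)
qed

text \<open>The constant is chosen before the thickness, so that the bound tends to 0 relative to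
  R^m as the slab gets thinner.\<close>

lemma slab_image_le:
  fixes F :: "real ^ 'm::finite \<Rightarrow> 'n::finite pspace"
  assumes lip: "L-lipschitz_on UNIV F" and L: "L \<ge> 1" and k: "k \<noteq> 0"
  shows "\<exists>C>0. \<forall>x M R. M \<ge> 1 \<longrightarrow> R > 0 \<longrightarrow>
    hausdorff dist CARD('m) (F ` {y. norm (y - x) \<le> R \<and> \<bar>k \<bullet> (y - x)\<bar> \<le> R / real M}) \<le> ennreal (C * R ^ CARD('m) / real M)"
proof -
  let ?m = "CARD('m)"
  obtain C where C: "C > 0"
    "\<And>M R. M \<ge> 1 \<Longrightarrow> R > 0 \<Longrightarrow> \<exists>\<U>. finite \<U> \<and> card \<U> \<le> (2 * M + 1) ^ (?m - 1) \<and>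
       {v. norm v \<le> R \<and> \<bar>k \<bullet> v\<bar> \<le> R / real M} \<subseteq> \<Union>\<U> \<and>
       (\<forall>U\<in>\<U>. \<forall>v\<in>U. \<forall>w\<in>U. norm (v - w) \<le> C * (R / real M))"
    using slab_cover[OF k] by blast
  define D where "D = 20 * L * C"
  have D: "D > 0" using L C by (simp add: D_def)
  have "hausdorff dist ?m (F ` {y. norm (y - x) \<le> R \<and> \<bar>k \<bullet> (y - x)\<bar> \<le> R / real M}) \<le> ennreal ((3 * D) ^ ?m * R ^ ?m / real M)"
    if M: "M \<ge> 1" and R: "R > 0" for x M R
  proof -
    obtain \<U> where U: "finite \<U>" "card \<U> \<le> (2 * M + 1) ^ (?m - 1)"
       "{v. norm v \<le> R \<and> \<bar>k \<bullet> v\<bar> \<le> R / real M} \<subseteq> \<Union>\<U>"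
       "\<forall>U\<in>\<U>. \<forall>v\<in>U. \<forall>w\<in>U. norm (v - w) \<le> C * (R / real M)"
      using C(2)[OF M R] by blast
    have "F ` {y. norm (y - x) \<le> R \<and> \<bar>k \<bullet> (y - x)\<bar> \<le> R / real M} \<subseteq> (\<Union>U\<in>\<U>. F ` {y. y - x \<in> U})"
    proof
      fix p assume "p \<in> F ` {y. norm (y - x) \<le> R \<and> \<bar>k \<bullet> (y - x)\<bar> \<le> R / real M}"
      then obtain y where y: "p = F y" "y - x \<in> {v. norm v \<le> R \<and> \<bar>k \<bullet> v\<bar> \<le> R / real M}" by blast
      then obtain U where "U \<in> \<U>" "y - x \<in> U" using U(3) by blast
      then show "p \<in> (\<Union>U\<in>\<U>. F ` {y. y - x \<in> U})" using y(1) by blast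
    qed
    then have "hausdorff dist ?m (F ` {y. norm (y - x) \<le> R \<and> \<bar>k \<bullet> (y - x)\<bar> \<le> R / real M}) \<le> hausdorff dist ?m (\<Union>U\<in>\<U>. F ` {y. y - x \<in> U})"
      by (rule hausdorff_mono)
    also have "\<dots> \<le> (\<Sum>U\<in>\<U>. hausdorff dist ?m (F ` {y. y - x \<in> U}))"
      using U(1) by (intro hausdorff_UN_finite) auto
    also have "\<dots> \<le> (\<Sum>U\<in>\<U>. ennreal ((20 * L * (C * (R / M))) ^ ?m))"
    proof (intro sum_mono hausdorff_image_le_diameter[OF lip L])
      fix U y z assume "U \<in> \<U>" "y \<in> {y. y - x \<in> U}" "z \<in> {y. y - x \<in> U}"
      then have "norm ((y - x) - (z - x)) \<le> C * (R / real M)" using U(4) by blast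
      then show "norm (y - z) \<le> C * (R / real M)" by simp
    qed (use C R M in auto)
    also have "\<dots> = ennreal (real (card \<U>) * (D * (R / M)) ^ ?m)"
    proof -
      have "0 \<le> (D * (R / M)) ^ ?m" using D R M by simp
      then have "ennreal (real (card \<U>) * (D * (R / M)) ^ ?m) = of_nat (card \<U>) * ennreal ((D * (R / M)) ^ ?m)"
        by (subst ennreal_mult) (simp_all add: ennreal_of_nat_eq_real_of_nat)
      then show ?thesis by (simp add: D_def mult.assoc)
    qed
    also have "\<dots> \<le> ennreal (real ((2 * M + 1) ^ (?m - 1)) * (D * (R / M)) ^ ?m)"
      using U(2) D R by (intro ennreal_leI mult_right_mono) (simp_all only: of_nat_le_iff, simp)
    also have "\<dots> \<le> ennreal ((3 * D) ^ ?m * R ^ ?m / real M)"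
      using M D R by (intro ennreal_leI slab_count_bound) auto
    finally show ?thesis .
  qed
  moreover have "(3 * D) ^ ?m > 0" using D by simp
  ultimately show ?thesis by blast
qed

lemma snd_le_infdist_horizontal:
  fixes p :: "'n::finite pspace"
  assumes "V \<subseteq> horizontal" "V \<noteq> {}"
  shows "\<bar>snd p\<bar> \<le> infdist p V"
proof -
  have "\<bar>snd p\<bar> \<le> dist p w" if "w \<in> V" for w
  proof -
    have "snd w = 0" using that assms by (auto simp: horizontal_def)
    then show ?thesis using dist_snd_le[of p w] by (simp add: dist_real_def)
  qed
  then show ?thesis using assms(2) by (simp add: infdist_def cINF_greatest)
qed

text \<open>Near \<open>a\<close>, the image \<open>F ` Y\<close> follows a plane that is not horizontal, while up to small density
  \<open>E\<close> stays in a cone around a horizontal plane; the preimage of this cone is a thin slab.\<close>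

lemma horizontal_tangent_piece_null:
  fixes F :: "real ^ 'm::finite \<Rightarrow> 'n::finite pspace"
  assumes lip: "L-lipschitz_on UNIV F" and L: "L \<ge> 1" and c: "c \<ge> 1"
    and Y: "\<And>x. x \<in> Y \<Longrightarrow> vertical_point F x" "\<And>x y. x \<in> Y \<Longrightarrow> y \<in> Y \<Longrightarrow> norm (y - x) \<le> c * norm (F y - F x)"
    and fin: "hausdorff dist CARD('m) E < \<infinity>"
  shows "hausdorff dist CARD('m) ({a\<in>E. \<exists>V. approx_tangent_plane CARD('m) E a V \<and> V \<subseteq> horizontal} \<inter> F ` Y) = 0"
    (is "hausdorff _ _ ?S = 0")
proof (rule hausdorff_null_if_density_small)
  let ?m = "CARD('m)"
  have "hausdorff dist ?m ?S \<le> hausdorff dist ?m E" by (rule hausdorff_mono) auto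
  then show "hausdorff dist ?m ?S < \<infinity>" using fin by (rule le_less_trans)
  fix a assume "a \<in> ?S"
  then obtain V x where V: "approx_tangent_plane ?m E a V" "V \<subseteq> horizontal" and x: "x \<in> Y" "a = F x" by blast
  obtain T where T: "(F has_derivative T) (at x)" "\<exists>h. snd (T h) \<noteq> 0"
    using Y(1)[OF x(1)] by (auto simp: vertical_point_def)
  have lin: "linear (\<lambda>v. snd (T v))"
    using linear_compose[OF has_derivative_linear[OF T(1)] linear_snd] by (simp add: o_def)
  define k where "k = adjoint (\<lambda>v. snd (T v)) 1"
  have k: "k \<bullet> v = snd (T v)" for v
    using adjoint_works[OF lin, of v 1] by (simp add: k_def inner_commute)
  have "k \<noteq> 0" using k T(2) by fastforce
  then obtain C where C: "C > 0" "\<And>x M R. M \<ge> 1 \<Longrightarrow> R > 0 \<Longrightarrow>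
    hausdorff dist ?m (F ` {y. norm (y - x) \<le> R \<and> \<bar>k \<bullet> (y - x)\<bar> \<le> R / real M}) \<le> ennreal (C * R ^ ?m / real M)"
    using slab_image_le[OF lip L] by blast
  \<comment> \<open>The image of the slab and the part of \<open>E\<close> outside the cone each get
    half of the admissible density 1/2.\<close>
  obtain M0 :: nat where M0: "4 * C * c ^ ?m < M0" using reals_Archimedean2 by blast
  define M where "M = M0 + 1"
  have M: "M \<ge> 1" "C * c ^ ?m / real M \<le> 1 / 4" using M0 by (auto simp: M_def field_simps)
  \<comment> \<open>Aperture of the cone and error of the linearisation at once; together they give
    the relative width \<open>1 / real M\<close> of the slab.\<close>
  define s where "s = 1 / (2 * real M)"
  have s: "0 < s" "s < 1" "s + s = 1 / real M" using M by (auto simp: s_def)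
  have V0: "V \<noteq> {}" using V(1) subspace_0 by (auto simp: approx_tangent_plane_def)
  have "((\<lambda>r. ennreal (1 / r ^ ?m) * hausdorff dist ?m (E \<inter> cball a r - euclidean_cone a V s)) \<longlongrightarrow> 0) (at_right 0)"
    using V(1) s by (simp add: approx_tangent_plane_def)
  then have "\<forall>\<^sub>F r in at_right 0. ennreal (1 / r ^ ?m) * hausdorff dist ?m (E \<inter> cball a r - euclidean_cone a V s) < ennreal (1 / 4)"
    by (rule order_tendstoD) simp
  then obtain r1 where r1: "r1 > 0" "\<And>r. 0 < r \<Longrightarrow> r < r1 \<Longrightarrow>
      ennreal (1 / r ^ ?m) * hausdorff dist ?m (E \<inter> cball a r - euclidean_cone a V s) < ennreal (1 / 4)"
    unfolding eventually_at_right_field by blast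
  obtain d where d: "d > 0" "\<And>y. norm (y - x) < d \<Longrightarrow> norm (F y - F x - T (y - x)) \<le> s * norm (y - x)"
    using has_derivative_atD[OF T(1) s(1)] by blast
  have "hausdorff dist ?m (?S \<inter> cball a r) \<le> ennreal (r ^ ?m / 2)" if r: "0 < r" "r < min r1 (d / c)" for r
  proof -
    define R where "R = c * r"
    have R: "R > 0" "r \<le> R" "R < d" using r c by (auto simp: R_def field_simps)
    let ?A = "E \<inter> cball a r - euclidean_cone a V s"
    let ?B = "F ` {y. norm (y - x) \<le> R \<and> \<bar>k \<bullet> (y - x)\<bar> \<le> R / real M}"
    have A: "hausdorff dist ?m ?A \<le> ennreal (r ^ ?m / 4)"
    proof -
      have "hausdorff dist ?m ?A = ennreal (r ^ ?m) * (ennreal (1 / r ^ ?m) * hausdorff dist ?m ?A)"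
        using r by (simp add: mult.assoc[symmetric] ennreal_mult[symmetric])
      also have "\<dots> \<le> ennreal (r ^ ?m) * ennreal (1 / 4)" using r1(2)[of r] r by (intro mult_left_mono less_imp_le) auto
      also have "\<dots> = ennreal (r ^ ?m / 4)" using r by (subst ennreal_mult[symmetric]) auto
      finally show ?thesis .
    qed
    have B: "hausdorff dist ?m ?B \<le> ennreal (r ^ ?m / 4)"
    proof -
      have "C * R ^ ?m / real M = (C * c ^ ?m / real M) * r ^ ?m" by (simp add: R_def power_mult_distrib)
      also have "\<dots> \<le> 1 / 4 * r ^ ?m" using M r by (intro mult_right_mono) auto
      finally have "ennreal (C * R ^ ?m / real M) \<le> ennreal (r ^ ?m / 4)" by (intro ennreal_leI) simp
      then show ?thesis using C(2)[OF M(1) R(1), of x] by (rule order_trans[rotated])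
    qed
    have "?S \<inter> cball a r \<subseteq> ?A \<union> ?B"
    proof
      fix p assume p: "p \<in> ?S \<inter> cball a r"
      show "p \<in> ?A \<union> ?B"
      proof (cases "p \<in> euclidean_cone a V s")
        case True
        obtain y where y: "y \<in> Y" "p = F y" using p by blast
        have pr: "norm (p - a) \<le> r" using p by (simp add: dist_norm norm_minus_commute)
        have "norm (y - x) \<le> c * norm (p - a)" using Y(2)[OF x(1) y(1)] x y by simp
        also have "\<dots> \<le> R" using pr c by (simp add: R_def)
        finally have yR: "norm (y - x) \<le> R" .
        have "\<bar>snd (p - a)\<bar> \<le> infdist (p - a) V" by (rule snd_le_infdist_horizontal[OF V(2) V0])
        also have "\<dots> \<le> s * norm (p - a)" using True by (simp add: euclidean_cone_def)
        also have "\<dots> \<le> s * R" using pr R s by (intro mult_left_mono) auto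
        finally have 1: "\<bar>snd (p - a)\<bar> \<le> s * R" .
        define e where "e = F y - F x - T (y - x)"
        have "\<bar>snd e\<bar> \<le> norm e" using norm_snd_le[of "snd e" "fst e"] by simp
        also have "\<dots> \<le> s * norm (y - x)" unfolding e_def using d(2) yR R by auto
        also have "\<dots> \<le> s * R" using yR s by (intro mult_left_mono) auto
        finally have 2: "\<bar>snd e\<bar> \<le> s * R" .
        have "k \<bullet> (y - x) = snd (p - a) - snd e" using k x y by (simp add: e_def)
        then have "\<bar>k \<bullet> (y - x)\<bar> \<le> s * R + s * R" using 1 2 by linarith
        also have "\<dots> = R / real M" unfolding distrib_right[symmetric] s(3) by simp
        finally show ?thesis using yR y by blast
      qed (use p in blast)
    qed
    then have "hausdorff dist ?m (?S \<inter> cball a r) \<le> hausdorff dist ?m (?A \<union> ?B)" by (rule hausdorff_mono)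
    also have "\<dots> \<le> hausdorff dist ?m ?A + hausdorff dist ?m ?B" by (rule hausdorff_Un) simp
    also have "\<dots> \<le> ennreal (r ^ ?m / 4) + ennreal (r ^ ?m / 4)" by (rule add_mono[OF A B])
    also have "\<dots> = ennreal (r ^ ?m / 2)" using r by (subst ennreal_plus[symmetric]) auto
    finally show ?thesis .
  qed
  moreover have "min r1 (d / c) > 0" using r1 d c by simp
  ultimately show "\<exists>r0>0. \<forall>r. 0 < r \<and> r < r0 \<longrightarrow> hausdorff dist ?m (?S \<inter> cball a r) \<le> ennreal (r ^ ?m / 2)"
    by blast
qed simp

text \<open>An injective derivative gives a lower bound for the increments of \<open>F\<close> near
  \<open>x\<close>, with constant and scale depending on \<open>x\<close>. Countably many small
  pieces make both uniform.\<close>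

lemma horizontal_tangents_null:
  fixes F :: "real ^ 'm::finite \<Rightarrow> 'n::finite pspace"
  assumes lip: "L-lipschitz_on UNIV F" and fin: "hausdorff dist CARD('m) E < \<infinity>"
  shows "hausdorff dist CARD('m) ({a\<in>E. \<exists>V. approx_tangent_plane CARD('m) E a V \<and> V \<subseteq> horizontal} \<inter> F ` {x. vertical_point F x}) = 0"
    (is "hausdorff _ _ (?S \<inter> _) = 0")
proof -
  have lip': "(max L 1)-lipschitz_on UNIV F" and L: "max L 1 \<ge> 1"
    using lipschitz_on_mono[OF lip, of UNIV "max L 1"] by auto
  obtain D :: "(real ^ 'm) set" where D: "countable D" "\<And>X. open X \<Longrightarrow> X \<noteq> {} \<Longrightarrow> \<exists>d\<in>D. d \<in> X"
    using countable_dense_setE by blast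
  define Y where "Y = (\<lambda>(j :: nat, d). {x \<in> ball d (1 / (2 * real (Suc j))). vertical_point F x \<and>
     (\<forall>y. norm (y - x) < 1 / Suc j \<longrightarrow> norm (y - x) \<le> real (Suc j) * norm (F y - F x))})"
  have "hausdorff dist CARD('m) (?S \<inter> F ` Y i) = 0" for i
  proof -
    obtain j d where i: "i = (j, d)" by fastforce
    show ?thesis
    proof (rule horizontal_tangent_piece_null[OF lip' L _ _ _ fin, where c = "real (Suc j)"])
      fix x y assume xy: "x \<in> Y i" "y \<in> Y i"
      have "dist y x < 1 / (2 * real (Suc j)) + 1 / (2 * real (Suc j))"
        using xy dist_triangle3[of y x d] by (auto simp: Y_def i)
      then have "norm (y - x) < 1 / Suc j" by (simp add: dist_norm field_simps)
      then show "norm (y - x) \<le> real (Suc j) * norm (F y - F x)" using xy(1) by (simp add: Y_def i)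
    qed (auto simp: Y_def i)
  qed
  then have "hausdorff dist CARD('m) (\<Union>i\<in>UNIV \<times> D. ?S \<inter> F ` Y i) = 0"
    using D by (intro hausdorff_null_UN) auto
  moreover have "?S \<inter> F ` {x. vertical_point F x} \<subseteq> (\<Union>i\<in>UNIV \<times> D. ?S \<inter> F ` Y i)"
  proof
    fix p assume p: "p \<in> ?S \<inter> F ` {x. vertical_point F x}"
    then obtain x where x: "p = F x" "vertical_point F x" by blast
    then obtain T where T: "(F has_derivative T) (at x)" "inj T" by (auto simp: vertical_point_def)
    obtain c where c: "c > 0" "\<And>v. c * norm v \<le> norm (T v)"
      using linear_inj_bounded_below_pos[OF has_derivative_linear[OF T(1)] T(2)] by (metis mult.commute)
    obtain d where d: "d > 0" "\<And>y. norm (y - x) < d \<Longrightarrow> norm (F y - F x - T (y - x)) \<le> c / 2 * norm (y - x)"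
      using has_derivative_atD[OF T(1), of "c / 2"] c(1) by auto
    \<comment> \<open>One index serves for the scale and for the constant: half of the lower bound
      \<open>c\<close> of the derivative survives the linearisation error.\<close>
    obtain j where j: "1 / Suc j < min d (c / 2)" using c(1) d(1) nat_approx_posE[of "min d (c / 2)"] by auto
    have "norm (y - x) \<le> real (Suc j) * norm (F y - F x)" if "norm (y - x) < 1 / Suc j" for y
    proof -
      have "norm (F y - F x - T (y - x)) \<le> c / 2 * norm (y - x)" using d(2) that j by auto
      moreover have "norm (T (y - x)) \<le> norm (F y - F x) + norm (F y - F x - T (y - x))"
        using norm_triangle_ineq4[of "F y - F x" "F y - F x - T (y - x)"] by simp
      ultimately have "c / 2 * norm (y - x) \<le> norm (F y - F x)" using c(2)[of "y - x"] by linarith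
      moreover have "1 / Suc j * norm (y - x) \<le> c / 2 * norm (y - x)" using j by (intro mult_right_mono) auto
      ultimately have "1 / Suc j * norm (y - x) \<le> norm (F y - F x)" by linarith
      then show ?thesis by (simp add: field_simps)
    qed
    moreover have "ball x (1 / (2 * real (Suc j))) \<noteq> {}" by simp
    then obtain z where z: "z \<in> D" "z \<in> ball x (1 / (2 * real (Suc j)))" using D(2)[OF open_ball] by blast
    ultimately have "x \<in> Y (j, z)" using x(2) by (auto simp: Y_def dist_commute)
    then have "p \<in> ?S \<inter> F ` Y (j, z)" using p x by blast
    then show "p \<in> (\<Union>i\<in>UNIV \<times> D. ?S \<inter> F ` Y i)" using z(1) by blast
  qed
  ultimately show ?thesis by (rule hausdorff_null_subset)
qed

section \<open>Assembly\<close>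

lemma euclidean_rectifiable_extended:
  fixes E :: "'n::finite pspace set"
  assumes "euclidean_rectifiable TYPE('m::finite) E"
  obtains F :: "nat \<Rightarrow> real ^ 'm \<Rightarrow> 'n pspace" and B :: "nat \<Rightarrow> real"
  where "\<And>i. (B i)-lipschitz_on UNIV (F i)"
    "hausdorff dist CARD('m) (E - (\<Union>i. range (F i))) = 0"
proof -
  obtain A :: "nat \<Rightarrow> (real ^ 'm) set" and f :: "nat \<Rightarrow> real ^ 'm \<Rightarrow> 'n pspace" where
    f: "\<And>i. \<exists>C. C-lipschitz_on (A i) (f i)" and null: "hausdorff dist CARD('m) (E - (\<Union>i. f i ` A i)) = 0"
    using assms unfolding euclidean_rectifiable_def by blast
  \<comment> \<open>Derivatives are to be taken at arbitrary parameter points, so the maps are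
    extended to the whole space; larger images only shrink the remainder.\<close>
  have "\<exists>B g. B-lipschitz_on UNIV g \<and> (\<forall>x\<in>A i. g x = f i x)" for i
  proof -
    obtain C where "C-lipschitz_on (A i) (f i)" using f by blast
    then obtain B g where "B-lipschitz_on UNIV g" "\<And>x. x \<in> A i \<Longrightarrow> g x = f i x"
      by (rule Lipschitz_extension) (rule that)
    then show ?thesis by blast
  qed
  then obtain B F where F: "\<And>i. (B i)-lipschitz_on UNIV (F i)" "\<And>i x. x \<in> A i \<Longrightarrow> F i x = f i x" by metis
  have "f i ` A i \<subseteq> range (F i)" for i
  proof
    fix p assume "p \<in> f i ` A i"
    then obtain x where "x \<in> A i" "p = f i x" by blast
    then show "p \<in> range (F i)" using F(2)[of x i] by (metis rangeI)
  qed
  then have "E - (\<Union>i. range (F i)) \<subseteq> E - (\<Union>i. f i ` A i)" by blast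
  then have "hausdorff dist CARD('m) (E - (\<Union>i. range (F i))) = 0" by (rule hausdorff_null_subset[OF null])
  then show thesis using that F(1) by blast
qed

theorem euclidean_rectifiable_imp_vertically_parabolic_rectifiable:
  fixes E :: "'n::finite pspace set"
  assumes dims: "CARD('m::finite) < CARD('n) + 1" and E: "euclidean_rectifiable TYPE('m) E"
  shows "vertically_parabolic_rectifiable (CARD('m) + 1) E"
  unfolding vertically_parabolic_rectifiable_def
proof (intro allI impI)
  let ?k = "CARD('m) + 1"
  fix L :: real assume L: "L > 0"
  obtain F :: "nat \<Rightarrow> real ^ 'm \<Rightarrow> 'n pspace" and B where F: "\<And>i. (B i)-lipschitz_on UNIV (F i)"
    and null: "hausdorff dist CARD('m) (E - (\<Union>i. range (F i))) = 0"
    by (rule euclidean_rectifiable_extended[OF E]) (rule that)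
  have "\<exists>\<G>. countable \<G> \<and> (\<forall>G\<in>\<G>. vertical_lipschitz_graph ?k L G) \<and> F i ` {x. vertical_point (F i) x} \<subseteq> \<Union>\<G>" for i
    by (rule vertical_points_image_covered[OF F L dims])
  then obtain \<G> where \<G>: "\<And>i. countable (\<G> i)" "\<And>i G. G \<in> \<G> i \<Longrightarrow> vertical_lipschitz_graph ?k L G"
    "\<And>i. F i ` {x. vertical_point (F i) x} \<subseteq> \<Union>(\<G> i)" by metis
  \<comment> \<open>The empty graph makes the family nonempty, so it can be enumerated by all
    natural numbers.\<close>
  define \<H> where "\<H> = insert {} (\<Union>i. \<G> i)"
  have \<H>: "countable \<H>" "\<H> \<noteq> {}" using \<G>(1) by (auto simp: \<H>_def)
  have "vertical_lipschitz_graph ?k L G" if "G \<in> \<H>" for G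
    using that \<G>(2) vertical_lipschitz_graph_empty[OF _ dims] by (auto simp: \<H>_def)
  then have "\<forall>i. vertical_lipschitz_graph ?k L (from_nat_into \<H> i)"
    using from_nat_into[OF \<H>(2)] by simp
  moreover have "hausdorff pdist ?k (E - (\<Union>i. from_nat_into \<H> i)) = 0"
  proof -
    have "hausdorff pdist ?k ((E - (\<Union>i. range (F i))) \<union> (\<Union>i. F i ` {x. \<not> vertical_point (F i) x})) = 0"
      by (intro hausdorff_null_Un hausdorff_pdist_null[OF _ null] hausdorff_null_UN
          non_vertical_points_image_null[OF F]) auto
    moreover have "E - (\<Union>i. from_nat_into \<H> i) \<subseteq> (E - (\<Union>i. range (F i))) \<union> (\<Union>i. F i ` {x. \<not> vertical_point (F i) x})"
    proof
      fix p assume p: "p \<in> E - (\<Union>i. from_nat_into \<H> i)"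
      have "(\<Union>i. from_nat_into \<H> i) = \<Union>\<H>" using range_from_nat_into[OF \<H>(2,1)] by simp
      then have "p \<notin> \<Union>(\<G> i)" for i using p by (auto simp: \<H>_def)
      then have "p \<notin> F i ` {x. vertical_point (F i) x}" for i using \<G>(3) by blast
      then show "p \<in> (E - (\<Union>i. range (F i))) \<union> (\<Union>i. F i ` {x. \<not> vertical_point (F i) x})" using p by blast
    qed
    ultimately show ?thesis by (rule hausdorff_null_subset)
  qed
  ultimately have "(\<forall>i. vertical_lipschitz_graph ?k L (from_nat_into \<H> i)) \<and> hausdorff pdist ?k (E - (\<Union>i. from_nat_into \<H> i)) = 0"
    by (rule conjI)
  then show "\<exists>G :: nat \<Rightarrow> _. (\<forall>i. vertical_lipschitz_graph ?k L (G i)) \<and> hausdorff pdist ?k (E - (\<Union>i. G i)) = 0"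
    by (rule exI[of _ "from_nat_into \<H>"])
qed

lemma vertically_parabolic_rectifiable_imp_parabolic_rectifiable:
  assumes "vertically_parabolic_rectifiable k E"
  shows "parabolic_rectifiable k E"
  unfolding parabolic_rectifiable_def
proof (intro allI impI)
  fix L :: real assume "L > 0"
  then obtain G :: "nat \<Rightarrow> _" where G: "\<forall>i. vertical_lipschitz_graph k L (G i)"
    "hausdorff pdist k (E - (\<Union>i. G i)) = 0"
    using assms[unfolded vertically_parabolic_rectifiable_def, rule_format] by metis
  have "(\<forall>i. lipschitz_graph k L (G i)) \<and> hausdorff pdist k (E - (\<Union>i. G i)) = 0"
    using G by (auto simp: vertical_lipschitz_graph_def lipschitz_graph_def planes_P_def)
  then show "\<exists>G :: nat \<Rightarrow> _. (\<forall>i. lipschitz_graph k L (G i)) \<and> hausdorff pdist k (E - (\<Union>i. G i)) = 0"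
    by (rule exI[of _ G])
qed

theorem horizontal_tangents_imp_parabolic_null:
  fixes E :: "'n::finite pspace set"
  assumes E: "euclidean_rectifiable TYPE('m::finite) E" and fin: "hausdorff dist CARD('m) E < \<infinity>"
    and tan: "hausdorff_ae dist CARD('m) E (\<lambda>a. \<exists>V. approx_tangent_plane CARD('m) E a V \<and> V \<subseteq> horizontal)"
  shows "hausdorff pdist (CARD('m) + 1) E = 0"
proof -
  obtain F :: "nat \<Rightarrow> real ^ 'm \<Rightarrow> 'n pspace" and B where F: "\<And>i. (B i)-lipschitz_on UNIV (F i)"
    and null: "hausdorff dist CARD('m) (E - (\<Union>i. range (F i))) = 0"
    by (rule euclidean_rectifiable_extended[OF E]) (rule that)
  let ?Q = "\<lambda>a. \<exists>V. approx_tangent_plane CARD('m) E a V \<and> V \<subseteq> horizontal"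
  \<comment> \<open>\<open>?N1\<close> is null already for the Euclidean measure. Images of points
    with degenerate derivative, as with a horizontal one, can have positive Euclidean measure; they
    form \<open>?N2\<close> and are null only in the parabolic sense.\<close>
  let ?N1 = "{a\<in>E. \<not> ?Q a} \<union> ((E - (\<Union>i. range (F i))) \<union> (\<Union>i. {a\<in>E. ?Q a} \<inter> F i ` {x. vertical_point (F i) x}))"
  let ?N2 = "\<Union>i. F i ` {x. \<not> vertical_point (F i) x}"
  have "hausdorff dist CARD('m) (\<Union>i. {a\<in>E. ?Q a} \<inter> F i ` {x. vertical_point (F i) x}) = 0"
    by (intro hausdorff_null_UN horizontal_tangents_null[OF F fin]) auto
  then have "hausdorff dist CARD('m) ?N1 = 0"
    by (intro hausdorff_null_Un null tan[unfolded hausdorff_ae_def]) auto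
  then have N1: "hausdorff pdist (CARD('m) + 1) ?N1 = 0" by (intro hausdorff_pdist_null) auto
  have N2: "hausdorff pdist (CARD('m) + 1) ?N2 = 0"
    using non_vertical_points_image_null[OF F] by (intro hausdorff_null_UN) auto
  have "hausdorff pdist (CARD('m) + 1) (?N1 \<union> ?N2) = 0" by (rule hausdorff_null_Un[OF _ N1 N2]) simp
  moreover have "E \<subseteq> ?N1 \<union> ?N2" by blast
  ultimately show ?thesis by (rule hausdorff_null_subset)
qed

theorem theorem6p2:
  fixes E :: "'n::finite pspace set" and m :: nat
  assumes "m = CARD('m::finite)" and "m < CARD('n) + 1"
    and "hausdorff_measurable dist m E"
    and "euclidean_rectifiable TYPE('m) E"
  shows "parabolic_rectifiable (m + 1) E \<and>
    (hausdorff dist m E < \<infinity> \<longrightarrow>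
       (hausdorff_ae dist m E (\<lambda>a. \<exists>V. approx_tangent_plane m E a V \<and> \<not> V \<subseteq> horizontal)
          \<longrightarrow> vertically_parabolic_rectifiable (m + 1) E) \<and>
       (hausdorff_ae dist m E (\<lambda>a. \<exists>V. approx_tangent_plane m E a V \<and> V \<subseteq> horizontal)
          \<longrightarrow> hausdorff pdist (m + 1) E = 0))"
proof -
  have "vertically_parabolic_rectifiable (m + 1) E"
    using euclidean_rectifiable_imp_vertically_parabolic_rectifiable[where 'm = 'm, of E] assms by simp
  then show ?thesis
    using vertically_parabolic_rectifiable_imp_parabolic_rectifiable[of "m + 1" E]
      horizontal_tangents_imp_parabolic_null[where 'm = 'm, of E] assms by simp
qed

end
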